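(* Let $n_1,\dots,n_d\in\mathbb{N}$ and $z_1,\dots,z_{d-1}\in\mathbb{C}_\infty$. Then: (1) If $z_d\in\mathbb{C}_\infty$ and $(z_1,\dots,z_d)\in\mathbb{D}^\star$, then $\vec{\mathrm{Li}}^\star_{n_1,\dots,n_d}(z_1,\dots,z_d)$ is congruent modulo $M^{\star,z_1,\dots,z_{d-1}}_{n_1,\dots,n_d}$ to $\big(\mathrm{Li}^\star_{n_1,\dots,n_d}(z_1,\dots,z_d),\tilde\pi^{n_1}\mathrm{Li}^\star_{n_2,\dots,n_d}(z_2,\dots,z_d),\dots,\tilde\pi^{n_1+\dots+n_{d-1}}\mathrm{Li}^\star_{n_d}(z_d)\big)^{\mathtt T}$. (2) The map $z_d\mapsto\vec{\mathrm{Li}}^\star_{n_1,\dots,n_d}(z_1,\dots,z_{d-1},z_d)$, $\mathbb{C}_\infty\to\mathbb{C}_\infty^d/M^{\star,z_1,\dots,z_{d-1}}_{n_1,\dots,n_d}$, is locally rigid-analytic: for each $z\in\mathbb{C}_\infty$ there exist a closed disk $U\ni z$ and a closed polydisk $V\subset\mathbb{C}_\infty^d$ injecting into the quotient and containing the image of $U$, such that the induced map $U\to V$ is given by rigid analytic functions.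
   Context: Notation: $q$ a prime power, $A=\mathbb{F}_q[\theta]$, $|\theta|_\infty=q$, $\mathbb{C}_\infty$ the completion of an algebraic closure of $\mathbb{F}_q((1/\theta))$. $\mathbb{T}\subset\mathbb{C}_\infty[[t]]$ the Tate algebra; twist $(\sum a_it^i)^{(1)}=\sum a_i^qt^i$; $\wp(f)=f-f^{(1)}$ is surjective $\mathbb{T}\to\mathbb{T}$, $\mathbb{F}_q[t]$-linear, kernel $\mathbb{F}_q[t]$. Fix a $(q-1)$-th root of $-\theta$, $\Omega=(-\theta)^{-q/(q-1)}\prod_{i\ge1}(1-t/\theta^{q^i})$ (entire, invertible in $\mathbb{T}$), $\tilde\pi=1/\Omega(\theta)$. $L_0=1$, $L_i=(\theta-\theta^q)\cdots(\theta-\theta^{q^i})$; the Carlitz multiple star polylogarithm is $\mathrm{Li}^\star_{m_1,\dots,m_r}(x_1,\dots,x_r)=\sum_{0\le i_1\le\dots\le i_r}x_1^{q^{i_1}}\cdots x_r^{q^{i_r}}/(L_{i_1}^{m_1}\cdots L_{i_r}^{m_r})$, converging on $\mathbb{D}^\star=\{(x_j):\prod_j(|x_j|_\infty q^{-qm_j/(q-1)})^{q^{i_j}}\to0$ as $0\le i_1\le\dots\le i_r\to\infty\}$; $\mathbb{D}^\star$ in the claim is this region for $(n_1,\dots,n_d)$. Construction: star depth-$r$ system for $Y_1,\dots,Y_r\in\mathbb{T}$: $(F_1,\dots,F_r)\in\mathbb{T}^r$ with $\wp(F_i)=Y_{r-i+1}F_{i-1}$, $F_0=1$ (solutions exist).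 Let $w=\sum n_i$, view $z_i$ as constants in $\mathbb{T}$, $Y_i=\Omega^{n_i}z_i$. For $0\le k\le d-1$ choose a solution $(G_1,\dots,G_k)$ of the star depth-$k$ system for $(Y_1,\dots,Y_k)$; the generator is $\Omega^{-w}(G_k,\dots,G_1,1,0,\dots,0)^{\mathtt T}$ ($d-k-1$ zeros). For $z_d\in\mathbb{C}_\infty$, $\vec{\mathfrak{Li}}^\star_{n_1,\dots,n_d}(z_1,\dots,z_d)$ is the set of vectors $\Omega^{-w}(F_d,\dots,F_1)^{\mathtt T}$ with $(F_i)$ a solution of the star depth-$d$ system for $(Y_1,\dots,Y_d)$, a coset of the $\mathbb{F}_q[t]$-module spanned by the generators. All these vectors can be evaluated at $t=\theta$. The monodromy module $M^{\star,z_1,\dots,z_{d-1}}_{n_1,\dots,n_d}\subset\mathbb{C}_\infty^d$ is the $A$-module generated by the values at $t=\theta$ of the $d$ generators (independent of choices), and $\vec{\mathrm{Li}}^\star_{n_1,\dots,n_d}(z_1,\dots,z_d)\in\mathbb{C}_\infty^d/M^{\star,z_1,\dots,z_{d-1}}_{n_1,\dots,n_d}$ is the class of the value at $t=\theta$ of any element of $\vec{\mathfrak{Li}}^\star_{n_1,\dots,n_d}(z_1,\dots,z_d)$.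
   Formalization: Part (1) also assumes that each tail (z_{i+1},…,z_d) lies in the region D* for (n_{i+1},…,n_d), so that every series in the displayed vector converges; this is automatic unless some z_j with j<d is 0, when a displayed series may diverge. *)

theory Defs
  imports
    "HOL-Analysis.Infinite_Sum"
    "HOL-Analysis.Elementary_Metric_Spaces"
    "HOL-Computational_Algebra.Formal_Laurent_Series"
    "HOL-Library.Cardinality"
    "HOL-Algebra.Algebraic_Closure_Type"
    "Jordan_Normal_Form.Matrix"
begin

section \<open>The field of definition\<close>

text \<open>
  Fields with a non-archimedean absolute value. The normed fields of the library are algebras over the
  reals, so the absolute value of \<open>x\<close> is expressed as its distance from \<open>0\<close>.
\<close>

class nonarch_field = field + metric_space +
  assumes dist_eq_dist_diff: "dist x y = dist (x - y) 0"
    and dist_mult_zero: "dist (x * y) 0 = dist x 0 * dist y 0"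
    and dist_add_zero_le: "dist (x + y) 0 \<le> max (dist x 0) (dist y 0)"

abbreviation vabs :: "'a::nonarch_field \<Rightarrow> real"
  where "vabs x \<equiv> dist x 0"

definition value_group :: "'a::nonarch_field itself \<Rightarrow> real set"
  where "value_group _ = vabs ` (UNIV - {0 :: 'a})"

text \<open>
  \<open>'k\<close> is \<open>\<bbbF>\<^sub>q\<close>, and \<open>'k fls\<close> is \<open>\<bbbF>\<^sub>q((1/\<theta>))\<close> with the formal variable standing for \<open>1/\<theta>\<close>, so that
  \<open>fls_X_inv\<close> is \<open>\<theta>\<close>. The locale says that the complete field \<open>'c\<close>, together with the embedding
  \<open>\<iota>\<close> of an algebraic closure of \<open>'k fls\<close>, is a completion of this algebraic closure with respect to
  an absolute value extending the one of \<open>'k fls\<close>; this determines \<open>'c\<close> up to isometric isomorphism.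
\<close>

locale C_infinity = field_hom \<iota>
  for \<iota> :: "'k::{field,finite} fls alg_closure \<Rightarrow> 'c::{nonarch_field,complete_space}" +
  assumes vabs_laurent: "f \<noteq> 0 \<Longrightarrow> vabs (\<iota> (to_ac f)) = real CARD('k) powi (- fls_subdegree f)"
    and dense_range: "closure (range \<iota>) = UNIV"

text \<open>The ring \<open>A = \<bbbF>\<^sub>q[\<theta>]\<close> inside \<open>\<complex>\<^sub>\<infinity>\<close>.\<close>

definition ring_A :: "('k::{field,finite} fls alg_closure \<Rightarrow> 'c::nonarch_field) \<Rightarrow> 'c set"
  where "ring_A \<iota> =
    range (\<lambda>p :: 'k poly. poly (map_poly (\<lambda>c. \<iota> (to_ac (fls_const c))) p) (\<iota> (to_ac fls_X_inv)))"

section \<open>The Tate algebra\<close>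

definition tate_algebra :: "'c::nonarch_field fps set"
  where "tate_algebra = {f. fps_nth f \<longlonglongrightarrow> 0}"

definition twist :: "nat \<Rightarrow> 'c::nonarch_field fps \<Rightarrow> 'c fps"
  where "twist q f = Abs_fps (\<lambda>i. fps_nth f i ^ q)"

definition wp :: "nat \<Rightarrow> 'c::nonarch_field fps \<Rightarrow> 'c fps"
  where "wp q f = f - twist q f"

definition eval_at :: "'c::nonarch_field \<Rightarrow> 'c fps \<Rightarrow> 'c"
  where "eval_at x f = (\<Sum>i. fps_nth f i * x ^ i)"

text \<open>
  Here \<open>lam\<close> is the chosen \<open>(q - 1)\<close>-th root of \<open>- \<theta>\<close>, so that \<open>(-\<theta>)\<^bsup>-q/(q-1)\<^esup>\<close> is \<open>lam\<^bsup>-q\<^esup>\<close>. The infinite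
  product is formed coefficientwise in \<open>\<complex>\<^sub>\<infinity>\<close>; it does not converge in the \<open>t\<close>-adic topology
  that the library puts on formal power series.
\<close>

definition Omega :: "nat \<Rightarrow> 'c::nonarch_field \<Rightarrow> 'c \<Rightarrow> 'c fps"
  where "Omega q \<theta> lam = fps_const (inverse (lam ^ q)) *
    Abs_fps (\<lambda>m. lim (\<lambda>N. fps_nth (\<Prod>i=1..N. 1 - fps_const (inverse (\<theta> ^ (q ^ i))) * fps_X) m))"

definition carlitz_period :: "nat \<Rightarrow> 'c::nonarch_field \<Rightarrow> 'c \<Rightarrow> 'c"
  where "carlitz_period q \<theta> lam = 1 / eval_at \<theta> (Omega q \<theta> lam)"

section \<open>Carlitz multiple star polylogarithms\<close>

text \<open>Tuples of indices and of arguments are lists, so the entry \<open>x\<^sub>j\<close> is \<open>xs ! (j - 1)\<close>.\<close>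

definition L_poly :: "nat \<Rightarrow> 'c::nonarch_field \<Rightarrow> nat \<Rightarrow> 'c"
  where "L_poly q \<theta> i = (\<Prod>k=1..i. \<theta> - \<theta> ^ (q ^ k))"

definition weakly_increasing :: "nat \<Rightarrow> nat list set"
  where "weakly_increasing r = {I. length I = r \<and> sorted I}"

definition Li_star :: "nat \<Rightarrow> 'c::nonarch_field \<Rightarrow> nat list \<Rightarrow> 'c list \<Rightarrow> 'c"
  where "Li_star q \<theta> ms xs =
    (\<Sum>\<^sub>\<infinity>I\<in>weakly_increasing (length ms).
       \<Prod>j<length ms. (xs ! j) ^ (q ^ (I ! j)) / L_poly q \<theta> (I ! j) ^ (ms ! j))"

definition D_star :: "nat \<Rightarrow> nat list \<Rightarrow> 'c::nonarch_field list set"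
  where "D_star q ms = {xs. length xs = length ms \<and>
    (\<forall>e>0. \<exists>N. \<forall>I\<in>weakly_increasing (length ms). last I \<ge> N \<longrightarrow>
       (\<Prod>j<length ms.
          (vabs (xs ! j) * real q powr (- (real q * real (ms ! j) / (real q - 1)))) ^ (q ^ (I ! j))) < e)}"

text \<open>
  If \<open>x\<^sub>j = 0\<close> for some \<open>j\<close>, then \<open>(x\<^sub>1, \<dots>, x\<^sub>r)\<close> lies in the region for trivial reasons and
  \<open>(x\<^sub>j\<^sub>+\<^sub>1, \<dots>, x\<^sub>r)\<close> need not. If the entries before the last one are nonzero, the region is
  stable under removing initial entries.
\<close>

lemma D_star_drop:
  assumes xs: "xs \<in> D_star q ms" and q: "q > 0" and i: "i < length ms"
    and nz: "\<And>j. j < i \<Longrightarrow> xs ! j \<noteq> 0"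
  shows "drop i xs \<in> D_star q (drop i ms)"
proof -
  define g where "g j = vabs (xs ! j) * real q powr (- (real q * real (ms ! j) / (real q - 1)))" for j
  define n where "n = length ms - i"
  define c where "c = (\<Prod>j<i. g j)"
  have len: "length xs = length ms"
    using xs by (simp add: D_star_def)
  have conv: "\<exists>N. \<forall>I\<in>weakly_increasing (length ms). last I \<ge> N \<longrightarrow>
       (\<Prod>j<length ms. g j ^ (q ^ (I ! j))) < e" if "e > 0" for e
    using xs that by (auto simp: D_star_def g_def)
  have n: "n > 0" "length ms = i + n"
    using i by (auto simp: n_def)
  have c: "c > 0"
    unfolding c_def by (rule prod_pos) (use nz q in \<open>auto simp: g_def\<close>)
  have "\<exists>N. \<forall>J\<in>weakly_increasing n. last J \<ge> N \<longrightarrow> (\<Prod>j<n. g (i + j) ^ (q ^ (J ! j))) < e"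
    if e: "e > 0" for e
  proof -
    obtain N where N: "\<And>I. I \<in> weakly_increasing (length ms) \<Longrightarrow> last I \<ge> N \<Longrightarrow>
        (\<Prod>j<length ms. g j ^ (q ^ (I ! j))) < e * c"
      using conv[of "e * c"] e c by auto
    have "(\<Prod>j<n. g (i + j) ^ (q ^ (J ! j))) < e" if J: "J \<in> weakly_increasing n" "last J \<ge> N" for J
    proof -
      define I where "I = replicate i 0 @ J"
      have "I \<in> weakly_increasing (length ms)" "last I \<ge> N"
        using J n by (auto simp: I_def weakly_increasing_def sorted_append)
      then have "(\<Prod>j<length ms. g j ^ (q ^ (I ! j))) < e * c"
        by (rule N)
      also have "(\<Prod>j<length ms. g j ^ (q ^ (I ! j))) =
          (\<Prod>j<i. g j ^ (q ^ (I ! j))) * (\<Prod>j<n. g (i + j) ^ (q ^ (I ! (i + j))))"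
        unfolding n(2) lessThan_atLeast0
        using prod.atLeastLessThan_concat[of 0 i "i + n" "\<lambda>j. g j ^ (q ^ (I ! j))"]
        by (simp add: prod.atLeastLessThan_shift_0[of _ i] o_def)
      also have "(\<Prod>j<i. g j ^ (q ^ (I ! j))) = c"
        unfolding c_def by (rule prod.cong) (auto simp: I_def nth_append)
      also have "(\<Prod>j<n. g (i + j) ^ (q ^ (I ! (i + j)))) = (\<Prod>j<n. g (i + j) ^ (q ^ (J ! j)))"
        by (rule prod.cong) (auto simp: I_def nth_append)
      finally show ?thesis
        using c by (simp add: mult.commute)
    qed
    then show ?thesis
      by blast
  qed
  then show ?thesis
    using len n by (simp add: D_star_def g_def)
qed

section \<open>Star systems and the vector-valued polylogarithm\<close>

text \<open>
  \<open>F 1, \<dots>, F r\<close> is a solution of the star system for \<open>Ys = [Y\<^sub>1, \<dots>, Y\<^sub>r]\<close>; the entry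
  \<open>Y\<^bsub>r-i+1\<^esub>\<close> is \<open>Ys ! (r - i)\<close>.
\<close>

definition star_solution :: "nat \<Rightarrow> 'c::nonarch_field fps list \<Rightarrow> (nat \<Rightarrow> 'c fps) \<Rightarrow> bool"
  where "star_solution q Ys F \<longleftrightarrow> F 0 = 1 \<and>
    (\<forall>i\<in>{1..length Ys}. F i \<in> tate_algebra \<and> wp q (F i) = Ys ! (length Ys - i) * F (i - 1))"

definition Y_seq :: "nat \<Rightarrow> 'c::nonarch_field \<Rightarrow> 'c \<Rightarrow> nat list \<Rightarrow> 'c list \<Rightarrow> 'c fps list"
  where "Y_seq q \<theta> lam ns zs = map2 (\<lambda>n z. Omega q \<theta> lam ^ n * fps_const z) ns zs"

text \<open>
  With \<open>d\<close> the length of \<open>ns\<close>, \<open>w\<close> its sum and \<open>G 0 = 1\<close>, this is the vector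
  \<open>\<Omega>\<^bsup>-w\<^esup> (G k, \<dots>, G 1, 1, 0, \<dots>, 0)\<close>.
\<close>

definition star_generator ::
    "nat \<Rightarrow> 'c::nonarch_field \<Rightarrow> 'c \<Rightarrow> nat list \<Rightarrow> nat \<Rightarrow> (nat \<Rightarrow> 'c fps) \<Rightarrow> 'c fps vec"
  where "star_generator q \<theta> lam ns k G = vec (length ns) (\<lambda>i.
    inverse (Omega q \<theta> lam) ^ sum_list ns * (if i \<le> k then G (k - i) else 0))"

text \<open>\<open>zs\<close> has the same length as \<open>ns\<close> here, the last entry being \<open>z\<^sub>d\<close>.\<close>

definition frak_Li_star ::
    "nat \<Rightarrow> 'c::nonarch_field \<Rightarrow> 'c \<Rightarrow> nat list \<Rightarrow> 'c list \<Rightarrow> 'c fps vec set"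
  where "frak_Li_star q \<theta> lam ns zs =
    {vec (length ns) (\<lambda>i. inverse (Omega q \<theta> lam) ^ sum_list ns * F (length ns - i)) | F.
       star_solution q (Y_seq q \<theta> lam ns zs) F}"

text \<open>
  \<open>G k\<close> is the solution chosen for the \<open>k\<close>-th generator, \<open>k < d\<close>; the module depends on
  \<open>z\<^sub>1, \<dots>, z\<^bsub>d-1\<^esub>\<close> only through these solutions.
\<close>

definition monodromy_module ::
    "('k::{field,finite} fls alg_closure \<Rightarrow> 'c::nonarch_field) \<Rightarrow> 'c \<Rightarrow> nat list \<Rightarrow>
      (nat \<Rightarrow> nat \<Rightarrow> 'c fps) \<Rightarrow> 'c vec set"
  where "monodromy_module \<iota> lam ns G =
    (let q = CARD('k); \<theta> = \<iota> (to_ac fls_X_inv); d = length ns in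
     {finsum_vec TYPE('c) d
        (\<lambda>k. a k \<cdot>\<^sub>v map_vec (eval_at \<theta>) (star_generator q \<theta> lam ns k (G k))) {..<d} | a.
        \<forall>k<d. a k \<in> ring_A \<iota>})"

definition residue_class :: "'c::nonarch_field vec set \<Rightarrow> 'c vec \<Rightarrow> 'c vec set"
  where "residue_class M v = {v + m | m. m \<in> M}"

text \<open>
  The union of the classes of the values of all elements of \<open>frak_Li_star\<close>; these classes
  coincide.
\<close>

definition vec_Li_star ::
    "nat \<Rightarrow> 'c::nonarch_field \<Rightarrow> 'c \<Rightarrow> nat list \<Rightarrow> 'c vec set \<Rightarrow> 'c list \<Rightarrow> 'c vec set"
  where "vec_Li_star q \<theta> lam ns M zs =
    (\<Union>f\<in>frak_Li_star q \<theta> lam ns zs. residue_class M (map_vec (eval_at \<theta>) f))"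

section \<open>Rigid analytic functions\<close>

definition polydisk :: "'c::nonarch_field vec \<Rightarrow> real vec \<Rightarrow> 'c vec set"
  where "polydisk c R = {v \<in> carrier_vec (dim_vec c). \<forall>i<dim_vec c. v $ i \<in> cball (c $ i) (R $ i)}"

definition rigid_analytic_on_cball :: "'c::nonarch_field \<Rightarrow> real \<Rightarrow> ('c \<Rightarrow> 'c) \<Rightarrow> bool"
  where "rigid_analytic_on_cball a r f \<longleftrightarrow>
    (\<exists>c. (\<lambda>k. vabs (c k) * r ^ k) \<longlonglongrightarrow> 0 \<and>
         (\<forall>x\<in>cball a r. (\<lambda>k. c k * (x - a) ^ k) sums f x))"

end

theory Submission
  imports Defs
begin

text \<open>
  Everything takes place in the ring of power series converging on the closed disk of radius
  \<open>\<bar>\<theta>\<bar> = q\<close>, on which evaluation at \<open>t = \<theta>\<close> is a continuous ring homomorphism. It contains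
  \<open>\<Omega>\<close>, \<open>1/\<Omega>\<close> and, since \<open>\<bar>a - a\<^sup>q\<bar> = \<bar>a\<bar>\<close> for \<open>\<bar>a\<bar> < 1\<close>, every solution of a star system.
  On \<open>D\<^sup>\<star>\<close> the series \<open>\<Sum> Y\<^sub>1\<^bsup>(i\<^sub>1)\<^esup> \<cdots> Y\<^sub>r\<^bsup>(i\<^sub>r)\<^esup>\<close> over \<open>i\<^sub>1 \<le> \<dots> \<le> i\<^sub>r\<close> converges there; splitting off
  the terms with \<open>i\<^sub>1 = 0\<close> shows that these series solve the star system, and the functional equation
  \<open>\<Omega> = (t - \<theta>\<^sup>q) \<Omega>\<^bsup>(1)\<^esup>\<close> turns their values at \<open>\<theta>\<close> into \<open>\<Omega>(\<theta>)\<^bsup>w\<^esup> Li\<^sup>\<star>\<close>.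
  Two solutions differ by an \<open>\<bbbF>\<^sub>q[t]\<close>-combination of the generators. The system is additive in the last
  argument, so a solution at \<open>z + u\<close> is a solution at \<open>z\<close> plus the series for a small \<open>u\<close>, which is a
  power series in \<open>u\<close>. Finally, the monodromy module is discrete because its generators form a
  triangular matrix with diagonal entries \<open>\<Omega>(\<theta>)\<^bsup>-w\<^esup>\<close>.
\<close>

section \<open>Non-archimedean fields\<close>

text \<open>The systems are posed on the unit disk, while \<open>\<theta>\<close> has absolute value
  \<open>q > 1\<close>; every estimate therefore has to be made at radius \<open>q\<close>. The
  zeros of \<open>\<Omega>\<close> are the \<open>\<theta>^(q^i)\<close> with
  \<open>i \<ge> 1\<close>, of absolute value at least \<open>q^q \<ge> q^2\<close>. Hence the
  auxiliary radius \<open>q^2\<close>: coefficient bounds there give convergence of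
  \<open>\<Omega>\<close> and of its inverse at radius \<open>q\<close>. At radius \<open>q\<close>
  the Gauss norm of \<open>\<Omega>^n\<close> is at most
  \<open>|lam|^(-q n) = q^(-q n/(q-1))\<close>, which is the weight in \<open>D_star\<close>; so
  membership in \<open>D_star\<close> controls the Gauss norms of the products of twists, not only
  the values of the polylogarithm. Near an arbitrary \<open>z\<close> the star series may diverge.
  For a small last argument it converges whatever the other arguments are, because the last index is
  the largest and its exponent beats all others; additivity then moves this expansion from
  \<open>0\<close> to \<open>z\<close>. The polydisk needs radii in the value group that lie below
  the separation \<open>|\<pi>^w|\<close> of the module; \<open>|\<pi>^w / \<theta>|\<close> is one,
  and the last argument is made small enough for the series to stay within it.\<close>

lemma vabs_one [simp]: "vabs (1 :: 'a::nonarch_field) = 1"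
  using dist_mult_zero[of "1::'a" 1] by simp

lemma vabs_minus [simp]: "vabs (- x :: 'a::nonarch_field) = vabs x"
proof -
  have "vabs (- 1 :: 'a) * vabs (- 1 :: 'a) = 1"
    using dist_mult_zero[of "- 1::'a" "- 1"] by simp
  then have "vabs (- 1 :: 'a) = 1"
    by (metis abs_of_nonneg abs_1 power2_eq_square power2_eq_1_iff zero_le_dist abs_minus_cancel)
  then show ?thesis
    using dist_mult_zero[of "- 1" x] by simp
qed

lemma vabs_diff_le: "vabs (x - y :: 'a::nonarch_field) \<le> max (vabs x) (vabs y)"
  using dist_add_zero_le[of x "- y"] by simp

lemma vabs_power: "vabs (x ^ n :: 'a::nonarch_field) = vabs x ^ n"
  by (induction n) (simp_all add: dist_mult_zero)

lemma vabs_inverse: "vabs (inverse x :: 'a::nonarch_field) = inverse (vabs x)"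
proof (cases "x = 0")
  case False
  then have "vabs (inverse x) * vabs x = 1"
    by (simp flip: dist_mult_zero)
  then show ?thesis
    by (metis inverse_unique mult.commute)
qed simp

lemma vabs_divide: "vabs (x / y :: 'a::nonarch_field) = vabs x / vabs y"
  by (simp add: divide_inverse dist_mult_zero vabs_inverse)

lemma vabs_sum_le:
  fixes f :: "'i \<Rightarrow> 'a::nonarch_field"
  assumes "\<And>i. i \<in> I \<Longrightarrow> vabs (f i) \<le> B" "B \<ge> 0"
  shows "vabs (\<Sum>i\<in>I. f i) \<le> B"
  using assms(1)
proof (induction I rule: infinite_finite_induct)
  case (insert i I)
  then have "vabs (f i + sum f I) \<le> max B B"
    by (intro order.trans[OF dist_add_zero_le]) (simp add: max.coboundedI1)
  with insert show ?case
    by simp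
qed (use assms(2) in auto)

text \<open>The bound from above is the ultrametric inequality; the one from below is the same
  inequality for \<open>y = (x + y) - x\<close>, where \<open>x\<close> is too small to account for
  \<open>y\<close>.\<close>

lemma vabs_add_eq_max:
  assumes "vabs (x :: 'a::nonarch_field) < vabs y"
  shows "vabs (x + y) = vabs y"
  using dist_add_zero_le[of x y] vabs_diff_le[of "x + y" x] assms
  by (auto simp: max_def split: if_splits)

lemma dist_ultrametric: "dist x z \<le> max (dist x y) (dist y (z :: 'a::nonarch_field))"
  using dist_add_zero_le[of "x - y" "y - z"] dist_eq_dist_diff[of x z] dist_eq_dist_diff[of x y]
    dist_eq_dist_diff[of y z] by simp

section \<open>Continuity of addition and multiplication\<close>

instance nonarch_field \<subseteq> topological_ab_group_add
proof
  fix a b :: 'a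
  have *: "dist (x + y) (a + b) \<le> dist x a + dist y b" for x y
  proof -
    have "dist (x + y) (a + b) \<le> max (dist x a) (dist y b)"
      using dist_add_zero_le[of "x - a" "y - b"] dist_eq_dist_diff[of "x + y" "a + b"]
        dist_eq_dist_diff[of x a] dist_eq_dist_diff[of y b] by (simp add: algebra_simps)
    also have "\<dots> \<le> dist x a + dist y b"
      by simp
    finally show ?thesis .
  qed
  have "((\<lambda>x. dist (fst x) a + dist (snd x) b) \<longlongrightarrow> dist a a + dist b b) (nhds a \<times>\<^sub>F nhds b)"
    by (intro tendsto_intros filterlim_fst filterlim_snd)
  then have lim: "((\<lambda>x. dist (fst x) a + dist (snd x) b) \<longlongrightarrow> 0) (nhds a \<times>\<^sub>F nhds b)"
    by simp
  show "((\<lambda>x. fst x + snd x) \<longlongrightarrow> a + b) (nhds a \<times>\<^sub>F nhds b)"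
    unfolding tendsto_dist_iff[of "\<lambda>x. fst x + snd x"]
    by (rule tendsto_sandwich[OF _ _ tendsto_const lim]) (simp_all add: *)
  have "dist (- x) (- a) = dist x a" for x
    by (metis dist_eq_dist_diff minus_diff_minus vabs_minus)
  then show "(uminus \<longlongrightarrow> - a) (nhds a)"
    unfolding tendsto_dist_iff[of uminus] using tendsto_dist_iff[of "\<lambda>x. x" a "nhds a"]
    by (simp add: filterlim_ident)
qed

instance nonarch_field \<subseteq> topological_comm_monoid_mult
proof
  fix a b :: 'a
  have *: "dist (x * y) (a * b) \<le> dist x a * dist y b + (vabs a * dist y b + dist x a * vabs b)" for x y
  proof -
    have "x * y - a * b = (x - a) * (y - b) + (a * (y - b) + (x - a) * b)"
      by (simp add: algebra_simps)
    then have "vabs (x * y - a * b) \<le> max (vabs ((x - a) * (y - b))) (max (vabs (a * (y - b))) (vabs ((x - a) * b)))"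
      by (simp only:) (intro order.trans[OF dist_add_zero_le] max.mono order.refl dist_add_zero_le)
    also have "\<dots> \<le> vabs ((x - a) * (y - b)) + (vabs (a * (y - b)) + vabs ((x - a) * b))"
      by (simp add: add_increasing2 add_increasing)
    finally show ?thesis
      by (simp add: dist_mult_zero flip: dist_eq_dist_diff)
  qed
  have "((\<lambda>x. dist (fst x) a * dist (snd x) b + (vabs a * dist (snd x) b + dist (fst x) a * vabs b))
      \<longlongrightarrow> dist a a * dist b b + (vabs a * dist b b + dist a a * vabs b)) (nhds a \<times>\<^sub>F nhds b)"
    by (intro tendsto_intros filterlim_fst filterlim_snd)
  then have lim: "((\<lambda>x. dist (fst x) a * dist (snd x) b + (vabs a * dist (snd x) b + dist (fst x) a * vabs b))
      \<longlongrightarrow> 0) (nhds a \<times>\<^sub>F nhds b)"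
    by simp
  show "((\<lambda>x. fst x * snd x) \<longlongrightarrow> a * b) (nhds a \<times>\<^sub>F nhds b)"
    unfolding tendsto_dist_iff[of "\<lambda>x. fst x * snd x"]
    by (rule tendsto_sandwich[OF _ _ tendsto_const lim]) (simp_all add: *)
qed

section \<open>Series and unordered sums in an ultrametric field\<close>

lemma nonarch_sums_mult: "f sums a \<Longrightarrow> (\<lambda>n. c * f n) sums (c * a)"
  for c :: "'a::nonarch_field"
  unfolding sums_def by (simp flip: sum_distrib_left) (intro tendsto_intros)

lemma nonarch_sums_imp_tendsto_zero:
  fixes f :: "nat \<Rightarrow> 'a::nonarch_field"
  assumes "f sums a"
  shows "f \<longlonglongrightarrow> 0"
proof -
  have lim: "(\<lambda>n. \<Sum>k<n. f k) \<longlonglongrightarrow> a"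
    using assms by (simp add: sums_def)
  have "(\<lambda>n. (\<Sum>k<Suc n. f k) - (\<Sum>k<n. f k)) \<longlonglongrightarrow> a - a"
    by (intro tendsto_diff lim LIMSEQ_Suc)
  then show ?thesis
    by simp
qed

text \<open>The distance of two terms is at most the largest of the consecutive distances between
  them, so errors do not accumulate.\<close>

lemma nonarch_Cauchy:
  fixes S :: "nat \<Rightarrow> 'a::nonarch_field"
  assumes "\<And>e. e > 0 \<Longrightarrow> \<exists>N. \<forall>n\<ge>N. dist (S (Suc n)) (S n) < e"
  shows "Cauchy S"
proof (rule metric_CauchyI)
  fix e :: real
  assume "e > 0"
  then obtain N where N: "\<And>n. n \<ge> N \<Longrightarrow> dist (S (Suc n)) (S n) < e"
    using assms by blast
  have *: "dist (S n) (S N) < e" if "n \<ge> N" for n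
    using that
  proof (induction n rule: dec_induct)
    case (step n)
    then show ?case
      using dist_ultrametric[of "S (Suc n)" "S N" "S n"] N[of n] by auto
  qed (use \<open>e > 0\<close> in simp)
  show "\<exists>M. \<forall>m\<ge>M. \<forall>n\<ge>M. dist (S m) (S n) < e"
  proof (intro exI allI impI)
    fix m n assume "m \<ge> N" "n \<ge> N"
    then show "dist (S m) (S n) < e"
      using dist_ultrametric[of "S m" "S n" "S N"] *[of m] *[of n] by (simp add: dist_commute)
  qed
qed

lemma nonarch_sums:
  fixes f :: "nat \<Rightarrow> 'a::{nonarch_field,complete_space}"
  assumes "f \<longlonglongrightarrow> 0"
  shows "f sums (\<Sum>n. f n)"
proof -
  have "Cauchy (\<lambda>n. \<Sum>k<n. f k)"
  proof (rule nonarch_Cauchy)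
    fix e :: real assume "e > 0"
    then have "\<exists>N. \<forall>n\<ge>N. vabs (f n) < e"
      using assms by (simp add: lim_sequentially)
    then show "\<exists>N. \<forall>n\<ge>N. dist (\<Sum>k<Suc n. f k) (\<Sum>k<n. f k) < e"
      by (subst dist_eq_dist_diff) simp
  qed
  then have "convergent (\<lambda>n. \<Sum>k<n. f k)"
    by (rule Cauchy_convergent)
  then show ?thesis
    by (simp add: summable_sums summable_iff_convergent)
qed

lemma vabs_limit_le:
  fixes S :: "nat \<Rightarrow> 'a::nonarch_field"
  assumes "S \<longlonglongrightarrow> x" "\<forall>\<^sub>F n in sequentially. vabs (S n) \<le> B"
  shows "vabs x \<le> B"
  by (rule tendsto_upperbound[OF tendsto_dist[OF assms(1) tendsto_const] assms(2)]) simp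

text \<open>The sum over a finite set containing \<open>W N\<close> differs from the sum over
  \<open>W N\<close> by at most the size of a term outside \<open>W N\<close>. The lemma yields both
  the unordered sum, by which \<open>Li_star\<close> is defined, and the limit along an exhaustion,
  in which the recursion for the series can be carried out.\<close>

lemma nonarch_has_sum:
  fixes f :: "'i \<Rightarrow> 'a::{nonarch_field,complete_space}"
  assumes fin: "\<And>N. finite (W N)" and sub: "\<And>N. W N \<subseteq> W (Suc N)" and A: "A = (\<Union>N. W N)"
    and small: "\<And>e. e > 0 \<Longrightarrow> \<exists>N. \<forall>I\<in>A - W N. vabs (f I) < e"
  shows "\<exists>s. (f has_sum s) A \<and> (\<lambda>N. sum f (W N)) \<longlonglongrightarrow> s"
proof -
  have mono: "W N \<subseteq> W M" if "N \<le> M" for N M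
    using sub that by (rule lift_Suc_mono_le)
  have diff: "dist (sum f S) (sum f (W N)) \<le> e"
    if "\<forall>I\<in>A - W N. vabs (f I) < e" "finite S" "W N \<subseteq> S" "S \<subseteq> A" "e > 0" for S N e
  proof -
    have "sum f S - sum f (W N) = sum f (S - W N)"
      using that by (simp add: sum_diff)
    also have "vabs \<dots> \<le> e"
      using that by (intro vabs_sum_le) (auto intro: less_imp_le)
    finally show ?thesis
      by (simp add: dist_eq_dist_diff[of "sum f S"])
  qed
  have "Cauchy (\<lambda>N. sum f (W N))"
  proof (rule nonarch_Cauchy)
    fix e :: real assume "e > 0"
    then obtain N where N: "\<forall>I\<in>A - W N. vabs (f I) < e / 2"
      using small[of "e / 2"] by auto
    have "dist (sum f (W (Suc n))) (sum f (W n)) < e" if "n \<ge> N" for n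
    proof -
      have "\<forall>I\<in>A - W n. vabs (f I) < e / 2"
        using N mono[OF that] by blast
      then have "dist (sum f (W (Suc n))) (sum f (W n)) \<le> e / 2"
        by (rule diff) (use fin sub A \<open>e > 0\<close> in auto)
      then show ?thesis
        using \<open>e > 0\<close> by simp
    qed
    then show "\<exists>N. \<forall>n\<ge>N. dist (sum f (W (Suc n))) (sum f (W n)) < e"
      by blast
  qed
  then obtain s where s: "(\<lambda>N. sum f (W N)) \<longlonglongrightarrow> s"
    using Cauchy_convergent convergent_def by blast
  have "(f has_sum s) A"
    unfolding has_sum_def tendsto_iff eventually_finite_subsets_at_top
  proof (intro allI impI)
    fix e :: real assume "e > 0"
    then obtain N where N: "\<forall>I\<in>A - W N. vabs (f I) < e / 2"
      using small[of "e / 2"] by auto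
    have "\<exists>M. \<forall>n\<ge>M. dist (sum f (W n)) s < e / 2"
      using s \<open>e > 0\<close> unfolding lim_sequentially by (metis half_gt_zero)
    then obtain M where M: "\<And>n. n \<ge> M \<Longrightarrow> dist (sum f (W n)) s < e / 2"
      by blast
    define K where "K = max M N"
    have K: "\<forall>I\<in>A - W K. vabs (f I) < e / 2" "dist (sum f (W K)) s < e / 2"
      using N mono[of N K] M[of K] by (auto simp: K_def)
    have "dist (sum f S) s < e" if "finite S" "W K \<subseteq> S" "S \<subseteq> A" for S
    proof -
      have "dist (sum f S) (sum f (W K)) \<le> e / 2"
        using K(1) that by (rule diff) (use \<open>e > 0\<close> in simp)
      then show ?thesis
        using K(2) dist_ultrametric[of "sum f S" s "sum f (W K)"] \<open>e > 0\<close> by auto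
    qed
    then show "\<exists>S. finite S \<and> S \<subseteq> A \<and> (\<forall>Y. finite Y \<and> S \<subseteq> Y \<and> Y \<subseteq> A \<longrightarrow> dist (sum f Y) s < e)"
      using fin A by (intro exI[of _ "W K"]) auto
  qed
  with s show ?thesis
    by blast
qed

section \<open>Power series converging on a disk\<close>

lemma tendsto_zero_squeeze:
  fixes f g :: "nat \<Rightarrow> real"
  assumes "g \<longlonglongrightarrow> 0" "\<And>n. 0 \<le> f n" "\<And>n. f n \<le> g n"
  shows "f \<longlonglongrightarrow> 0"
  by (rule tendsto_sandwich[OF _ _ tendsto_const assms(1)]) (simp_all add: assms)

text \<open>The Gauss norm on the disk of radius \<open>\<rho>\<close> is at most \<open>B\<close>.
  As a relation it makes sense for series of infinite norm, and no supremum has to be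
  handled.\<close>

definition gauss_le :: "real \<Rightarrow> 'c::nonarch_field fps \<Rightarrow> real \<Rightarrow> bool"
  where "gauss_le \<rho> f B \<longleftrightarrow> (\<forall>m. vabs (fps_nth f m) * \<rho> ^ m \<le> B)"

definition tate_radius :: "real \<Rightarrow> 'c::nonarch_field fps set"
  where "tate_radius \<rho> = {f. (\<lambda>m. vabs (fps_nth f m) * \<rho> ^ m) \<longlonglongrightarrow> 0}"

lemma tate_algebra_eq: "tate_algebra = tate_radius 1"
  by (simp add: tate_algebra_def tate_radius_def tendsto_dist_iff[of _ "0 :: 'a :: nonarch_field"])

lemma gauss_leD: "gauss_le \<rho> f B \<Longrightarrow> vabs (fps_nth f m) * \<rho> ^ m \<le> B"
  by (simp add: gauss_le_def)

lemma gauss_le_nonneg: "gauss_le \<rho> f B \<Longrightarrow> 0 \<le> B"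
  using gauss_leD[of \<rho> f B 0] by (auto intro: order.trans[rotated])

lemma gauss_le_mono: "gauss_le \<rho> f B \<Longrightarrow> B \<le> C \<Longrightarrow> gauss_le \<rho> f C"
  by (force simp: gauss_le_def intro: order.trans)

lemma gauss_le_one [simp]: "gauss_le \<rho> 1 1"
  by (simp add: gauss_le_def)

lemma gauss_le_const [simp]: "gauss_le \<rho> (fps_const c) (vabs c)"
  by (simp add: gauss_le_def)

lemma gauss_le_X:
  assumes "\<rho> \<ge> 0"
  shows "gauss_le \<rho> fps_X \<rho>"
  using assms by (auto simp: gauss_le_def fps_X_def)

lemma gauss_le_minus [simp]: "gauss_le \<rho> (- f) B \<longleftrightarrow> gauss_le \<rho> f B"
  by (simp add: gauss_le_def)

lemma gauss_le_add:
  assumes "gauss_le \<rho> f B" "gauss_le \<rho> g B" "\<rho> \<ge> 0"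
  shows "gauss_le \<rho> (f + g) B"
  unfolding gauss_le_def
proof
  fix m
  have "vabs (fps_nth (f + g) m) * \<rho> ^ m \<le> max (vabs (fps_nth f m)) (vabs (fps_nth g m)) * \<rho> ^ m"
    using dist_add_zero_le \<open>\<rho> \<ge> 0\<close> by (intro mult_right_mono) auto
  also have "\<dots> \<le> B"
    using assms by (auto simp: max_def gauss_le_def)
  finally show "vabs (fps_nth (f + g) m) * \<rho> ^ m \<le> B" .
qed

lemma gauss_le_diff:
  assumes "gauss_le \<rho> f B" "gauss_le \<rho> g B" "\<rho> \<ge> 0"
  shows "gauss_le \<rho> (f - g) B"
  using gauss_le_add[of \<rho> f B "- g"] assms by simp

lemma gauss_le_sum:
  assumes "\<And>i. i \<in> I \<Longrightarrow> gauss_le \<rho> (f i) B" "B \<ge> 0" "\<rho> \<ge> 0"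
  shows "gauss_le \<rho> (\<Sum>i\<in>I. f i) B"
  using assms(1)
proof (induction I rule: infinite_finite_induct)
  case (insert i I)
  then show ?case
    using assms(3) by (simp add: gauss_le_add)
qed (use assms(2) in \<open>simp_all add: gauss_le_def\<close>)

lemma gauss_le_mult:
  assumes f: "gauss_le \<rho> f B" and g: "gauss_le \<rho> g C" and \<rho>: "\<rho> > 0"
  shows "gauss_le \<rho> (f * g) (B * C)"
  unfolding gauss_le_def
proof
  fix m
  have nn: "B \<ge> 0" "C \<ge> 0"
    using f g by (auto dest: gauss_le_nonneg)
  have "vabs (fps_nth (f * g) m) \<le> B * C / \<rho> ^ m"
    unfolding fps_mult_nth
  proof (rule vabs_sum_le)
    fix i assume i: "i \<in> {0..m}"
    have "vabs (fps_nth f i) * \<rho> ^ i * (vabs (fps_nth g (m - i)) * \<rho> ^ (m - i)) \<le> B * C"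
      using gauss_leD[OF f, of i] gauss_leD[OF g, of "m - i"] nn \<rho> by (intro mult_mono) auto
    also have "vabs (fps_nth f i) * \<rho> ^ i * (vabs (fps_nth g (m - i)) * \<rho> ^ (m - i)) =
        vabs (fps_nth f i * fps_nth g (m - i)) * \<rho> ^ m"
      using i by (simp add: dist_mult_zero mult_ac flip: power_add)
    finally show "vabs (fps_nth f i * fps_nth g (m - i)) \<le> B * C / \<rho> ^ m"
      using \<rho> by (simp add: field_simps)
  qed (use nn \<rho> in auto)
  then show "vabs (fps_nth (f * g) m) * \<rho> ^ m \<le> B * C"
    using \<rho> by (simp add: field_simps)
qed

lemma gauss_le_prod:
  assumes "\<And>i. i \<in> I \<Longrightarrow> gauss_le \<rho> (f i) (B i)" "\<rho> > 0"
  shows "gauss_le \<rho> (\<Prod>i\<in>I. f i) (\<Prod>i\<in>I. B i)"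
  using assms(1)
  by (induction I rule: infinite_finite_induct) (use assms(2) in \<open>auto intro!: gauss_le_mult\<close>)

lemma gauss_le_power:
  assumes "gauss_le \<rho> f B" "\<rho> > 0"
  shows "gauss_le \<rho> (f ^ n) (B ^ n)"
  by (induction n) (use assms in \<open>auto intro!: gauss_le_mult\<close>)

text \<open>The recursion expressing a coefficient of the inverse through the earlier ones involves
  no division when the constant term is \<open>1\<close>, and each of its summands inherits the
  weighted bound \<open>1\<close>.\<close>

lemma gauss_le_inverse:
  assumes f: "gauss_le \<rho> f 1" "fps_nth f 0 = 1" and \<rho>: "\<rho> > 0"
  shows "gauss_le \<rho> (inverse f) 1"
  unfolding gauss_le_def
proof
  fix n
  show "vabs (fps_nth (inverse f) n) * \<rho> ^ n \<le> 1"
  proof (induction n rule: less_induct)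
    case (less n)
    show ?case
    proof (cases "n = 0")
      case False
      have "fps_nth (f * inverse f) n = 0"
        using False f(2) by (simp add: inverse_mult_eq_1')
      then have nth: "fps_nth (inverse f) n = - (\<Sum>i=1..n. fps_nth f i * fps_nth (inverse f) (n - i))"
        using f(2) by (simp add: fps_mult_nth sum.atLeast_Suc_atMost eq_neg_iff_add_eq_0)
      have "vabs (fps_nth (inverse f) n) \<le> 1 / \<rho> ^ n"
        unfolding nth vabs_minus
      proof (rule vabs_sum_le)
        fix i assume i: "i \<in> {1..n}"
        have "vabs (fps_nth f i) * \<rho> ^ i * (vabs (fps_nth (inverse f) (n - i)) * \<rho> ^ (n - i)) \<le> 1 * 1"
          using gauss_leD[OF f(1), of i] less[of "n - i"] i \<rho> by (intro mult_mono) auto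
        also have "vabs (fps_nth f i) * \<rho> ^ i * (vabs (fps_nth (inverse f) (n - i)) * \<rho> ^ (n - i)) =
            vabs (fps_nth f i * fps_nth (inverse f) (n - i)) * \<rho> ^ n"
          using i by (simp add: dist_mult_zero mult_ac flip: power_add)
        finally show "vabs (fps_nth f i * fps_nth (inverse f) (n - i)) \<le> 1 / \<rho> ^ n"
          using \<rho> by (simp add: field_simps)
      qed (use \<rho> in simp)
      then show ?thesis
        using \<rho> by (simp add: field_simps)
    qed (use f in simp)
  qed
qed

section \<open>The algebra of series converging on a closed disk, and its completeness\<close>

lemma tate_radius_add:
  assumes "f \<in> tate_radius \<rho>" "g \<in> tate_radius \<rho>" "\<rho> \<ge> 0"
  shows "f + g \<in> tate_radius \<rho>"
proof -
  have "(\<lambda>m. vabs (fps_nth f m) * \<rho> ^ m + vabs (fps_nth g m) * \<rho> ^ m) \<longlonglongrightarrow> 0 + 0"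
    using assms unfolding tate_radius_def by (intro tendsto_add) auto
  then have lim: "(\<lambda>m. vabs (fps_nth f m) * \<rho> ^ m + vabs (fps_nth g m) * \<rho> ^ m) \<longlonglongrightarrow> 0"
    by simp
  have "vabs (fps_nth (f + g) m) * \<rho> ^ m \<le> vabs (fps_nth f m) * \<rho> ^ m + vabs (fps_nth g m) * \<rho> ^ m" for m
    using dist_add_zero_le[of "fps_nth f m" "fps_nth g m"] \<open>\<rho> \<ge> 0\<close>
    by (auto simp: max_def add_increasing add_increasing2 intro!: mult_right_mono simp flip: distrib_right split: if_splits)
  then show ?thesis
    unfolding tate_radius_def using \<open>\<rho> \<ge> 0\<close>
    by (auto intro!: tendsto_sandwich[OF _ _ tendsto_const lim])
qed

lemma tate_radius_minus [simp]: "- f \<in> tate_radius \<rho> \<longleftrightarrow> f \<in> tate_radius \<rho>"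
  by (simp add: tate_radius_def)

lemma tate_radius_diff:
  "f \<in> tate_radius \<rho> \<Longrightarrow> g \<in> tate_radius \<rho> \<Longrightarrow> \<rho> \<ge> 0 \<Longrightarrow> f - g \<in> tate_radius \<rho>"
  using tate_radius_add[of f \<rho> "- g"] by simp

lemma tate_radius_sum:
  "(\<And>i. i \<in> I \<Longrightarrow> f i \<in> tate_radius \<rho>) \<Longrightarrow> \<rho> \<ge> 0 \<Longrightarrow> (\<Sum>i\<in>I. f i) \<in> tate_radius \<rho>"
  by (induction I rule: infinite_finite_induct) (auto intro!: tate_radius_add, auto simp: tate_radius_def)

lemma tate_radius_const [simp]: "fps_const c \<in> tate_radius \<rho>"
  unfolding tate_radius_def
  by (auto intro!: tendsto_eventually eventually_sequentiallyI[of 1])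

lemma tate_radius_mono:
  assumes "f \<in> tate_radius \<rho>" "0 \<le> \<rho>'" "\<rho>' \<le> \<rho>"
  shows "f \<in> tate_radius \<rho>'"
proof -
  have "vabs (fps_nth f m) * \<rho>' ^ m \<le> vabs (fps_nth f m) * \<rho> ^ m" for m
    using assms by (intro mult_left_mono power_mono) auto
  then show ?thesis
    using assms unfolding tate_radius_def by (auto intro: tendsto_zero_squeeze)
qed

text \<open>Shrinking the radius gains the geometric factor \<open>(\<rho> / \<rho>')^m\<close>.
  This turns bounds at radius \<open>q^2\<close> into convergence at radius
  \<open>q\<close>.\<close>

lemma tate_radius_if_gauss_le:
  assumes f: "gauss_le \<rho>' f B" and \<rho>: "0 \<le> \<rho>" "\<rho> < \<rho>'"
  shows "f \<in> tate_radius \<rho>"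
proof -
  have le: "vabs (fps_nth f m) * \<rho> ^ m \<le> B * (\<rho> / \<rho>') ^ m" for m
  proof -
    have "vabs (fps_nth f m) * \<rho> ^ m = (vabs (fps_nth f m) * \<rho>' ^ m) * (\<rho> / \<rho>') ^ m"
      using \<rho> by (simp add: power_divide)
    also have "\<dots> \<le> B * (\<rho> / \<rho>') ^ m"
      using gauss_leD[OF f, of m] \<rho> by (intro mult_right_mono) auto
    finally show ?thesis .
  qed
  have "(\<lambda>m. B * (\<rho> / \<rho>') ^ m) \<longlonglongrightarrow> B * 0"
    using \<rho> by (intro tendsto_intros LIMSEQ_power_zero) auto
  then show ?thesis
    unfolding tate_radius_def using le \<rho> by (auto intro: tendsto_zero_squeeze)
qed

lemma gauss_le_if_tate_radius:
  assumes "f \<in> tate_radius \<rho>"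
  shows "\<exists>B. gauss_le \<rho> f B"
proof -
  have "Bseq (\<lambda>m. vabs (fps_nth f m) * \<rho> ^ m)"
    using assms unfolding tate_radius_def by (auto intro: convergent_imp_Bseq convergentI)
  then show ?thesis
    unfolding Bseq_def gauss_le_def by (metis real_norm_def abs_le_D1)
qed

lemma tate_radius_approx:
  assumes "\<And>e. e > 0 \<Longrightarrow> \<exists>g\<in>tate_radius \<rho>. gauss_le \<rho> (f - g) e" and \<rho>: "\<rho> \<ge> 0"
  shows "f \<in> tate_radius \<rho>"
  unfolding tate_radius_def mem_Collect_eq
proof (rule LIMSEQ_I)
  fix e :: real assume e: "e > 0"
  then obtain g where g: "g \<in> tate_radius \<rho>" "gauss_le \<rho> (f - g) (e / 2)"
    using assms(1)[of "e / 2"] by auto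
  obtain N where N: "\<And>m. m \<ge> N \<Longrightarrow> vabs (fps_nth g m) * \<rho> ^ m < e / 2"
    using g(1) e \<rho> unfolding tate_radius_def
    by (force dest!: LIMSEQ_D[where r = "e / 2"])
  have "vabs (fps_nth f m) * \<rho> ^ m < e" if "m \<ge> N" for m
  proof -
    have "vabs (fps_nth f m) \<le> max (vabs (fps_nth (f - g) m)) (vabs (fps_nth g m))"
      using dist_add_zero_le[of "fps_nth (f - g) m" "fps_nth g m"] by simp
    then have "vabs (fps_nth f m) * \<rho> ^ m \<le> max (vabs (fps_nth (f - g) m)) (vabs (fps_nth g m)) * \<rho> ^ m"
      using \<rho> by (intro mult_right_mono) auto
    also have "\<dots> \<le> e / 2"
      using gauss_leD[OF g(2), of m] N[OF that] by (auto simp: max_def)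
    finally show ?thesis
      using e by simp
  qed
  then show "\<exists>no. \<forall>n\<ge>no. norm (vabs (fps_nth f n) * \<rho> ^ n - 0) < e"
    using \<rho> by auto
qed

text \<open>Two kinds of convergence are returned because they serve different ends: coefficientwise
  limits pass through the twist and through products, while Gauss norm limits pass through
  evaluation at a point.\<close>

lemma tate_radius_limit:
  fixes f :: "nat \<Rightarrow> 'c::{nonarch_field,complete_space} fps"
  assumes f: "\<And>n. f n \<in> tate_radius \<rho>" and \<rho>: "\<rho> > 0"
    and cau: "\<And>e. e > 0 \<Longrightarrow> \<exists>N. \<forall>n\<ge>N. gauss_le \<rho> (f (Suc n) - f n) e"
  obtains F where "F \<in> tate_radius \<rho>" "\<And>m. (\<lambda>n. fps_nth (f n) m) \<longlonglongrightarrow> fps_nth F m"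
    "\<And>e. e > 0 \<Longrightarrow> \<exists>N. \<forall>n\<ge>N. gauss_le \<rho> (F - f n) e"
proof -
  have tele: "gauss_le \<rho> (f k - f n) e"
    if "\<forall>n\<ge>N. gauss_le \<rho> (f (Suc n) - f n) e" "n \<ge> N" "k \<ge> n" "e > 0" for N n k e
    using that(3)
  proof (induction k rule: dec_induct)
    case base
    then show ?case
      using that(4) by (simp add: gauss_le_def)
  next
    case (step k)
    have "gauss_le \<rho> ((f (Suc k) - f k) + (f k - f n)) e"
      using step that \<rho> by (intro gauss_le_add) auto
    then show ?case
      by simp
  qed
  have "convergent (\<lambda>n. fps_nth (f n) m)" for m
  proof (intro Cauchy_convergent nonarch_Cauchy)
    fix e :: real assume e: "e > 0"
    then obtain N where N: "\<And>n. n \<ge> N \<Longrightarrow> gauss_le \<rho> (f (Suc n) - f n) (e / 2 * \<rho> ^ m)"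
      using cau[of "e / 2 * \<rho> ^ m"] \<rho> by auto
    have "dist (fps_nth (f (Suc n)) m) (fps_nth (f n) m) < e" if "n \<ge> N" for n
    proof -
      have "vabs (fps_nth (f (Suc n) - f n) m) \<le> e / 2"
        using gauss_leD[OF N[OF that], of m] \<rho> by (simp add: field_simps)
      then show ?thesis
        using e by (simp add: dist_eq_dist_diff[of "fps_nth (f (Suc n)) m"])
    qed
    then show "\<exists>N. \<forall>n\<ge>N. dist (fps_nth (f (Suc n)) m) (fps_nth (f n) m) < e"
      by blast
  qed
  then obtain c where c: "\<And>m. (\<lambda>n. fps_nth (f n) m) \<longlonglongrightarrow> c m"
    unfolding convergent_def by metis
  define F where "F = Abs_fps c"
  \<comment> \<open>The bound on \<open>f k - f n\<close> is uniform in \<open>k\<close>, so it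
    survives letting \<open>k\<close> tend to infinity in each coefficient.\<close>
  have unif: "gauss_le \<rho> (F - f n) e"
    if "\<forall>n\<ge>N. gauss_le \<rho> (f (Suc n) - f n) e" "n \<ge> N" "e > 0" for N n e
    unfolding gauss_le_def
  proof
    fix m
    have "(\<lambda>k. fps_nth (f k) m - fps_nth (f n) m) \<longlonglongrightarrow> fps_nth (F - f n) m"
      unfolding fps_sub_nth F_def by (simp, intro tendsto_intros c)
    moreover have "vabs (fps_nth (f k) m - fps_nth (f n) m) \<le> e / \<rho> ^ m" if "k \<ge> n" for k
      using gauss_leD[OF tele[OF \<open>\<forall>n\<ge>N. _ n\<close> \<open>n \<ge> N\<close> that \<open>e > 0\<close>], of m] \<rho> by (simp add: field_simps)
    ultimately have "vabs (fps_nth (F - f n) m) \<le> e / \<rho> ^ m"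
      by (intro vabs_limit_le[of _ "fps_nth (F - f n) m"]) (auto simp: eventually_sequentially)
    then show "vabs (fps_nth (F - f n) m) * \<rho> ^ m \<le> e"
      using \<rho> by (simp add: field_simps)
  qed
  show ?thesis
  proof
    show "F \<in> tate_radius \<rho>"
    proof (rule tate_radius_approx)
      fix e :: real assume "e > 0"
      then show "\<exists>g\<in>tate_radius \<rho>. gauss_le \<rho> (F - g) e"
        using cau[of e] unif f by blast
    qed (use \<rho> in simp)
    show "(\<lambda>n. fps_nth (f n) m) \<longlonglongrightarrow> fps_nth F m" for m
      using c by (simp add: F_def)
    show "\<exists>N. \<forall>n\<ge>N. gauss_le \<rho> (F - f n) e" if "e > 0" for e
      using cau[OF that] unif that by blast
  qed
qed

section \<open>Evaluation at a point of the disk\<close>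

lemma eval_at_sums:
  fixes f :: "'c::{nonarch_field,complete_space} fps"
  assumes f: "f \<in> tate_radius \<rho>" and x: "vabs x \<le> \<rho>"
  shows "(\<lambda>i. fps_nth f i * x ^ i) sums eval_at x f"
  unfolding eval_at_def
proof (rule nonarch_sums)
  have "vabs (fps_nth f m * x ^ m) \<le> vabs (fps_nth f m) * \<rho> ^ m" for m
    using x by (auto simp: dist_mult_zero vabs_power intro!: mult_left_mono power_mono)
  then show "(\<lambda>i. fps_nth f i * x ^ i) \<longlonglongrightarrow> 0"
    using f unfolding tate_radius_def by (subst tendsto_dist_iff) (auto intro: tendsto_zero_squeeze)
qed

lemma eval_at_add:
  fixes f g :: "'c::{nonarch_field,complete_space} fps"
  assumes "f \<in> tate_radius \<rho>" "g \<in> tate_radius \<rho>" "vabs x \<le> \<rho>"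
  shows "eval_at x (f + g) = eval_at x f + eval_at x g"
proof -
  have "(\<lambda>i. fps_nth (f + g) i * x ^ i) sums (eval_at x f + eval_at x g)"
    using sums_add[OF eval_at_sums[OF assms(1,3)] eval_at_sums[OF assms(2,3)]]
    by (simp add: distrib_right)
  then show ?thesis
    unfolding eval_at_def[of x "f + g"] by (rule sums_unique[symmetric])
qed

lemma eval_at_minus:
  fixes f :: "'c::{nonarch_field,complete_space} fps"
  assumes "f \<in> tate_radius \<rho>" "vabs x \<le> \<rho>"
  shows "eval_at x (- f) = - eval_at x f"
proof -
  have "(\<lambda>i. fps_nth (- f) i * x ^ i) sums (- 1 * eval_at x f)"
    using nonarch_sums_mult[OF eval_at_sums[OF assms], of "- 1"] by simp
  then show ?thesis
    unfolding eval_at_def[of x "- f"] by (simp add: sums_iff)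
qed

lemma eval_at_diff:
  fixes f g :: "'c::{nonarch_field,complete_space} fps"
  assumes "f \<in> tate_radius \<rho>" "g \<in> tate_radius \<rho>" "vabs x \<le> \<rho>"
  shows "eval_at x (f - g) = eval_at x f - eval_at x g"
  using eval_at_add[of f \<rho> "- g" x] eval_at_minus[of g \<rho> x] assms by simp

lemma eval_at_const [simp]: "eval_at x (fps_const c) = c"
  unfolding eval_at_def by (subst suminf_finite[of "{0}"]) auto

lemma eval_at_one [simp]: "eval_at x 1 = 1"
  using eval_at_const[of x 1] by simp

lemma eval_at_zero [simp]: "eval_at x 0 = 0"
  using eval_at_const[of x 0] by simp

lemma eval_at_sum:
  fixes f :: "'i \<Rightarrow> 'c::{nonarch_field,complete_space} fps"
  assumes "\<And>i. i \<in> I \<Longrightarrow> f i \<in> tate_radius \<rho>" "vabs x \<le> \<rho>"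
  shows "eval_at x (\<Sum>i\<in>I. f i) = (\<Sum>i\<in>I. eval_at x (f i))"
proof -
  have "\<rho> \<ge> 0"
    using assms(2) by (rule order.trans[rotated]) simp
  then show ?thesis
    using assms(1)
    by (induction I rule: infinite_finite_induct)
      (auto simp: eval_at_add[OF _ tate_radius_sum assms(2)])
qed

lemma eval_at_le:
  fixes f :: "'c::{nonarch_field,complete_space} fps"
  assumes f: "f \<in> tate_radius \<rho>" and x: "vabs x \<le> \<rho>" and B: "gauss_le \<rho> f B"
  shows "vabs (eval_at x f) \<le> B"
proof (rule vabs_limit_le)
  show "(\<lambda>n. \<Sum>i<n. fps_nth f i * x ^ i) \<longlonglongrightarrow> eval_at x f"
    using eval_at_sums[OF f x] by (simp add: sums_def)
  have "vabs (fps_nth f m * x ^ m) \<le> B" for m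
  proof -
    have "vabs (fps_nth f m * x ^ m) \<le> vabs (fps_nth f m) * \<rho> ^ m"
      using x by (auto simp: dist_mult_zero vabs_power intro!: mult_left_mono power_mono)
    also have "\<dots> \<le> B"
      by (rule gauss_leD[OF B])
    finally show ?thesis .
  qed
  then show "\<forall>\<^sub>F n in sequentially. vabs (\<Sum>i<n. fps_nth f i * x ^ i) \<le> B"
    using gauss_le_nonneg[OF B] by (auto intro!: always_eventually vabs_sum_le)
qed

lemma eval_at_tendsto:
  fixes f :: "nat \<Rightarrow> 'c::{nonarch_field,complete_space} fps"
  assumes f: "\<And>n. f n \<in> tate_radius \<rho>" and F: "F \<in> tate_radius \<rho>" and x: "vabs x \<le> \<rho>"
    and unif: "\<And>e. e > 0 \<Longrightarrow> \<exists>N. \<forall>n\<ge>N. gauss_le \<rho> (F - f n) e"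
  shows "(\<lambda>n. eval_at x (f n)) \<longlonglongrightarrow> eval_at x F"
  unfolding lim_sequentially
proof (intro allI impI)
  fix e :: real assume e: "e > 0"
  have \<rho>: "\<rho> \<ge> 0"
    using x by (rule order.trans[rotated]) simp
  obtain N where N: "\<And>n. n \<ge> N \<Longrightarrow> gauss_le \<rho> (F - f n) (e / 2)"
    using unif[of "e / 2"] e by auto
  have "dist (eval_at x (f n)) (eval_at x F) < e" if "n \<ge> N" for n
  proof -
    have "vabs (eval_at x (F - f n)) \<le> e / 2"
      using F f x N[OF that] \<rho> by (intro eval_at_le[where \<rho> = \<rho>] tate_radius_diff) auto
    then have "dist (eval_at x F) (eval_at x (f n)) \<le> e / 2"
      using eval_at_diff[OF F f x, of n] by (simp add: dist_eq_dist_diff[of "eval_at x F"])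
    then show ?thesis
      using e by (simp add: dist_commute)
  qed
  then show "\<exists>no. \<forall>n\<ge>no. dist (eval_at x (f n)) (eval_at x F) < e"
    by blast
qed

lemma tate_radius_truncate:
  assumes f: "f \<in> tate_radius \<rho>" and \<rho>: "\<rho> \<ge> 0" and e: "e > 0"
  shows "\<exists>N. \<forall>n\<ge>N. gauss_le \<rho> (f - (\<Sum>k<n. fps_const (fps_nth f k) * fps_X ^ k)) e"
proof -
  obtain N where N: "\<And>m. m \<ge> N \<Longrightarrow> vabs (fps_nth f m) * \<rho> ^ m < e"
    using f e \<rho> unfolding tate_radius_def
    by (force dest!: LIMSEQ_D[where r = e])
  have "fps_nth (\<Sum>k<n. fps_const (fps_nth f k) * fps_X ^ k) m = (if m < n then fps_nth f m else 0)" for n m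
    by (simp add: fps_sum_nth fps_X_power_nth if_distrib[of "\<lambda>x. _ * x"] cong: if_cong)
  moreover have "vabs (fps_nth f m) * \<rho> ^ m \<le> e" if "m \<ge> n" "n \<ge> N" for m n
    using N[of m] that by simp
  ultimately show ?thesis
    using e by (intro exI[of _ N]) (auto simp: gauss_le_def not_less)
qed

text \<open>\<open>f\<close> is approximated by its truncations \<open>p n\<close>. For a monomial,
  multiplication merely shifts the series of \<open>g\<close>, so the product rule is immediate;
  linearity gives it for \<open>p n\<close>, and continuity in the Gauss norm for
  \<open>f\<close>.\<close>

lemma
  fixes f g :: "'c::{nonarch_field,complete_space} fps"
  assumes f: "f \<in> tate_radius \<rho>" and g: "g \<in> tate_radius \<rho>" and \<rho>: "\<rho> > 0"
  shows tate_radius_mult: "f * g \<in> tate_radius \<rho>"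
    and eval_at_mult: "vabs x \<le> \<rho> \<Longrightarrow> eval_at x (f * g) = eval_at x f * eval_at x g"
proof -
  define p where "p n = (\<Sum>k<n. fps_const (fps_nth f k) * fps_X ^ k)" for n
  have monom_nth: "fps_nth (fps_const c * fps_X ^ k * h) m = (if m < k then 0 else c * fps_nth h (m - k))"
    for c k m and h :: "'c fps"
    by (simp add: mult.assoc fps_X_power_mult_nth)
  have shift: "fps_const c * fps_X ^ k * h \<in> tate_radius \<rho>" if "h \<in> tate_radius \<rho>" for c k and h :: "'c fps"
  proof -
    have "(\<lambda>m. vabs (fps_nth h m) * \<rho> ^ m) \<longlonglongrightarrow> 0"
      using that by (simp add: tate_radius_def)
    then have "(\<lambda>m. vabs c * \<rho> ^ k * (vabs (fps_nth h m) * \<rho> ^ m)) \<longlonglongrightarrow> 0"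
      by (rule tendsto_mult_right_zero)
    then have "(\<lambda>m. vabs (fps_nth (fps_const c * fps_X ^ k * h) (m + k)) * \<rho> ^ (m + k)) \<longlonglongrightarrow> 0"
      unfolding monom_nth by (simp add: dist_mult_zero power_add mult_ac)
    then show ?thesis
      unfolding tate_radius_def mem_Collect_eq by (rule LIMSEQ_offset)
  qed
  have eval_shift: "eval_at x (fps_const c * fps_X ^ k * h) = c * x ^ k * eval_at x h"
    if h: "h \<in> tate_radius \<rho>" and x: "vabs x \<le> \<rho>" for c k x and h :: "'c fps"
  proof -
    have "(\<lambda>i. c * x ^ k * (fps_nth h i * x ^ i)) sums (c * x ^ k * eval_at x h)"
      by (intro nonarch_sums_mult eval_at_sums[OF h x])
    also have "(\<lambda>i. c * x ^ k * (fps_nth h i * x ^ i)) =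
        (\<lambda>i. fps_nth (fps_const c * fps_X ^ k * h) (i + k) * x ^ (i + k))"
      unfolding monom_nth by (simp add: power_add mult_ac)
    finally have "(\<lambda>i. fps_nth (fps_const c * fps_X ^ k * h) i * x ^ i) sums (c * x ^ k * eval_at x h)"
    proof (subst (asm) sums_mono_reindex)
      fix n
      assume "n \<notin> range (\<lambda>i. i + k)"
      then have "n < k"
        by (metis le_add_diff_inverse2 not_less rangeI)
      then show "fps_nth (fps_const c * fps_X ^ k * h) n * x ^ n = 0"
        by (simp add: monom_nth)
    qed (auto simp: strict_mono_def)
    then show ?thesis
      unfolding eval_at_def[of x "_ * h"] by (rule sums_unique[symmetric])
  qed
  have one: "1 \<in> tate_radius \<rho>"
    using tate_radius_const[of 1 \<rho>] by simp
  have monom_in: "fps_const c * fps_X ^ k \<in> tate_radius \<rho>" for c :: 'c and k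
    using shift[OF one, of c k] by simp
  have p: "p n \<in> tate_radius \<rho>" for n
    unfolding p_def using \<rho> monom_in by (intro tate_radius_sum) auto
  have pg: "p n * g \<in> tate_radius \<rho>" for n
    unfolding p_def sum_distrib_right using \<rho> shift[OF g] by (intro tate_radius_sum) auto
  have lim: "\<exists>N. \<forall>n\<ge>N. gauss_le \<rho> (f - p n) e" if "e > 0" for e
    unfolding p_def using tate_radius_truncate[OF f _ that] \<rho> by simp
  obtain B where B: "gauss_le \<rho> g B"
    using gauss_le_if_tate_radius[OF g] by blast
  have lim_g: "\<exists>N. \<forall>n\<ge>N. gauss_le \<rho> (f * g - p n * g) e" if e: "e > 0" for e
  proof -
    \<comment> \<open>The bound \<open>B\<close> may be \<open>0\<close>, and the error is to be
      divided by it.\<close>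
    define B' where "B' = max B 1"
    have B': "gauss_le \<rho> g B'" "B' > 0"
      using gauss_le_mono[OF B] by (auto simp: B'_def)
    obtain N where N: "\<And>n. n \<ge> N \<Longrightarrow> gauss_le \<rho> (f - p n) (e / B')"
      using lim[of "e / B'"] e B'(2) by auto
    have "gauss_le \<rho> (f * g - p n * g) e" if "n \<ge> N" for n
      using gauss_le_mult[OF N[OF that] B'(1) \<rho>] B'(2) by (simp add: left_diff_distrib)
    then show ?thesis
      by blast
  qed
  show fg: "f * g \<in> tate_radius \<rho>"
    using lim_g pg \<rho> by (intro tate_radius_approx) (blast | simp)+
  show "eval_at x (f * g) = eval_at x f * eval_at x g" if x: "vabs x \<le> \<rho>"
  proof -
    have "eval_at x (p n * g) = eval_at x (p n) * eval_at x g" for n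
      unfolding p_def sum_distrib_right
      using eval_at_sum[of "{..<n}" "\<lambda>k. fps_const (fps_nth f k) * fps_X ^ k * g" \<rho> x]
        eval_at_sum[of "{..<n}" "\<lambda>k. fps_const (fps_nth f k) * fps_X ^ k" \<rho> x]
        eval_shift[OF g x] eval_shift[OF one x] shift[OF g] monom_in x
      by (simp add: sum_distrib_right)
    moreover have "(\<lambda>n. eval_at x (p n * g)) \<longlonglongrightarrow> eval_at x (f * g)"
      using pg fg x lim_g by (rule eval_at_tendsto)
    moreover have "(\<lambda>n. eval_at x (p n) * eval_at x g) \<longlonglongrightarrow> eval_at x f * eval_at x g"
      by (intro tendsto_mult tendsto_const eval_at_tendsto[OF p f x lim])
    ultimately show ?thesis
      by (auto intro: LIMSEQ_unique)
  qed
qed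

lemma tate_radius_one [simp]: "1 \<in> tate_radius \<rho>"
  using tate_radius_const[of 1 \<rho>] by simp

lemma tate_radius_X [simp]: "fps_X \<in> tate_radius \<rho>"
  unfolding tate_radius_def
  by (auto simp: fps_X_def intro!: tendsto_eventually eventually_sequentiallyI[of 2])

lemma eval_at_X: "eval_at x fps_X = x"
  unfolding eval_at_def by (subst suminf_finite[of "{1}"]) auto

lemma
  fixes f :: "'i \<Rightarrow> 'c::{nonarch_field,complete_space} fps"
  assumes f: "\<And>i. i \<in> I \<Longrightarrow> f i \<in> tate_radius \<rho>" and \<rho>: "\<rho> > 0"
  shows tate_radius_prod: "(\<Prod>i\<in>I. f i) \<in> tate_radius \<rho>"
    and eval_at_prod: "vabs x \<le> \<rho> \<Longrightarrow> eval_at x (\<Prod>i\<in>I. f i) = (\<Prod>i\<in>I. eval_at x (f i))"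
proof -
  have "(\<Prod>i\<in>I. f i) \<in> tate_radius \<rho> \<and>
      (vabs x \<le> \<rho> \<longrightarrow> eval_at x (\<Prod>i\<in>I. f i) = (\<Prod>i\<in>I. eval_at x (f i)))" for x
    using f
  proof (induction I rule: infinite_finite_induct)
    case (insert i I)
    then show ?case
      using \<rho> eval_at_mult[of "f i" \<rho> "prod f I" x] by (auto intro: tate_radius_mult)
  qed auto
  then show "(\<Prod>i\<in>I. f i) \<in> tate_radius \<rho>"
    "vabs x \<le> \<rho> \<Longrightarrow> eval_at x (\<Prod>i\<in>I. f i) = (\<Prod>i\<in>I. eval_at x (f i))"
    by auto
qed

lemma
  fixes f :: "'c::{nonarch_field,complete_space} fps"
  assumes f: "f \<in> tate_radius \<rho>" and \<rho>: "\<rho> > 0"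
  shows tate_radius_power: "f ^ n \<in> tate_radius \<rho>"
    and eval_at_power: "vabs x \<le> \<rho> \<Longrightarrow> eval_at x (f ^ n) = eval_at x f ^ n"
  using tate_radius_prod[of "{..<n}" "\<lambda>_. f" \<rho>] eval_at_prod[of "{..<n}" "\<lambda>_. f" \<rho> x] assms
  by simp_all

section \<open>The Frobenius of \<open>\<complex>\<^sub>\<infinity>\<close> and the operator \<open>\<wp>\<close>\<close>

text \<open>Multiplication by a nonzero \<open>x\<close> permutes the nonzero elements; comparing
  the products of all of them gives \<open>x^(q-1) = 1\<close>.\<close>

lemma finite_field_power_card:
  fixes x :: "'k::{field,finite}"
  shows "x ^ CARD('k) = x"
proof (cases "x = 0")
  case False
  have "(\<Prod>y\<in>UNIV - {0}. x * y) = (\<Prod>y\<in>UNIV - {0}. y)"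
    by (rule prod.reindex_bij_witness[of _ "\<lambda>y. y / x" "\<lambda>y. x * y"]) (use False in auto)
  then have "x ^ (CARD('k) - 1) * \<Prod>(UNIV - {0 :: 'k}) = \<Prod>(UNIV - {0})"
    by (simp add: prod.distrib card_Diff_singleton)
  moreover have "\<Prod>(UNIV - {0 :: 'k}) \<noteq> 0"
    by simp
  ultimately have "x ^ (CARD('k) - 1) = 1"
    by simp
  then have "x * x ^ (CARD('k) - 1) = x"
    by simp
  then show ?thesis
    by (simp flip: power_Suc)
qed simp

text \<open>\<open>(X + 1)\<^sup>q - X\<^sup>q - 1\<close> has degree less than \<open>q\<close> and vanishes on the \<open>q\<close> elements of the field.\<close>

lemma finite_field_binomial_eq_0:
  assumes i: "0 < i" "i < CARD('k::{field,finite})"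
  shows "of_nat (CARD('k) choose i) = (0 :: 'k)"
proof -
  define q where "q = CARD('k)"
  define p :: "'k poly" where "p = (\<Sum>j\<in>{1..<q}. monom (of_nat (q choose j)) j)"
  have q: "q > 0"
    by (simp add: q_def)
  have "poly p x = 0" for x
  proof -
    have "(x + 1) ^ q = (\<Sum>j\<le>q. of_nat (q choose j) * x ^ j)"
      by (simp add: binomial_ring)
    also have "{..q} = insert 0 (insert q {1..<q})"
      by auto
    also have "(\<Sum>j\<in>\<dots>. of_nat (q choose j) * x ^ j) = 1 + (x ^ q + poly p x)"
      using q by (simp add: p_def poly_sum poly_monom)
    finally show ?thesis
      using finite_field_power_card[of x] finite_field_power_card[of "x + 1"] by (simp add: q_def)
  qed
  then have "card {x. poly p x = 0} = q"
    by (simp add: q_def)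
  moreover have "degree p \<le> q - 1"
    unfolding p_def by (rule degree_sum_le) (auto intro: order.trans[OF degree_monom_le])
  ultimately have "p = 0"
    using card_poly_roots_bound[of p] q by linarith
  moreover have "coeff p i = of_nat (q choose i)"
    using i by (simp add: p_def coeff_sum q_def if_distrib cong: if_cong)
  ultimately show ?thesis
    by (simp add: q_def)
qed

section \<open>The finite field of constants and the Frobenius map\<close>

locale carlitz_setup = C_infinity \<iota>
  for \<iota> :: "'k::{field,finite} fls alg_closure \<Rightarrow> 'c::{nonarch_field,complete_space}" +
  fixes q :: nat and \<theta> lam :: 'c
  assumes q_eq: "q = CARD('k)"
    and theta_eq: "\<theta> = \<iota> (to_ac fls_X_inv)"
    and lam_power: "lam ^ (q - 1) = - \<theta>"
begin

lemma q_ge_2: "q \<ge> 2"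
proof -
  have "card {0, 1 :: 'k} \<le> CARD('k)"
    by (intro card_mono) auto
  then show ?thesis
    by (simp add: q_eq)
qed

lemma vabs_theta: "vabs \<theta> = real q"
  using vabs_laurent[of fls_X_inv] by (simp add: theta_eq q_eq)

lemma theta_nonzero: "\<theta> \<noteq> 0"
  using vabs_theta q_ge_2 by auto

definition emb :: "'k \<Rightarrow> 'c"
  where "emb c = \<iota> (to_ac (fls_const c))"

lemma emb_0 [simp]: "emb 0 = 0"
  by (simp add: emb_def)

lemma emb_1 [simp]: "emb 1 = 1"
  by (simp add: emb_def)

lemma emb_mult: "emb (x * y) = emb x * emb y"
  by (simp add: emb_def hom_mult flip: fls_const_mult_const)

lemma emb_add: "emb (x + y) = emb x + emb y"
  by (simp add: emb_def hom_add flip: fls_plus_const)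

lemma emb_minus: "emb (- x) = - emb x"
  using emb_add[of x "- x"] by (simp add: eq_neg_iff_add_eq_0 add.commute)

lemma emb_of_nat: "emb (of_nat n) = of_nat n"
  by (induction n) (simp_all add: emb_add emb_1)

lemma emb_power: "emb (x ^ n) = emb x ^ n"
  by (induction n) (simp_all add: emb_mult)

lemma vabs_emb: "c \<noteq> 0 \<Longrightarrow> vabs (emb c) = 1"
  using vabs_laurent[of "fls_const c"] by (simp add: emb_def)

lemma emb_eq_0_iff: "emb c = 0 \<longleftrightarrow> c = 0"
  using vabs_emb[of c] by (cases "c = 0") auto

text \<open>The middle binomial coefficients vanish in the finite field, and \<open>emb\<close>
  carries this over to \<open>'c\<close>. In this way \<open>q\<close> serves directly as the
  exponent, with no passage through the characteristic.\<close>

lemma frob_add: "(x + y :: 'c) ^ q = x ^ q + y ^ q"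
proof -
  have zero: "of_nat (q choose j) = (0 :: 'c)" if "j \<in> {1..<q}" for j
    using finite_field_binomial_eq_0[where ?'k = 'k, of j] that emb_of_nat[of "q choose j"]
    by (simp add: q_eq)
  have "(x + y) ^ q = (\<Sum>j\<le>q. of_nat (q choose j) * x ^ j * y ^ (q - j))"
    by (simp add: binomial_ring)
  also have "{..q} = insert 0 (insert q {1..<q})"
    by auto
  also have "(\<Sum>j\<in>\<dots>. of_nat (q choose j) * x ^ j * y ^ (q - j)) = x ^ q + y ^ q"
    using q_ge_2 by (simp add: zero)
  finally show ?thesis .
qed

lemma frob_minus: "(- x :: 'c) ^ q = - (x ^ q)"
  using frob_add[of x "- x"] q_ge_2 by (simp add: eq_neg_iff_add_eq_0 add.commute power_0_left)

lemma frob_diff: "(x - y :: 'c) ^ q = x ^ q - y ^ q"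
  using frob_add[of x "- y"] frob_minus[of y] by simp

lemma frob_sum: "(\<Sum>i\<in>I. f i :: 'c) ^ q = (\<Sum>i\<in>I. f i ^ q)"
  by (induction I rule: infinite_finite_induct) (use q_ge_2 in \<open>simp_all add: frob_add\<close>)

text \<open>The polynomial \<open>X^q - X\<close> has at most \<open>q\<close> roots, and the
  embedded finite field already supplies \<open>q\<close> of them.\<close>

lemma frob_fixed:
  assumes "(x :: 'c) ^ q = x"
  shows "x \<in> range emb"
proof -
  define p :: "'c poly" where "p = monom 1 q - monom 1 1"
  have "coeff p q = 1"
    using q_ge_2 by (simp add: p_def)
  then have "p \<noteq> 0"
    by auto
  have "degree p \<le> q"
    unfolding p_def using q_ge_2 by (intro degree_diff_le) (auto simp: degree_monom_eq)
  have "inj emb"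
    by (rule injI) (metis diff_add_cancel emb_add emb_eq_0_iff add_cancel_right_left right_minus_eq)
  then have card: "card (range emb) = q"
    by (simp add: card_image q_eq)
  have "range emb \<subseteq> {x. poly p x = 0}"
    by (auto simp: p_def poly_monom q_eq finite_field_power_card simp flip: emb_power)
  moreover have "finite {x. poly p x = 0}" "card {x. poly p x = 0} \<le> q"
    using poly_roots_finite[OF \<open>p \<noteq> 0\<close>] card_poly_roots_bound[OF \<open>p \<noteq> 0\<close>] \<open>degree p \<le> q\<close> by auto
  ultimately have "range emb = {x. poly p x = 0}"
    using card by (intro card_seteq) auto
  moreover have "poly p x = 0"
    using assms by (simp add: p_def poly_monom)
  ultimately show ?thesis
    by blast
qed

section \<open>The twist of power series\<close>

lemma twist_nth [simp]: "fps_nth (twist q f) i = fps_nth f i ^ q" for f :: "'c fps"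
  by (simp add: twist_def)

lemma twist_add: "twist q (f + g) = twist q f + twist q g" for f g :: "'c fps"
  by (rule fps_ext) (simp add: frob_add)

lemma twist_diff: "twist q (f - g) = twist q f - twist q g" for f g :: "'c fps"
  by (rule fps_ext) (simp add: frob_diff)

lemma twist_mult: "twist q (f * g) = twist q f * twist q g" for f g :: "'c fps"
  by (rule fps_ext) (simp add: fps_mult_nth frob_sum power_mult_distrib)

lemma twist_const: "twist q (fps_const c) = fps_const (c ^ q)" for c :: 'c
  by (rule fps_ext) (use q_ge_2 in simp)

lemma twist_one [simp]: "twist q 1 = (1 :: 'c fps)"
  using twist_const[of 1] by simp

lemma twist_X [simp]: "twist q fps_X = (fps_X :: 'c fps)"
  by (rule fps_ext) (use q_ge_2 in \<open>simp add: fps_X_def\<close>)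

lemma twist_sum: "twist q (\<Sum>i\<in>I. f i) = (\<Sum>i\<in>I. twist q (f i :: 'c fps))"
  by (rule fps_ext) (simp add: fps_sum_nth frob_sum)

lemma twist_prod: "twist q (\<Prod>i\<in>I. f i) = (\<Prod>i\<in>I. twist q (f i :: 'c fps))"
  by (induction I rule: infinite_finite_induct) (simp_all add: twist_mult)

lemma twist_power: "twist q (f ^ n) = twist q f ^ n" for f :: "'c fps"
  using twist_prod[of "\<lambda>_. f" "{..<n}"] by simp

lemma twist_iter_mult: "(twist q ^^ i) (f * g) = (twist q ^^ i) f * (twist q ^^ i) g" for f g :: "'c fps"
  by (induction i) (simp_all add: twist_mult)

lemma twist_iter_power: "(twist q ^^ i) (f ^ n) = (twist q ^^ i) f ^ n" for f :: "'c fps"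
  by (induction i) (simp_all add: twist_power)

lemma twist_iter_const: "(twist q ^^ i) (fps_const c) = fps_const (c ^ (q ^ i))" for c :: 'c
  by (induction i) (simp_all add: twist_const mult.commute flip: power_mult)

text \<open>The variable is not twisted, so the weight remains \<open>\<rho>^m\<close>; it is at
  most its own \<open>q\<close>-th power because \<open>\<rho> \<ge> 1\<close>.\<close>

lemma gauss_le_twist:
  fixes f :: "'c fps"
  assumes f: "gauss_le \<rho> f B" and \<rho>: "\<rho> \<ge> 1"
  shows "gauss_le \<rho> (twist q f) (B ^ q)"
  unfolding gauss_le_def
proof
  fix m
  have "1 ^ (q - 1) \<le> (\<rho> ^ m) ^ (q - 1)"
    using \<rho> by (intro power_mono) auto
  then have "\<rho> ^ m * 1 \<le> \<rho> ^ m * (\<rho> ^ m) ^ (q - 1)"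
    using \<rho> by (intro mult_left_mono) auto
  also have "\<dots> = (\<rho> ^ m) ^ q"
    using q_ge_2 by (simp flip: power_Suc)
  finally have "vabs (fps_nth (twist q f) m) * \<rho> ^ m \<le> (vabs (fps_nth f m) * \<rho> ^ m) ^ q"
    by (simp add: vabs_power power_mult_distrib mult_left_mono)
  also have "\<dots> \<le> B ^ q"
    using gauss_leD[OF f, of m] \<rho> by (intro power_mono) auto
  finally show "vabs (fps_nth (twist q f) m) * \<rho> ^ m \<le> B ^ q" .
qed

lemma tate_radius_twist:
  fixes f :: "'c fps"
  assumes f: "f \<in> tate_radius \<rho>" and \<rho>: "\<rho> \<ge> 1"
  shows "twist q f \<in> tate_radius \<rho>"
proof -
  have "(\<lambda>m. (vabs (fps_nth f m) * \<rho> ^ m) ^ q) \<longlonglongrightarrow> 0"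
    using f q_ge_2 unfolding tate_radius_def by (intro tendsto_null_power) auto
  moreover have "vabs (fps_nth (twist q f) m) * \<rho> ^ m \<le> (vabs (fps_nth f m) * \<rho> ^ m) ^ q" for m
  proof -
    \<comment> \<open>Applied to a single monomial, the Gauss bound becomes an estimate for one
      coefficient.\<close>
    have "gauss_le \<rho> (fps_const (fps_nth f m) * fps_X ^ m) (vabs (fps_nth f m) * \<rho> ^ m)"
      using \<rho> by (intro gauss_le_mult gauss_le_power gauss_le_X) auto
    from gauss_leD[OF gauss_le_twist[OF this \<rho>], of m] show ?thesis
      by simp
  qed
  ultimately show ?thesis
    unfolding tate_radius_def using \<rho> by (auto intro: tendsto_zero_squeeze)
qed

lemma tate_radius_twist_iter:
  "f \<in> tate_radius \<rho> \<Longrightarrow> \<rho> \<ge> 1 \<Longrightarrow> (twist q ^^ i) f \<in> tate_radius \<rho>" for f :: "'c fps"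
  by (induction i) (simp_all add: tate_radius_twist)

lemma gauss_le_twist_iter:
  "gauss_le \<rho> f B \<Longrightarrow> \<rho> \<ge> 1 \<Longrightarrow> gauss_le \<rho> ((twist q ^^ i) f) (B ^ (q ^ i))" for f :: "'c fps"
proof (induction i)
  case (Suc i)
  from gauss_le_twist[OF Suc.IH[OF Suc.prems] Suc.prems(2)] show ?case
    by (simp add: mult.commute flip: power_mult)
qed simp

section \<open>Artin-Schreier equations, and the image and kernel of \<wp>\<close>

lemma artin_schreier_small:
  assumes y: "vabs (y :: 'c) < 1"
  shows "\<exists>a. a - a ^ q = y \<and> vabs a \<le> vabs y"
proof -
  \<comment> \<open>The solution is the sum of all \<open>y^(q^i)\<close>: its \<open>q\<close>-th
    power is the same series without the first term.\<close>
  define f where "f i = y ^ (q ^ i)" for i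
  have le: "vabs (f i) \<le> vabs y ^ i" for i
  proof -
    have "i \<le> q ^ i"
      using q_ge_2 by (simp add: less_imp_le power_gt_expt)
    then show ?thesis
      unfolding f_def vabs_power using y by (intro power_decreasing) auto
  qed
  have "(\<lambda>i. vabs y ^ i) \<longlonglongrightarrow> 0"
    using y by (intro LIMSEQ_power_zero) auto
  then have "f \<longlonglongrightarrow> 0"
    by (subst tendsto_dist_iff) (auto intro: tendsto_zero_squeeze le)
  then have "f sums suminf f"
    by (rule nonarch_sums)
  then obtain a where a: "(\<lambda>n. \<Sum>i<n. f i) \<longlonglongrightarrow> a"
    by (auto simp: sums_def)
  have "(\<lambda>n. (\<Sum>i<Suc n. f i) - (\<Sum>i<n. f i) ^ q) \<longlonglongrightarrow> a - a ^ q"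
    by (intro tendsto_intros tendsto_power_strong LIMSEQ_Suc a)
  moreover have "(\<Sum>i<Suc n. f i) - (\<Sum>i<n. f i) ^ q = y" for n
  proof -
    have "(\<Sum>i<Suc n. f i) = f 0 + (\<Sum>i<n. f (Suc i))"
      by (rule sum.lessThan_Suc_shift)
    also have "(\<Sum>i<n. f (Suc i)) = (\<Sum>i<n. f i) ^ q"
      unfolding frob_sum by (simp add: f_def mult.commute flip: power_mult)
    finally show ?thesis
      by (simp add: f_def)
  qed
  ultimately have "a - a ^ q = y"
    by (simp add: LIMSEQ_const_iff)
  moreover have "vabs (f i) \<le> vabs y" for i
    unfolding f_def vabs_power using y q_ge_2 power_decreasing[of 1 "q ^ i" "vabs y"] by simp
  then have "vabs a \<le> vabs y"
    by (intro vabs_limit_le[OF a]) (auto intro!: always_eventually vabs_sum_le)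
  ultimately show ?thesis
    by blast
qed

text \<open>By density \<open>y\<close> is the image of some \<open>b\<close> in the algebraic
  closure plus an element of absolute value below \<open>1\<close>. The equation for
  \<open>b\<close> is solved by a root of a polynomial, the one for the rest by the series, and the
  two solutions add up. The size bound for small \<open>y\<close> selects the root that makes
  coefficients tend to \<open>0\<close>.\<close>

lemma artin_schreier: "\<exists>a :: 'c. a - a ^ q = y \<and> (vabs y < 1 \<longrightarrow> vabs a \<le> vabs y)"
proof (cases "vabs y < 1")
  case False
  have "y \<in> closure (range \<iota>)"
    using dense_range by simp
  then obtain b where b: "dist (\<iota> b) y < 1"
    unfolding closure_approachable by (force dest: spec[of _ 1])
  define p :: "'k fls alg_closure poly" where "p = monom 1 q - monom 1 1 + [:b:]"
  have "coeff p q = 1"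
    using q_ge_2 by (simp add: p_def coeff_pCons split: nat.split)
  then have "degree p \<ge> q"
    by (intro le_degree) simp
  then obtain x where "poly p x = 0"
    using alg_closed_imp_poly_has_root[of p] q_ge_2 by auto
  then have "x - x ^ q = b"
    by (simp add: p_def poly_monom algebra_simps)
  then have x: "\<iota> x - \<iota> x ^ q = \<iota> b"
    by (simp flip: hom_power hom_minus)
  have "vabs (y - \<iota> b) < 1"
    using b by (metis dist_eq_dist_diff dist_commute)
  then obtain a where a: "a - a ^ q = y - \<iota> b"
    using artin_schreier_small by blast
  have "(a + \<iota> x) - (a + \<iota> x) ^ q = y"
    by (simp only: frob_add add_diff_add a x diff_add_cancel)
  with False show ?thesis
    by blast
qed (use artin_schreier_small in blast)

text \<open>The equation is solved in each coefficient separately. All but finitely many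
  coefficients of \<open>f\<close> are smaller than \<open>1\<close>, and there the chosen root is
  no larger than the coefficient.\<close>

lemma wp_surj:
  assumes "f \<in> tate_algebra"
  shows "\<exists>F\<in>tate_algebra. wp q F = (f :: 'c fps)"
proof -
  obtain a where a: "\<And>i. a i - a i ^ q = fps_nth f i"
    "\<And>i. vabs (fps_nth f i) < 1 \<Longrightarrow> vabs (a i) \<le> vabs (fps_nth f i)"
    using choice[of "\<lambda>i a. a - a ^ q = fps_nth f i \<and> (vabs (fps_nth f i) < 1 \<longrightarrow> vabs a \<le> vabs (fps_nth f i))"]
      artin_schreier by blast
  have lim: "(\<lambda>i. vabs (fps_nth f i)) \<longlonglongrightarrow> 0"
    using assms by (simp add: tate_algebra_eq tate_radius_def)
  have "\<forall>\<^sub>F i in sequentially. vabs (fps_nth f i) < 1"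
    using order_tendstoD(2)[OF lim] by simp
  then have "\<forall>\<^sub>F i in sequentially. vabs (a i) \<le> vabs (fps_nth f i)"
    by eventually_elim (rule a)
  then have "(\<lambda>i. vabs (a i)) \<longlonglongrightarrow> 0"
    by (intro tendsto_sandwich[OF _ _ tendsto_const lim]) auto
  then have "Abs_fps a \<in> tate_algebra"
    by (simp add: tate_algebra_eq tate_radius_def)
  moreover have "wp q (Abs_fps a) = f"
    by (rule fps_ext) (simp add: wp_def a)
  ultimately show ?thesis
    by blast
qed

text \<open>Once \<open>\<bar>a\<bar> < 1\<close>, the absolute values of \<open>a\<close> and \<open>a - a\<^sup>q\<close> agree, so \<open>\<wp>\<close> preserves
  the radius of convergence.\<close>

lemma tate_radius_if_wp:
  fixes F :: "'c fps"
  assumes F: "F \<in> tate_algebra" and wp: "wp q F \<in> tate_radius \<rho>"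
  shows "F \<in> tate_radius \<rho>"
proof -
  have "(\<lambda>i. vabs (fps_nth F i)) \<longlonglongrightarrow> 0"
    using F by (simp add: tate_algebra_eq tate_radius_def)
  then have "\<forall>\<^sub>F i in sequentially. vabs (fps_nth F i) < 1"
    by (rule order_tendstoD(2)) simp
  then have "\<forall>\<^sub>F i in sequentially. vabs (fps_nth (wp q F) i) * \<rho> ^ i = vabs (fps_nth F i) * \<rho> ^ i"
  proof eventually_elim
    case (elim i)
    let ?a = "fps_nth F i"
    show ?case
    proof (cases "?a = 0")
      case False
      have "vabs ?a ^ q < vabs ?a ^ 1"
        using elim False q_ge_2 by (intro power_strict_decreasing) auto
      then have "vabs (- (?a ^ q) + ?a) = vabs ?a"
        by (intro vabs_add_eq_max) (simp add: vabs_power)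
      then show ?thesis
        by (simp add: wp_def)
    qed (use q_ge_2 in \<open>simp add: wp_def\<close>)
  qed
  then show ?thesis
    using wp unfolding tate_radius_def mem_Collect_eq by (subst (asm) tendsto_cong)
qed

lemma wp_diff: "wp q (f - g) = wp q f - wp q g" for f g :: "'c fps"
  by (simp add: wp_def twist_diff)

lemma wp_add: "wp q (f + g) = wp q f + wp q g" for f g :: "'c fps"
  by (simp add: wp_def twist_add)

lemma wp_mult_kernel: "wp q a = 0 \<Longrightarrow> wp q (a * f) = a * wp q f" for a f :: "'c fps"
  by (simp add: wp_def twist_mult right_diff_distrib)

text \<open>The coefficients of \<open>a\<close> are fixed by Frobenius, hence lie in the finite
  field, whose nonzero elements have absolute value \<open>1\<close>. Since they tend to
  \<open>0\<close>, almost all of them vanish and \<open>a\<close> is a polynomial.\<close>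

lemma eval_wp_kernel:
  fixes a :: "'c fps"
  assumes a: "a \<in> tate_algebra" and wp: "wp q a = 0"
  shows "eval_at \<theta> a \<in> ring_A \<iota>"
proof -
  have "fps_nth a i ^ q = fps_nth a i" for i
    using wp by (metis wp_def eq_iff_diff_eq_0 twist_nth)
  then have "\<exists>c. fps_nth a i = emb c" for i
    using frob_fixed[of "fps_nth a i"] by blast
  then obtain c where c: "\<And>i. fps_nth a i = emb (c i)"
    using choice[of "\<lambda>i c. fps_nth a i = emb c"] by blast
  have "(\<lambda>i. vabs (fps_nth a i)) \<longlonglongrightarrow> 0"
    using a by (simp add: tate_algebra_eq tate_radius_def)
  then have "\<forall>\<^sub>F i in sequentially. vabs (fps_nth a i) < 1"
    by (rule order_tendstoD(2)) simp
  then obtain N where "\<And>i. i \<ge> N \<Longrightarrow> vabs (fps_nth a i) < 1"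
    by (auto simp: eventually_sequentially)
  then have c0: "c i = 0" if "i \<ge> N" for i
    using c vabs_emb that by (metis less_irrefl)
  define p where "p = (\<Sum>i<N. monom (c i) i)"
  have coeff: "coeff p i = c i" for i
    using c0[of i] by (auto simp: p_def coeff_sum if_distrib not_less cong: if_cong)
  then have "degree (map_poly emb p) \<le> N"
    using c0 by (intro degree_le) (auto simp: coeff_map_poly)
  have "eval_at \<theta> a = (\<Sum>i\<le>N. emb (c i) * \<theta> ^ i)"
    unfolding eval_at_def by (subst suminf_finite[of "{..N}"]) (auto simp: c c0)
  also have "\<dots> = poly (map_poly emb p) \<theta>"
    unfolding poly_altdef using \<open>degree (map_poly emb p) \<le> N\<close>
    by (intro sum.mono_neutral_cong_right)
      (auto simp: coeff_map_poly coeff intro!: le_degree)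
  finally show ?thesis
    unfolding ring_A_def emb_def[abs_def] theta_eq by blast
qed

end

section \<open>The function \<open>\<Omega>\<close>\<close>

context carlitz_setup
begin

definition omega_prod :: "nat \<Rightarrow> 'c fps"
  where "omega_prod N = (\<Prod>i=1..N. 1 - fps_const (inverse (\<theta> ^ (q ^ i))) * fps_X)"

text \<open>Separating the leading constant from \<open>\<Omega>\<close> leaves a series with
  constant term \<open>1\<close> and bounds that do not involve \<open>lam\<close>.\<close>

definition omega_lim :: "'c fps"
  where "omega_lim = Abs_fps (\<lambda>m. lim (\<lambda>N. fps_nth (omega_prod N) m))"

abbreviation \<Omega> :: "'c fps"
  where "\<Omega> \<equiv> Omega q \<theta> lam"

lemma Omega_eq: "\<Omega> = fps_const (inverse (lam ^ q)) * omega_lim"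
  by (simp add: Omega_def omega_lim_def omega_prod_def)

lemma real_q: "real q \<ge> 1" "real q \<ge> 0" "real q > 0" "real q > 1"
  using q_ge_2 by auto

lemma gauss_le_omega_prod: "gauss_le ((real q)\<^sup>2) (omega_prod N) 1"
proof -
  have "gauss_le ((real q)\<^sup>2) (1 - fps_const (inverse (\<theta> ^ (q ^ i))) * fps_X) 1" if "i \<in> {1..N}" for i
  proof (rule gauss_le_diff)
    have "2 \<le> q ^ i"
      using that q_ge_2 self_le_power[of q i] by simp
    then have "(real q)\<^sup>2 \<le> real q ^ (q ^ i)"
      using real_q by (intro power_increasing) auto
    then have "vabs (inverse (\<theta> ^ (q ^ i))) * (real q)\<^sup>2 \<le> 1"
      using real_q by (simp add: vabs_inverse vabs_divide vabs_power vabs_theta field_simps)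
    moreover have "gauss_le ((real q)\<^sup>2) (fps_const (inverse (\<theta> ^ (q ^ i))) * fps_X)
        (vabs (inverse (\<theta> ^ (q ^ i))) * (real q)\<^sup>2)"
      using real_q by (intro gauss_le_mult gauss_le_X) auto
    ultimately show "gauss_le ((real q)\<^sup>2) (fps_const (inverse (\<theta> ^ (q ^ i))) * fps_X) 1"
      by (rule gauss_le_mono[rotated])
  qed auto
  then have "gauss_le ((real q)\<^sup>2) (omega_prod N) (\<Prod>i=1..N. 1)"
    unfolding omega_prod_def using real_q by (intro gauss_le_prod) auto
  then show ?thesis
    by simp
qed

lemma q_less_square: "real q < (real q)\<^sup>2"
  using q_ge_2 by (simp add: power2_eq_square)

lemma omega_prod_in_tate_radius: "omega_prod N \<in> tate_radius (real q)"
  using gauss_le_omega_prod q_less_square by (intro tate_radius_if_gauss_le[of "(real q)\<^sup>2"]) auto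

text \<open>Passing from \<open>n\<close> to \<open>n + 1\<close> factors changes the product by a
  multiple of \<open>\<theta>^(-q^(n+1)) t\<close>, whose Gauss norm decays. Only this convergence
  gives the coefficientwise \<open>lim\<close> in the definition its meaning.\<close>

lemma omega_lim_tendsto: "(\<lambda>N. fps_nth (omega_prod N) m) \<longlonglongrightarrow> fps_nth omega_lim m"
proof -
  have step: "gauss_le (real q) (omega_prod (Suc n) - omega_prod n) ((1 / real q) ^ n)" for n
  proof -
    \<comment> \<open>Of the \<open>n + 1\<close> factors \<open>1/q\<close> obtained here, one is
      spent on the factor \<open>q\<close> contributed by \<open>fps_X\<close>.\<close>
    have "n + 1 \<le> q ^ Suc n"
      using power_gt_expt[of q "Suc n"] q_ge_2 by simp
    then have "(1 / real q) ^ (q ^ Suc n) \<le> (1 / real q) ^ (n + 1)"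
      using real_q by (intro power_decreasing) auto
    then have "vabs (inverse (\<theta> ^ (q ^ Suc n))) \<le> (1 / real q) ^ (n + 1)"
      by (simp add: vabs_inverse vabs_power vabs_theta power_divide inverse_eq_divide vabs_divide del: power_Suc)
    then have "vabs (inverse (\<theta> ^ (q ^ Suc n))) * real q \<le> (1 / real q) ^ (n + 1) * real q"
      by (rule mult_right_mono) simp
    then have le: "vabs (inverse (\<theta> ^ (q ^ Suc n))) * real q \<le> (1 / real q) ^ n"
      using real_q by simp
    have "gauss_le (real q) (omega_prod n) 1"
      unfolding gauss_le_def
    proof
      fix m
      have "vabs (fps_nth (omega_prod n) m) * real q ^ m \<le> vabs (fps_nth (omega_prod n) m) * (real q)\<^sup>2 ^ m"
        using q_less_square by (intro mult_left_mono power_mono) auto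
      also have "\<dots> \<le> 1"
        by (rule gauss_leD[OF gauss_le_omega_prod])
      finally show "vabs (fps_nth (omega_prod n) m) * real q ^ m \<le> 1" .
    qed
    then have "gauss_le (real q) (fps_const (inverse (\<theta> ^ (q ^ Suc n))) * fps_X * omega_prod n)
        (vabs (inverse (\<theta> ^ (q ^ Suc n))) * real q * 1)"
      using real_q by (intro gauss_le_mult gauss_le_X gauss_le_const) auto
    then have "gauss_le (real q) (fps_const (inverse (\<theta> ^ (q ^ Suc n))) * fps_X * omega_prod n) ((1 / real q) ^ n)"
      using le by (auto elim: gauss_le_mono)
    moreover have "omega_prod (Suc n) - omega_prod n =
        - (fps_const (inverse (\<theta> ^ (q ^ Suc n))) * fps_X * omega_prod n)"
      by (simp add: omega_prod_def algebra_simps)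
    ultimately show ?thesis
      by (simp only: gauss_le_minus)
  qed
  have cau: "\<exists>N. \<forall>n\<ge>N. gauss_le (real q) (omega_prod (Suc n) - omega_prod n) e" if e: "e > 0" for e
  proof -
    obtain N where N: "(1 / real q) ^ N < e"
      using real_arch_pow_inv[OF e, of "1 / real q"] real_q by auto
    have "gauss_le (real q) (omega_prod (Suc n) - omega_prod n) e" if "n \<ge> N" for n
    proof (rule gauss_le_mono[OF step])
      have "(1 / real q) ^ n \<le> (1 / real q) ^ N"
        using that real_q by (intro power_decreasing) auto
      with N show "(1 / real q) ^ n \<le> e"
        by linarith
    qed
    then show ?thesis
      by blast
  qed
  obtain P where "P \<in> tate_radius (real q)"
    and P: "\<And>m. (\<lambda>n. fps_nth (omega_prod n) m) \<longlonglongrightarrow> fps_nth P m"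
    and "\<And>e. e > 0 \<Longrightarrow> \<exists>N. \<forall>n\<ge>N. gauss_le (real q) (P - omega_prod n) e"
    by (rule tate_radius_limit[OF omega_prod_in_tate_radius real_q(3) cau]) (assumption | rule that)+
  from P have "convergent (\<lambda>N. fps_nth (omega_prod N) m)"
    by (auto simp: convergent_def)
  then show ?thesis
    by (simp add: omega_lim_def convergent_LIMSEQ_iff)
qed

lemma gauss_le_omega_lim: "gauss_le ((real q)\<^sup>2) omega_lim 1"
  unfolding gauss_le_def
proof
  fix m
  have "vabs (fps_nth (omega_prod N) m) \<le> 1 / (real q)\<^sup>2 ^ m" for N
    using gauss_leD[OF gauss_le_omega_prod, of N m] real_q by (simp add: field_simps)
  then have "vabs (fps_nth omega_lim m) \<le> 1 / (real q)\<^sup>2 ^ m"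
    by (intro vabs_limit_le[OF omega_lim_tendsto]) (auto intro: always_eventually)
  then show "vabs (fps_nth omega_lim m) * (real q)\<^sup>2 ^ m \<le> 1"
    using real_q by (simp add: field_simps)
qed

lemma omega_lim_0: "fps_nth omega_lim 0 = 1"
proof -
  have "fps_nth (omega_prod N) 0 = 1" for N
    by (induction N) (simp_all add: omega_prod_def)
  then show ?thesis
    using omega_lim_tendsto[of 0] by (simp add: LIMSEQ_const_iff)
qed

lemma lam_nonzero: "lam \<noteq> 0"
  using lam_power theta_nonzero q_ge_2 by (auto simp: power_0_left split: if_splits)

lemma Omega_in_tate_radius: "\<Omega> \<in> tate_radius (real q)"
  unfolding Omega_eq using real_q gauss_le_omega_lim q_less_square
  by (intro tate_radius_mult tate_radius_const) (auto intro: tate_radius_if_gauss_le)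

lemma inverse_Omega_in_tate_radius: "inverse \<Omega> \<in> tate_radius (real q)"
proof -
  have "gauss_le ((real q)\<^sup>2) (inverse omega_lim) 1"
    using gauss_le_omega_lim omega_lim_0 real_q by (intro gauss_le_inverse) auto
  then have "inverse omega_lim \<in> tate_radius (real q)"
    using real_q q_less_square by (auto intro: tate_radius_if_gauss_le)
  moreover have "inverse \<Omega> = fps_const (lam ^ q) * inverse omega_lim"
    by (simp add: Omega_eq fps_inverse_mult fps_const_inverse)
  ultimately show ?thesis
    using real_q by (auto intro: tate_radius_mult)
qed

lemma Omega_mult_inverse: "\<Omega> * inverse \<Omega> = 1"
  using lam_nonzero omega_lim_0 by (intro inverse_mult_eq_1') (simp add: Omega_eq)

text \<open>That \<open>\<Omega>\<close> does not vanish at \<open>\<theta>\<close> follows from its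
  inverse converging there too, so the division defining the period is a true reciprocal.\<close>

lemma eval_Omega_mult_period: "eval_at \<theta> \<Omega> * carlitz_period q \<theta> lam = 1"
  and eval_inverse_Omega: "eval_at \<theta> (inverse \<Omega>) = carlitz_period q \<theta> lam"
proof -
  have *: "eval_at \<theta> \<Omega> * eval_at \<theta> (inverse \<Omega>) = 1"
    using eval_at_mult[OF Omega_in_tate_radius inverse_Omega_in_tate_radius real_q(3), of \<theta>]
    by (simp add: Omega_mult_inverse vabs_theta)
  then show "eval_at \<theta> \<Omega> * carlitz_period q \<theta> lam = 1"
    by (auto simp: carlitz_period_def)
  then show "eval_at \<theta> (inverse \<Omega>) = carlitz_period q \<theta> lam"
    using * by (metis mult_left_cancel mult_zero_left zero_neq_one)
qed

lemma period_nonzero: "carlitz_period q \<theta> lam \<noteq> 0"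
  using eval_Omega_mult_period by auto

lemma vabs_lam: "vabs lam = real q powr (1 / (real q - 1))"
proof -
  have "vabs lam ^ (q - 1) = real q"
    using lam_power vabs_power[of lam "q - 1"] by (simp add: vabs_theta)
  then have "vabs lam powr real (q - 1) = real q"
    using lam_nonzero by (simp add: powr_realpow)
  then have "real q powr (1 / (real q - 1)) = vabs lam powr (real (q - 1) * (1 / (real q - 1)))"
    by (metis powr_powr)
  also have "real (q - 1) * (1 / (real q - 1)) = 1"
    using q_ge_2 by (simp add: of_nat_diff)
  finally show ?thesis
    using lam_nonzero by simp
qed

lemma gauss_le_Omega_power:
  "gauss_le (real q) (\<Omega> ^ n) (real q powr (- (real q * real n / (real q - 1))))"
proof -
  have "gauss_le (real q) omega_lim 1"
    unfolding gauss_le_def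
  proof
    fix m
    have "vabs (fps_nth omega_lim m) * real q ^ m \<le> vabs (fps_nth omega_lim m) * (real q)\<^sup>2 ^ m"
      using q_less_square by (intro mult_left_mono power_mono) auto
    also have "\<dots> \<le> 1"
      by (rule gauss_leD[OF gauss_le_omega_lim])
    finally show "vabs (fps_nth omega_lim m) * real q ^ m \<le> 1" .
  qed
  then have "gauss_le (real q) (\<Omega> ^ n) ((vabs (inverse (lam ^ q)) * 1) ^ n)"
    unfolding Omega_eq using real_q by (intro gauss_le_power gauss_le_mult gauss_le_const) auto
  also have "(vabs (inverse (lam ^ q)) * 1) ^ n = inverse (vabs lam ^ (q * n))"
    by (simp add: vabs_inverse vabs_power power_inverse power_mult)
  also have "\<dots> = inverse (vabs lam powr real (q * n))"
    using lam_nonzero by (simp add: powr_realpow flip: of_nat_mult)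
  also have "\<dots> = real q powr (- (real q * real n / (real q - 1)))"
    by (simp add: vabs_lam powr_powr powr_minus field_simps)
  finally show ?thesis .
qed

text \<open>The twist shifts the product by one factor, so only \<open>1 - t/\<theta>^q\<close> is
  missing. The leading constant supplies the factor that turns it into
  \<open>t - \<theta>^q\<close>.\<close>

lemma Omega_functional_equation: "\<Omega> = (fps_X - fps_const (\<theta> ^ q)) * twist q \<Omega>"
proof -
  have prod_Suc: "omega_prod (Suc N) = (1 - fps_const (inverse (\<theta> ^ q)) * fps_X) * twist q (omega_prod N)" for N
  proof -
    have "omega_prod (Suc N) = (\<Prod>i\<in>insert 1 {Suc 1..Suc N}. 1 - fps_const (inverse (\<theta> ^ (q ^ i))) * fps_X)"
      unfolding omega_prod_def by (rule prod.cong) auto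
    also have "\<dots> = (1 - fps_const (inverse (\<theta> ^ q)) * fps_X) *
        (\<Prod>i\<in>{Suc 1..Suc N}. 1 - fps_const (inverse (\<theta> ^ (q ^ i))) * fps_X)"
      by simp
    also have "(\<Prod>i\<in>{Suc 1..Suc N}. 1 - fps_const (inverse (\<theta> ^ (q ^ i))) * fps_X) = twist q (omega_prod N)"
      unfolding prod.atLeast_Suc_atMost_Suc_shift omega_prod_def twist_prod
      by (rule prod.cong)
        (simp_all add: twist_diff twist_mult twist_const power_inverse mult.commute flip: power_mult)
    finally show ?thesis .
  qed
  have lim: "omega_lim = (1 - fps_const (inverse (\<theta> ^ q)) * fps_X) * twist q omega_lim"
  proof (rule fps_ext)
    fix m
    have "(\<lambda>N. fps_nth ((1 - fps_const (inverse (\<theta> ^ q)) * fps_X) * twist q (omega_prod N)) m)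
        \<longlonglongrightarrow> fps_nth ((1 - fps_const (inverse (\<theta> ^ q)) * fps_X) * twist q omega_lim) m"
      unfolding fps_mult_nth twist_nth
      by (intro tendsto_intros tendsto_power_strong omega_lim_tendsto)
    then show "fps_nth omega_lim m =
        fps_nth ((1 - fps_const (inverse (\<theta> ^ q)) * fps_X) * twist q omega_lim) m"
      using LIMSEQ_Suc[OF omega_lim_tendsto, of m] unfolding prod_Suc by (rule LIMSEQ_unique[rotated])
  qed
  \<comment> \<open>This is where the choice of \<open>lam\<close> as a root of
    \<open>- \<theta>\<close> enters.\<close>
  have "lam ^ q = - \<theta> * lam"
    using q_ge_2 by (simp flip: lam_power power_Suc2)
  then have "(lam ^ q) ^ q = - (\<theta> ^ q) * lam ^ q"
    by (simp only: power_mult_distrib frob_minus)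
  then have *: "inverse ((lam ^ q) ^ q) = inverse (lam ^ q) * - inverse (\<theta> ^ q)"
    by simp
  have "(fps_X - fps_const (\<theta> ^ q)) * twist q \<Omega> =
      fps_const (inverse ((lam ^ q) ^ q)) * (fps_X - fps_const (\<theta> ^ q)) * twist q omega_lim"
    by (simp add: Omega_eq twist_mult twist_const power_inverse mult_ac)
  also have "fps_const (inverse ((lam ^ q) ^ q)) * (fps_X - fps_const (\<theta> ^ q)) =
      fps_const (inverse (lam ^ q)) * (1 - fps_const (inverse (\<theta> ^ q)) * fps_X)"
    unfolding * using theta_nonzero by (intro fps_ext) (simp add: fps_X_def mult.assoc)
  also have "\<dots> * twist q omega_lim = \<Omega>"
    by (simp add: Omega_eq lim[symmetric] mult.assoc)
  finally show ?thesis ..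
qed

text \<open>Stated without division: that \<open>L_poly q \<theta> i\<close> is nonzero is later
  read off from this identity, whose right-hand side is nonzero.\<close>

lemma eval_twist_Omega: "eval_at \<theta> ((twist q ^^ i) \<Omega>) * L_poly q \<theta> i = eval_at \<theta> \<Omega>"
proof (induction i)
  case 0
  then show ?case
    by (simp add: L_poly_def)
next
  case (Suc i)
  have in_T: "(twist q ^^ j) \<Omega> \<in> tate_radius (real q)" for j
    using Omega_in_tate_radius real_q by (intro tate_radius_twist_iter) auto
  \<comment> \<open>The functional equation twisted \<open>i\<close> times; at
    \<open>t = \<theta>\<close> its linear factor is the new factor of
    \<open>L_poly q \<theta> (Suc i)\<close>.\<close>
  have "(twist q ^^ i) \<Omega> = (fps_X - fps_const (\<theta> ^ (q ^ Suc i))) * (twist q ^^ Suc i) \<Omega>"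
  proof (induction i)
    case 0
    then show ?case
      using Omega_functional_equation by simp
  next
    case (Suc i)
    have "(twist q ^^ Suc i) \<Omega> = twist q ((twist q ^^ i) \<Omega>)"
      by simp
    also have "\<dots> = (fps_X - fps_const ((\<theta> ^ (q ^ Suc i)) ^ q)) * (twist q ^^ Suc (Suc i)) \<Omega>"
      by (subst Suc.IH) (simp add: twist_mult twist_diff twist_const)
    finally show ?case
      by (simp add: mult.commute flip: power_mult)
  qed
  then have "eval_at \<theta> ((twist q ^^ i) \<Omega>) = (\<theta> - \<theta> ^ (q ^ Suc i)) * eval_at \<theta> ((twist q ^^ Suc i) \<Omega>)"
    using in_T[of "Suc i"] real_q vabs_theta
    by (simp only: eval_at_mult[of _ "real q"] tate_radius_diff tate_radius_X tate_radius_const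
        eval_at_diff[of _ "real q"] eval_at_X eval_at_const order.refl)
  then show ?case
    using Suc.IH by (simp add: L_poly_def mult_ac)
qed

end

section \<open>The solution given by the star polylogarithm series\<close>

text \<open>A finite exhaustion of the index tuples by their largest entry, which is also the
  quantity that \<open>D_star\<close> lets tend to infinity.\<close>

definition incr_upto :: "nat \<Rightarrow> nat \<Rightarrow> nat list set"
  where "incr_upto r N = {I. length I = r \<and> sorted I \<and> set I \<subseteq> {..N}}"

lemma finite_incr_upto: "finite (incr_upto r N)"
  by (rule finite_subset[OF _ finite_lists_length_eq[of "{..N}" r]]) (auto simp: incr_upto_def)

lemma incr_upto_mono: "incr_upto r N \<subseteq> incr_upto r (Suc N)"
  by (auto simp: incr_upto_def)

lemma incr_upto_0: "incr_upto 0 N = {[]}"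
  by (auto simp: incr_upto_def)

lemma weakly_increasing_eq_UN: "weakly_increasing r = (\<Union>N. incr_upto r N)"
proof -
  have "\<exists>N. set I \<subseteq> {..N}" for I :: "nat list"
    \<comment> \<open>For the empty tuple \<open>Max\<close> has no specified value, but then any
      bound will do.\<close>
    by (intro exI[of _ "Max (set I)"]) auto
  then show ?thesis
    by (auto simp: weakly_increasing_def incr_upto_def)
qed

lemma sorted_le_last: "sorted I \<Longrightarrow> x \<in> set I \<Longrightarrow> x \<le> last I"
  by (cases I rule: rev_cases) (auto simp: sorted_append)

lemma last_gt_if_not_incr_upto:
  "I \<in> weakly_increasing r \<Longrightarrow> I \<notin> incr_upto r N \<Longrightarrow> last I > N"
  by (force simp: weakly_increasing_def incr_upto_def dest: sorted_le_last)

text \<open>A sorted tuple either starts with \<open>0\<close> or has positive entries only; in the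
  second case all entries can be lowered by \<open>1\<close>.\<close>

lemma incr_upto_Suc:
  "incr_upto (Suc r) (Suc N) = (#) 0 ` incr_upto r (Suc N) \<union> map Suc ` incr_upto (Suc r) N"
proof (intro equalityI subsetI)
  fix I assume I: "I \<in> incr_upto (Suc r) (Suc N)"
  then obtain i J where IJ: "I = i # J"
    by (auto simp: incr_upto_def length_Suc_conv)
  show "I \<in> (#) 0 ` incr_upto r (Suc N) \<union> map Suc ` incr_upto (Suc r) N"
  proof (cases "i = 0")
    case True
    then show ?thesis
      using I by (auto simp: IJ incr_upto_def)
  next
    case False
    then have pos: "x > 0" if "x \<in> set I" for x
      using I that by (auto simp: IJ incr_upto_def)
    define K where "K = map (\<lambda>x. x - 1) I"
    have "map Suc K = I"
      using pos by (auto simp: K_def o_def intro!: map_idI)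
    moreover have "K \<in> incr_upto (Suc r) N"
      using I by (fastforce simp: K_def incr_upto_def sorted_map intro: sorted_wrt_mono_rel[of I "(\<le>)"])
    ultimately show ?thesis
      by force
  qed
next
  fix I assume "I \<in> (#) 0 ` incr_upto r (Suc N) \<union> map Suc ` incr_upto (Suc r) N"
  then show "I \<in> incr_upto (Suc r) (Suc N)"
    by (force simp: incr_upto_def sorted_map intro: sorted_wrt_mono_rel)
qed

context carlitz_setup
begin

section \<open>Truncated star series and their terms\<close>

definition star_sum :: "'c fps list \<Rightarrow> nat \<Rightarrow> 'c fps"
  where "star_sum Ys N =
    (\<Sum>I\<in>incr_upto (length Ys) N. \<Prod>j<length Ys. (twist q ^^ (I ! j)) (Ys ! j))"

lemma star_sum_Nil [simp]: "star_sum [] N = 1"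
  by (simp add: star_sum_def incr_upto_0)

text \<open>Tuples starting with \<open>0\<close> contribute the untwisted factor \<open>Y\<close>;
  raising all indices by \<open>1\<close> applies one more twist. The cutoffs \<open>Suc N\<close>
  and \<open>N\<close> make the identity exact before any limit is taken, and in the limit it
  becomes an equation of the star system.\<close>

lemma star_sum_Cons:
  "star_sum (Y # Ys) (Suc N) = Y * star_sum Ys (Suc N) + twist q (star_sum (Y # Ys) N)"
proof -
  define r where "r = length Ys"
  define t where "t I = (\<Prod>j<Suc r. (twist q ^^ (I ! j)) ((Y # Ys) ! j))" for I
  have "star_sum (Y # Ys) (Suc N) = sum t ((#) 0 ` incr_upto r (Suc N) \<union> map Suc ` incr_upto (Suc r) N)"
    by (simp add: star_sum_def t_def r_def flip: incr_upto_Suc)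
  also have "\<dots> = sum t ((#) 0 ` incr_upto r (Suc N)) + sum t (map Suc ` incr_upto (Suc r) N)"
  proof (rule sum.union_disjoint)
    show "(#) 0 ` incr_upto r (Suc N) \<inter> map Suc ` incr_upto (Suc r) N = {}"
      by (auto simp: incr_upto_def length_Suc_conv)
  qed (simp_all add: finite_incr_upto)
  also have "sum t ((#) 0 ` incr_upto r (Suc N)) = (\<Sum>J\<in>incr_upto r (Suc N). t (0 # J))"
    by (subst sum.reindex) (auto simp: inj_on_def)
  also have "\<dots> = Y * star_sum Ys (Suc N)"
    unfolding star_sum_def sum_distrib_left
    by (intro sum.cong) (simp_all add: t_def r_def prod.lessThan_Suc_shift del: prod.lessThan_Suc)
  also have "sum t (map Suc ` incr_upto (Suc r) N) = (\<Sum>J\<in>incr_upto (Suc r) N. t (map Suc J))"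
    by (subst sum.reindex) (auto simp: inj_on_def inj_map_eq_map)
  also have "\<dots> = twist q (star_sum (Y # Ys) N)"
    unfolding star_sum_def twist_sum
  proof (intro sum.cong)
    fix J assume "J \<in> incr_upto (length (Y # Ys)) N"
    then have "length J = Suc r"
      by (simp add: incr_upto_def r_def)
    then have "t (map Suc J) = (\<Prod>j<Suc r. twist q ((twist q ^^ (J ! j)) ((Y # Ys) ! j)))"
      unfolding t_def by (intro prod.cong) auto
    then show "t (map Suc J) = twist q (\<Prod>j<length (Y # Ys). (twist q ^^ (J ! j)) ((Y # Ys) ! j))"
      by (simp only: twist_prod r_def length_Cons)
  qed (simp add: r_def)
  finally show ?thesis .
qed

text \<open>The base of the \<open>j\<close>-th power in the condition of \<open>D_star\<close>, and
  at the same time a Gauss bound at radius \<open>q\<close> for the \<open>j\<close>-th entry of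
  \<open>Y_seq\<close>.\<close>

definition D_bound :: "nat list \<Rightarrow> 'c list \<Rightarrow> nat \<Rightarrow> real"
  where "D_bound ms xs j = vabs (xs ! j) * real q powr (- (real q * real (ms ! j) / (real q - 1)))"

definition Li_term :: "nat list \<Rightarrow> 'c list \<Rightarrow> nat list \<Rightarrow> 'c"
  where "Li_term ms xs I = (\<Prod>j<length ms. (xs ! j) ^ (q ^ (I ! j)) / L_poly q \<theta> (I ! j) ^ (ms ! j))"

lemma D_bound_nonneg: "D_bound ms xs j \<ge> 0"
  by (simp add: D_bound_def)

lemma length_Y_seq: "length (Y_seq q \<theta> lam ms xs) = min (length ms) (length xs)"
  by (simp add: Y_seq_def)

lemma Y_seq_nth:
  "j < length ms \<Longrightarrow> j < length xs \<Longrightarrow> Y_seq q \<theta> lam ms xs ! j = \<Omega> ^ (ms ! j) * fps_const (xs ! j)"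
  by (simp add: Y_seq_def)

lemma drop_Y_seq: "drop i (Y_seq q \<theta> lam ms xs) = Y_seq q \<theta> lam (drop i ms) (drop i xs)"
  by (simp add: Y_seq_def drop_map drop_zip)

lemma Y_in_tate_radius: "\<Omega> ^ n * fps_const x \<in> tate_radius (real q)"
  using real_q by (intro tate_radius_mult tate_radius_power Omega_in_tate_radius) auto

lemma gauss_le_Y: "gauss_le (real q) (\<Omega> ^ (ms ! j) * fps_const (xs ! j)) (D_bound ms xs j)"
  unfolding D_bound_def mult.commute[of "vabs _"]
  using real_q by (intro gauss_le_mult gauss_le_Omega_power gauss_le_const) auto

context
  fixes ms :: "nat list" and xs :: "'c list"
  assumes len: "length xs = length ms"
begin

lemma
  fixes I :: "nat list"
  defines "f \<equiv> (\<Prod>j<length ms. (twist q ^^ (I ! j)) (Y_seq q \<theta> lam ms xs ! j))"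
  shows star_term_in_tate_radius: "f \<in> tate_radius (real q)"
    and gauss_le_star_term: "gauss_le (real q) f (\<Prod>j<length ms. D_bound ms xs j ^ (q ^ (I ! j)))"
    and eval_star_term: "eval_at \<theta> f = eval_at \<theta> \<Omega> ^ sum_list ms * Li_term ms xs I"
proof -
  have in_T: "(twist q ^^ i) (Y_seq q \<theta> lam ms xs ! j) \<in> tate_radius (real q)" if "j < length ms" for i j
    using that len real_q Y_in_tate_radius
    by (intro tate_radius_twist_iter) (auto simp: Y_seq_nth)
  show "f \<in> tate_radius (real q)"
    unfolding f_def using in_T real_q by (intro tate_radius_prod) auto
  show "gauss_le (real q) f (\<Prod>j<length ms. D_bound ms xs j ^ (q ^ (I ! j)))"
    unfolding f_def using len real_q gauss_le_Y[of ms _ xs]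
    by (intro gauss_le_prod gauss_le_twist_iter) (auto simp: Y_seq_nth)
  have "eval_at \<theta> f = (\<Prod>j<length ms. eval_at \<theta> ((twist q ^^ (I ! j)) (Y_seq q \<theta> lam ms xs ! j)))"
    unfolding f_def using in_T real_q vabs_theta by (intro eval_at_prod[where \<rho> = "real q"]) auto
  also have "\<dots> = (\<Prod>j<length ms. eval_at \<theta> \<Omega> ^ (ms ! j) *
      ((xs ! j) ^ (q ^ (I ! j)) / L_poly q \<theta> (I ! j) ^ (ms ! j)))"
  proof (rule prod.cong)
    fix j assume j: "j \<in> {..<length ms}"
    define i where "i = I ! j"
    have tw: "(twist q ^^ i) \<Omega> \<in> tate_radius (real q)"
      using Omega_in_tate_radius real_q by (intro tate_radius_twist_iter) auto
    \<comment> \<open>It divides \<open>\<Omega>(\<theta>)\<close>, which is nonzero.\<close>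
    have "L_poly q \<theta> i \<noteq> 0"
      using eval_twist_Omega[of i] eval_Omega_mult_period by auto
    then have ev: "eval_at \<theta> ((twist q ^^ i) \<Omega>) = eval_at \<theta> \<Omega> / L_poly q \<theta> i"
      using eval_twist_Omega[of i] by (simp add: field_simps)
    have "(twist q ^^ i) (Y_seq q \<theta> lam ms xs ! j) = (twist q ^^ i) \<Omega> ^ (ms ! j) * fps_const ((xs ! j) ^ (q ^ i))"
      using j len by (simp add: Y_seq_nth twist_iter_mult twist_iter_power twist_iter_const)
    then have "eval_at \<theta> ((twist q ^^ i) (Y_seq q \<theta> lam ms xs ! j)) =
        (eval_at \<theta> \<Omega> / L_poly q \<theta> i) ^ (ms ! j) * (xs ! j) ^ (q ^ i)"
      using tw real_q vabs_theta
      by (simp add: eval_at_mult[where \<rho> = "real q"] eval_at_power[where \<rho> = "real q"] tate_radius_power ev)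
    then show "eval_at \<theta> ((twist q ^^ (I ! j)) (Y_seq q \<theta> lam ms xs ! j)) = eval_at \<theta> \<Omega> ^ (ms ! j) *
        ((xs ! j) ^ (q ^ (I ! j)) / L_poly q \<theta> (I ! j) ^ (ms ! j))"
      by (simp add: i_def power_divide)
  qed simp
  also have "\<dots> = eval_at \<theta> \<Omega> ^ sum_list ms * Li_term ms xs I"
    unfolding prod.distrib Li_term_def sum_list_sum_nth power_sum lessThan_atLeast0 ..
  finally show "eval_at \<theta> f = eval_at \<theta> \<Omega> ^ sum_list ms * Li_term ms xs I" .
qed

text \<open>No estimate of \<open>L_poly\<close> is needed: the term is \<open>\<pi>^w\<close> times
  the value at \<open>\<theta>\<close> of a product of twists, and a value is bounded by the Gauss
  norm.\<close>

lemma vabs_Li_term_le: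
  "vabs (Li_term ms xs I) \<le>
    vabs (carlitz_period q \<theta> lam) ^ sum_list ms * (\<Prod>j<length ms. D_bound ms xs j ^ (q ^ (I ! j)))"
proof -
  let ?f = "\<Prod>j<length ms. (twist q ^^ (I ! j)) (Y_seq q \<theta> lam ms xs ! j)"
  have "Li_term ms xs I = (eval_at \<theta> \<Omega> * carlitz_period q \<theta> lam) ^ sum_list ms * Li_term ms xs I"
    by (simp add: eval_Omega_mult_period)
  also have "\<dots> = carlitz_period q \<theta> lam ^ sum_list ms * eval_at \<theta> ?f"
    by (simp add: eval_star_term power_mult_distrib)
  finally have "vabs (Li_term ms xs I) = vabs (carlitz_period q \<theta> lam) ^ sum_list ms * vabs (eval_at \<theta> ?f)"
    by (simp add: dist_mult_zero vabs_power)
  moreover have "vabs (eval_at \<theta> ?f) \<le> (\<Prod>j<length ms. D_bound ms xs j ^ (q ^ (I ! j)))"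
    using vabs_theta by (intro eval_at_le[OF star_term_in_tate_radius _ gauss_le_star_term]) auto
  ultimately show ?thesis
    by (simp add: mult_left_mono)
qed

lemma star_sum_in_tate_radius: "star_sum (Y_seq q \<theta> lam ms xs) N \<in> tate_radius (real q)"
  unfolding star_sum_def using star_term_in_tate_radius real_q len
  by (intro tate_radius_sum) (auto simp: length_Y_seq)

lemma eval_star_sum:
  "eval_at \<theta> (star_sum (Y_seq q \<theta> lam ms xs) N) =
    eval_at \<theta> \<Omega> ^ sum_list ms * (\<Sum>I\<in>incr_upto (length ms) N. Li_term ms xs I)"
proof -
  have "eval_at \<theta> (star_sum (Y_seq q \<theta> lam ms xs) N) =
      (\<Sum>I\<in>incr_upto (length ms) N.
        eval_at \<theta> (\<Prod>j<length ms. (twist q ^^ (I ! j)) (Y_seq q \<theta> lam ms xs ! j)))"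
    unfolding star_sum_def using star_term_in_tate_radius vabs_theta len
    by (simp add: length_Y_seq) (intro eval_at_sum[where \<rho> = "real q"], auto)
  then show ?thesis
    by (simp add: eval_star_term sum_distrib_left)
qed

section \<open>Convergence on the region \<open>D_star\<close>\<close>

lemma Li_star_tendsto:
  assumes D: "xs \<in> D_star q ms"
  shows "(\<lambda>N. \<Sum>I\<in>incr_upto (length ms) N. Li_term ms xs I) \<longlonglongrightarrow> Li_star q \<theta> ms xs"
proof -
  define P where "P = vabs (carlitz_period q \<theta> lam) ^ sum_list ms"
  have P: "P > 0"
    using period_nonzero by (simp add: P_def)
  have "\<exists>N. \<forall>I\<in>weakly_increasing (length ms) - incr_upto (length ms) N. vabs (Li_term ms xs I) < e"
    if "e > 0" for e
  proof -
    obtain N where N: "\<And>I. I \<in> weakly_increasing (length ms) \<Longrightarrow> last I \<ge> N \<Longrightarrow>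
        (\<Prod>j<length ms. D_bound ms xs j ^ (q ^ (I ! j))) < e / P"
      using D \<open>e > 0\<close> P unfolding D_star_def D_bound_def by (force dest: spec[of _ "e / P"])
    have "vabs (Li_term ms xs I) < e" if "I \<in> weakly_increasing (length ms) - incr_upto (length ms) N" for I
    proof -
      have "(\<Prod>j<length ms. D_bound ms xs j ^ (q ^ (I ! j))) < e / P"
        using that last_gt_if_not_incr_upto[of I "length ms" N] by (intro N) auto
      then have "P * (\<Prod>j<length ms. D_bound ms xs j ^ (q ^ (I ! j))) < e"
        using P by (simp add: field_simps)
      then show ?thesis
        using vabs_Li_term_le[of I] by (simp add: P_def)
    qed
    then show ?thesis
      by blast
  qed
  then obtain s where s: "(Li_term ms xs has_sum s) (weakly_increasing (length ms))"
    "(\<lambda>N. sum (Li_term ms xs) (incr_upto (length ms) N)) \<longlonglongrightarrow> s"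
    using nonarch_has_sum[OF finite_incr_upto incr_upto_mono weakly_increasing_eq_UN] by blast
  have "Li_star q \<theta> ms xs = s"
    unfolding Li_star_def using infsumI[OF s(1)] by (simp add: Li_term_def[abs_def])
  with s(2) show ?thesis
    by simp
qed

text \<open>Raising the cutoff above \<open>n\<close> adds only tuples whose last index exceeds
  \<open>n\<close>, and on \<open>D_star\<close> their Gauss norms are uniformly small. The value at
  \<open>\<theta>\<close> is then computed as a limit of values of truncations.\<close>

lemma star_sum_converges:
  assumes D: "xs \<in> D_star q ms"
  shows "\<exists>F\<in>tate_radius (real q).
    (\<forall>m. (\<lambda>N. fps_nth (star_sum (Y_seq q \<theta> lam ms xs) N) m) \<longlonglongrightarrow> fps_nth F m) \<and>
    eval_at \<theta> F = eval_at \<theta> \<Omega> ^ sum_list ms * Li_star q \<theta> ms xs"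
proof -
  let ?S = "star_sum (Y_seq q \<theta> lam ms xs)"
  have cau: "\<exists>N. \<forall>n\<ge>N. gauss_le (real q) (?S (Suc n) - ?S n) e" if e: "e > 0" for e
  proof -
    obtain N where N: "\<And>I. I \<in> weakly_increasing (length ms) \<Longrightarrow> last I \<ge> N \<Longrightarrow>
        (\<Prod>j<length ms. D_bound ms xs j ^ (q ^ (I ! j))) < e"
      using D e unfolding D_star_def D_bound_def by (force dest: spec[of _ e])
    have "gauss_le (real q) (?S (Suc n) - ?S n) e" if "n \<ge> N" for n
    proof -
      have "?S (Suc n) - ?S n = (\<Sum>I\<in>incr_upto (length ms) (Suc n) - incr_upto (length ms) n.
          \<Prod>j<length ms. (twist q ^^ (I ! j)) (Y_seq q \<theta> lam ms xs ! j))"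
        unfolding star_sum_def using len incr_upto_mono finite_incr_upto
        by (simp add: length_Y_seq sum_diff)
      moreover have "gauss_le (real q) \<dots> e"
      proof (rule gauss_le_sum)
        fix I assume I: "I \<in> incr_upto (length ms) (Suc n) - incr_upto (length ms) n"
        then have "I \<in> weakly_increasing (length ms)"
          unfolding weakly_increasing_eq_UN by blast
        then have "(\<Prod>j<length ms. D_bound ms xs j ^ (q ^ (I ! j))) < e"
          using I last_gt_if_not_incr_upto[of I "length ms" n] that by (intro N) auto
        then show "gauss_le (real q) (\<Prod>j<length ms. (twist q ^^ (I ! j)) (Y_seq q \<theta> lam ms xs ! j)) e"
          by (intro gauss_le_mono[OF gauss_le_star_term]) simp
      qed (use e real_q in auto)
      ultimately show ?thesis
        by simp
    qed
    then show ?thesis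
      by blast
  qed
  obtain F where F: "F \<in> tate_radius (real q)" "\<And>m. (\<lambda>n. fps_nth (?S n) m) \<longlonglongrightarrow> fps_nth F m"
    and unif: "\<And>e. e > 0 \<Longrightarrow> \<exists>N. \<forall>n\<ge>N. gauss_le (real q) (F - ?S n) e"
    by (rule tate_radius_limit[OF star_sum_in_tate_radius real_q(3) cau]) (assumption | rule that)+
  have "(\<lambda>N. eval_at \<theta> (?S N)) \<longlonglongrightarrow> eval_at \<theta> F"
    using star_sum_in_tate_radius F(1) _ unif by (rule eval_at_tendsto) (simp add: vabs_theta)
  moreover have "(\<lambda>N. eval_at \<theta> (?S N)) \<longlonglongrightarrow> eval_at \<theta> \<Omega> ^ sum_list ms * Li_star q \<theta> ms xs"
    unfolding eval_star_sum by (intro tendsto_intros Li_star_tendsto D)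
  ultimately have "eval_at \<theta> F = eval_at \<theta> \<Omega> ^ sum_list ms * Li_star q \<theta> ms xs"
    by (rule LIMSEQ_unique)
  with F show ?thesis
    by blast
qed

end

text \<open>The \<open>j\<close>-th component of the solution is the series of the last
  \<open>j\<close> arguments, so each tail must lie in its own region.\<close>

lemma star_series_solution:
  assumes len: "length zs = length ns"
    and D: "\<And>i. i < length ns \<Longrightarrow> drop i zs \<in> D_star q (drop i ns)"
  shows "\<exists>F. star_solution q (Y_seq q \<theta> lam ns zs) F \<and>
    (\<forall>i<length ns. eval_at \<theta> (F (length ns - i)) =
      eval_at \<theta> \<Omega> ^ sum_list (drop i ns) * Li_star q \<theta> (drop i ns) (drop i zs))"
proof -
  define d where "d = length ns"
  define Ys where "Ys = Y_seq q \<theta> lam ns zs"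
  have len_Ys: "length Ys = d"
    using len by (simp add: Ys_def length_Y_seq d_def)
  have "\<exists>F\<in>tate_radius (real q).
      (\<forall>m. (\<lambda>N. fps_nth (star_sum (drop i Ys) N) m) \<longlonglongrightarrow> fps_nth F m) \<and>
      eval_at \<theta> F = eval_at \<theta> \<Omega> ^ sum_list (drop i ns) * Li_star q \<theta> (drop i ns) (drop i zs)"
    if "i < d" for i
    unfolding Ys_def drop_Y_seq using that len by (intro star_sum_converges D) (simp_all add: d_def)
  then obtain H where H: "\<And>i. i < d \<Longrightarrow> H i \<in> tate_radius (real q)"
    "\<And>i m. i < d \<Longrightarrow> (\<lambda>N. fps_nth (star_sum (drop i Ys) N) m) \<longlonglongrightarrow> fps_nth (H i) m"
    "\<And>i. i < d \<Longrightarrow> eval_at \<theta> (H i) = eval_at \<theta> \<Omega> ^ sum_list (drop i ns) * Li_star q \<theta> (drop i ns) (drop i zs)"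
    by metis
  \<comment> \<open>The value \<open>1\<close> at index \<open>d\<close> belongs to the empty tail
    and matches both \<open>star_sum []\<close> and \<open>F 0 = 1\<close>.\<close>
  define H' where "H' i = (if i < d then H i else 1)" for i
  have lim: "(\<lambda>N. fps_nth (star_sum (drop i Ys) N) m) \<longlonglongrightarrow> fps_nth (H' i) m" for i m
    using H(2) len_Ys by (cases "i < d") (auto simp: H'_def)
  have lim_Suc: "(\<lambda>N. fps_nth (star_sum (drop i Ys) (Suc N)) m) \<longlonglongrightarrow> fps_nth (H' i) m" for i m
    by (rule LIMSEQ_Suc[OF lim])
  have wp: "wp q (H' i) = Ys ! i * H' (Suc i)" if i: "i < d" for i
  proof (rule fps_ext)
    fix m
    have drop: "drop i Ys = Ys ! i # drop (Suc i) Ys"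
      using i len_Ys by (simp add: Cons_nth_drop_Suc)
    \<comment> \<open>Both cutoffs have the same limit, so the left-hand side tends to the
      coefficient of \<open>wp q (H' i)\<close>.\<close>
    have "fps_nth (star_sum (drop i Ys) (Suc N)) m - fps_nth (star_sum (drop i Ys) N) m ^ q =
        fps_nth (Ys ! i * star_sum (drop (Suc i) Ys) (Suc N)) m" for N
      unfolding drop star_sum_Cons by simp
    moreover have "(\<lambda>N. fps_nth (star_sum (drop i Ys) (Suc N)) m - fps_nth (star_sum (drop i Ys) N) m ^ q)
        \<longlonglongrightarrow> fps_nth (H' i) m - fps_nth (H' i) m ^ q"
      by (intro tendsto_diff lim_Suc tendsto_power_strong tendsto_const lim)
    moreover have "(\<lambda>N. fps_nth (Ys ! i * star_sum (drop (Suc i) Ys) (Suc N)) m)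
        \<longlonglongrightarrow> fps_nth (Ys ! i * H' (Suc i)) m"
      unfolding fps_mult_nth by (intro tendsto_sum tendsto_mult tendsto_const lim_Suc)
    ultimately have "fps_nth (H' i) m - fps_nth (H' i) m ^ q = fps_nth (Ys ! i * H' (Suc i)) m"
      by (simp add: LIMSEQ_unique)
    then show "fps_nth (wp q (H' i)) m = fps_nth (Ys ! i * H' (Suc i)) m"
      by (simp add: wp_def)
  qed
  have H'_in: "H' i \<in> tate_algebra" if "i < d" for i
    unfolding tate_algebra_eq using H(1)[OF that] that real_q
    by (auto simp: H'_def intro: tate_radius_mono)
  have "star_solution q Ys (\<lambda>j. H' (d - j))"
    unfolding star_solution_def len_Ys
  proof (intro conjI ballI)
    fix i assume i: "i \<in> {1..d}"
    then have "d - (i - 1) = Suc (d - i)"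
      by auto
    then show "wp q (H' (d - i)) = Ys ! (d - i) * H' (d - (i - 1))"
      using wp[of "d - i"] i by simp
    show "H' (d - i) \<in> tate_algebra"
      using i by (intro H'_in) auto
  qed (simp add: H'_def)
  then show ?thesis
    using H(3) by (intro exI[of _ "\<lambda>j. H' (d - j)"]) (auto simp: H'_def Ys_def d_def)
qed

end

section \<open>Power series expansion of the star polylogarithm in its last variable\<close>

lemma mem_cball_vabs_iff: "x \<in> cball a r \<longleftrightarrow> vabs (x - a :: 'c::nonarch_field) \<le> r"
  by (simp only: mem_cball dist_commute[of a x] dist_eq_dist_diff[of x a])

text \<open>As \<open>r\<close> is an absolute value, convergence at one point with
  \<open>|u| = r\<close> already forces the growth condition on the coefficients.\<close>

lemma rigid_analytic_on_cballI:
  fixes f :: "'c::nonarch_field \<Rightarrow> 'c"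
  assumes r: "r \<in> value_group TYPE('c)"
    and sums: "\<And>u. vabs u \<le> r \<Longrightarrow> (\<lambda>k. c k * u ^ k) sums f (a + u)"
  shows "rigid_analytic_on_cball a r f"
proof -
  obtain u where u: "r = vabs (u :: 'c)"
    using r by (auto simp: value_group_def)
  have "(\<lambda>k. vabs (c k * u ^ k)) \<longlonglongrightarrow> 0"
    using nonarch_sums_imp_tendsto_zero[OF sums[of u]] u
    by (simp add: tendsto_dist_iff[of "\<lambda>k. c k * u ^ k"])
  then have "(\<lambda>k. vabs (c k) * r ^ k) \<longlonglongrightarrow> 0"
    by (simp add: dist_mult_zero vabs_power u)
  moreover have "(\<lambda>k. c k * (x - a) ^ k) sums f x" if "x \<in> cball a r" for x
    using sums[of "x - a"] that by (simp add: mem_cball_vabs_iff del: mem_cball)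
  ultimately show ?thesis
    unfolding rigid_analytic_on_cball_def by blast
qed

context carlitz_setup
begin

lemma Li_term_append:
  assumes "length ys = s" "length ms = Suc s" "length I = Suc s"
  shows "Li_term ms (ys @ [u]) I = Li_term ms (ys @ [1]) I * u ^ (q ^ last I)"
proof -
  have "last I = I ! s"
    using assms by (subst last_conv_nth) auto
  then show ?thesis
    using assms by (simp add: Li_term_def nth_append)
qed

text \<open>All terms with last index \<open>N\<close> contain the last argument as
  \<open>u^(q^N)\<close>. Grouping the series by the last index therefore displays it as a power
  series whose coefficients do not depend on \<open>u\<close>.\<close>

lemma Li_star_power_series:
  assumes len: "length ys = s" "length ms = Suc s"
  shows "\<exists>c. c 0 = 0 \<and> (\<forall>u. ys @ [u] \<in> D_star q ms \<longrightarrow>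
    (\<lambda>k. c k * u ^ k) sums Li_star q \<theta> ms (ys @ [u]))"
proof -
  define W where "W N = {I \<in> incr_upto (Suc s) N. last I = N}" for N
  \<comment> \<open>The coefficient of \<open>u^(q^N)\<close>, read off by putting \<open>1\<close>
    for \<open>u\<close>; the sum is finite, so nothing has to converge at \<open>1\<close>.\<close>
  define b where "b N = (\<Sum>I\<in>W N. Li_term ms (ys @ [1]) I)" for N
  define g where "g N = q ^ N" for N
  define c where "c k = (if k \<in> range g then b (inv_into UNIV g k) else 0)" for k
  have mono: "strict_mono g"
    using q_ge_2 by (auto simp: g_def strict_mono_def)
  then have inj: "inj g"
    by (rule strict_mono_imp_inj_on)
  have "0 \<notin> range g"
    using q_ge_2 by (auto simp: g_def)
  then have "c 0 = 0"
    by (simp add: c_def)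
  moreover have "(\<lambda>k. c k * u ^ k) sums Li_star q \<theta> ms (ys @ [u])" if D: "ys @ [u] \<in> D_star q ms" for u
  proof -
    have b: "b N * u ^ g N = (\<Sum>I\<in>W N. Li_term ms (ys @ [u]) I)" for N
      unfolding b_def sum_distrib_right g_def
    proof (rule sum.cong)
      fix I assume "I \<in> W N"
      then have "length I = Suc s" "last I = N"
        by (auto simp: W_def incr_upto_def)
      then show "Li_term ms (ys @ [1]) I * u ^ q ^ N = Li_term ms (ys @ [u]) I"
        using Li_term_append[OF len, of I u] by simp
    qed simp
    have "(\<Sum>N<Suc n. b N * u ^ g N) = (\<Sum>I\<in>incr_upto (length ms) n. Li_term ms (ys @ [u]) I)" for n
    proof (induction n)
      case 0
      have "I \<in> W 0" if "I \<in> incr_upto (Suc s) 0" for I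
      proof -
        have "I \<noteq> []" "set I \<subseteq> {0}"
          using that by (auto simp: incr_upto_def)
        then have "last I = 0"
          using last_in_set[of I] by blast
        with that show ?thesis
          by (simp add: W_def)
      qed
      then have "W 0 = incr_upto (Suc s) 0"
        by (auto simp: W_def)
      then show ?case
        using len by (simp add: b)
    next
      case (Suc n)
      have union: "incr_upto (Suc s) (Suc n) = incr_upto (Suc s) n \<union> W (Suc n)"
      proof (intro equalityI subsetI)
        fix I assume I: "I \<in> incr_upto (Suc s) (Suc n)"
        then have le: "last I \<le> Suc n"
          using last_in_set[of I] by (fastforce simp: incr_upto_def)
        show "I \<in> incr_upto (Suc s) n \<union> W (Suc n)"
          using I le last_gt_if_not_incr_upto[of I "Suc s" n]
          by (fastforce simp: W_def weakly_increasing_eq_UN)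
      qed (use incr_upto_mono in \<open>auto simp: W_def\<close>)
      have disj: "incr_upto (Suc s) n \<inter> W (Suc n) = {}"
      proof -
        have "last I \<le> n" if "I \<in> incr_upto (Suc s) n" for I
          using that last_in_set[of I] by (fastforce simp: incr_upto_def)
        then show ?thesis
          by (fastforce simp: W_def)
      qed
      have "(\<Sum>I\<in>incr_upto (Suc s) (Suc n). Li_term ms (ys @ [u]) I) =
          (\<Sum>I\<in>incr_upto (Suc s) n. Li_term ms (ys @ [u]) I) + (\<Sum>I\<in>W (Suc n). Li_term ms (ys @ [u]) I)"
        unfolding union
        by (rule sum.union_disjoint[OF _ _ disj]) (simp_all add: finite_incr_upto W_def)
      then show ?case
        using Suc.IH len b[of "Suc n"] by simp
    qed
    then have "(\<lambda>n. \<Sum>N<Suc n. b N * u ^ g N) \<longlonglongrightarrow> Li_star q \<theta> ms (ys @ [u])"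
      using Li_star_tendsto[OF _ D] len by simp
    then have "(\<lambda>N. b N * u ^ g N) sums Li_star q \<theta> ms (ys @ [u])"
      unfolding sums_def by (rule LIMSEQ_imp_Suc)
    then have "(\<lambda>N. c (g N) * u ^ g N) sums Li_star q \<theta> ms (ys @ [u])"
      by (simp add: c_def Hilbert_Choice.inv_f_f[OF inj])
    then show ?thesis
      by (subst (asm) sums_mono_reindex[OF mono]) (auto simp: c_def)
  qed
  ultimately show ?thesis
    by blast
qed

section \<open>Estimates for a small last argument\<close>

context
  fixes ms :: "nat list" and ys :: "'c list" and s :: nat and K :: real and u :: 'c
  assumes len: "length ys = s" "length ms = Suc s"
    and K: "(\<Prod>j<s. max 1 (D_bound ms ys j)) \<le> K"
    and small: "vabs u * real q powr (- (real q * real (ms ! s) / (real q - 1))) * K \<le> 1 / real q"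
begin

text \<open>Once the earlier bounds are replaced by their maxima with \<open>1\<close>, their
  exponents may be raised to the largest one, \<open>q^(last I)\<close>. The product is then a
  single power whose base is at most \<open>1/q\<close>.\<close>

lemma D_product_le:
  assumes I: "I \<in> weakly_increasing (Suc s)"
  shows "(\<Prod>j<length ms. D_bound ms (ys @ [u]) j ^ (q ^ (I ! j))) \<le> (1 / real q) ^ (q ^ last I)"
proof -
  define C where "C = vabs u * real q powr (- (real q * real (ms ! s) / (real q - 1)))"
  have lenI: "length I = Suc s" and "sorted I"
    using I by (auto simp: weakly_increasing_def)
  have last: "last I = I ! s"
    using lenI by (subst last_conv_nth) auto
  have "D_bound ms (ys @ [u]) j ^ (q ^ (I ! j)) \<le> max 1 (D_bound ms ys j) ^ (q ^ last I)" if "j < s" for j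
  proof -
    have "D_bound ms (ys @ [u]) j = D_bound ms ys j"
      using that len by (simp add: D_bound_def nth_append)
    then have "D_bound ms (ys @ [u]) j ^ (q ^ (I ! j)) \<le> max 1 (D_bound ms ys j) ^ (q ^ (I ! j))"
      by (intro power_mono) (auto simp: D_bound_nonneg)
    also have "I ! j \<le> last I"
      using \<open>sorted I\<close> that lenI by (intro sorted_le_last) auto
    then have "max 1 (D_bound ms ys j) ^ (q ^ (I ! j)) \<le> max 1 (D_bound ms ys j) ^ (q ^ last I)"
      using q_ge_2 by (intro power_increasing) auto
    finally show ?thesis .
  qed
  then have "(\<Prod>j<s. D_bound ms (ys @ [u]) j ^ (q ^ (I ! j))) \<le>
      (\<Prod>j<s. max 1 (D_bound ms ys j) ^ (q ^ last I))"
    by (intro prod_mono) (auto simp: D_bound_nonneg)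
  also have "\<dots> = (\<Prod>j<s. max 1 (D_bound ms ys j)) ^ (q ^ last I)"
    by (rule prod_power_distrib[symmetric])
  also have "\<dots> \<le> K ^ (q ^ last I)"
    using K by (intro power_mono prod_nonneg) auto
  finally have "(\<Prod>j<s. D_bound ms (ys @ [u]) j ^ (q ^ (I ! j))) * C ^ (q ^ last I) \<le>
      K ^ (q ^ last I) * C ^ (q ^ last I)"
    by (intro mult_right_mono) (auto simp: C_def)
  moreover have "D_bound ms (ys @ [u]) s = C"
    using len by (simp add: D_bound_def C_def nth_append)
  ultimately have "(\<Prod>j<length ms. D_bound ms (ys @ [u]) j ^ (q ^ (I ! j))) \<le> (C * K) ^ (q ^ last I)"
    using len last by (simp add: power_mult_distrib mult.commute)
  also have "\<dots> \<le> (1 / real q) ^ (q ^ last I)"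
  proof (rule power_mono)
    have "1 \<le> (\<Prod>j<s. max 1 (D_bound ms ys j))"
      by (intro prod_ge_1) auto
    then show "C * K \<ge> 0"
      using K by (simp add: C_def)
    show "C * K \<le> 1 / real q"
      using small by (simp add: C_def)
  qed
  finally show ?thesis .
qed

lemma in_D_star_if_small: "ys @ [u] \<in> D_star q ms"
proof -
  have "\<exists>N. \<forall>I\<in>weakly_increasing (length ms). last I \<ge> N \<longrightarrow>
       (\<Prod>j<length ms. D_bound ms (ys @ [u]) j ^ (q ^ (I ! j))) < e" if e: "e > 0" for e
  proof -
    obtain N where N: "(1 / real q) ^ N < e"
      using real_arch_pow_inv[OF e, of "1 / real q"] real_q by auto
    have "(\<Prod>j<length ms. D_bound ms (ys @ [u]) j ^ (q ^ (I ! j))) < e"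
      if I: "I \<in> weakly_increasing (length ms)" "last I \<ge> N" for I
    proof -
      have "last I \<le> q ^ last I"
        using q_ge_2 by (simp add: less_imp_le power_gt_expt)
      then have "N \<le> q ^ last I"
        using I(2) by (rule order.trans[rotated])
      then have "(1 / real q) ^ (q ^ last I) \<le> (1 / real q) ^ N"
        using real_q by (intro power_decreasing) auto
      with N D_product_le[of I] I(1) len show ?thesis
        by simp
    qed
    then show ?thesis
      by blast
  qed
  then show ?thesis
    using len by (simp add: D_star_def D_bound_def)
qed

text \<open>The gain \<open>1/q\<close> over the power of the period later keeps the values inside a
  polydisk smaller than the separation of the monodromy module.\<close>

lemma vabs_Li_star_le:
  "vabs (Li_star q \<theta> ms (ys @ [u])) \<le> vabs (carlitz_period q \<theta> lam) ^ sum_list ms / real q"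
proof (rule vabs_limit_le)
  show "(\<lambda>N. \<Sum>I\<in>incr_upto (length ms) N. Li_term ms (ys @ [u]) I) \<longlonglongrightarrow> Li_star q \<theta> ms (ys @ [u])"
    using len by (intro Li_star_tendsto in_D_star_if_small) simp
  have "vabs (Li_term ms (ys @ [u]) I) \<le> vabs (carlitz_period q \<theta> lam) ^ sum_list ms / real q"
    if "I \<in> incr_upto (length ms) N" for I N
  proof -
    have "I \<in> weakly_increasing (Suc s)"
      using that len by (auto simp: weakly_increasing_eq_UN)
    then have "(\<Prod>j<length ms. D_bound ms (ys @ [u]) j ^ (q ^ (I ! j))) \<le> (1 / real q) ^ (q ^ last I)"
      by (rule D_product_le)
    also have "\<dots> \<le> (1 / real q) ^ 1"
      using real_q q_ge_2 by (intro power_decreasing) auto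
    finally have "vabs (carlitz_period q \<theta> lam) ^ sum_list ms *
        (\<Prod>j<length ms. D_bound ms (ys @ [u]) j ^ (q ^ (I ! j))) \<le>
        vabs (carlitz_period q \<theta> lam) ^ sum_list ms * (1 / real q) ^ 1"
      by (rule mult_left_mono) simp
    then show ?thesis
      using vabs_Li_term_le[of "ys @ [u]" ms I] len by simp
  qed
  then show "\<forall>\<^sub>F N in sequentially. vabs (\<Sum>I\<in>incr_upto (length ms) N. Li_term ms (ys @ [u]) I) \<le>
      vabs (carlitz_period q \<theta> lam) ^ sum_list ms / real q"
    by (intro always_eventually allI vabs_sum_le) auto
qed

end

end

section \<open>Star solutions and the monodromy module\<close>

context carlitz_setup
begin

section \<open>Existence of solutions and their convergence at \<open>\<theta>\<close>\<close>

lemma star_solution_exists: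
  fixes Ys :: "'c fps list"
  assumes Ys: "\<And>j. j < length Ys \<Longrightarrow> Ys ! j \<in> tate_algebra"
  shows "\<exists>F. star_solution q Ys F"
proof -
  define F where "F = rec_nat 1 (\<lambda>i f. SOME H. H \<in> tate_algebra \<and> wp q H = Ys ! (length Ys - Suc i) * f)"
  have F0: "F 0 = 1"
    by (simp add: F_def)
  have step: "F (Suc i) \<in> tate_algebra \<and> wp q (F (Suc i)) = Ys ! (length Ys - Suc i) * F i"
    if "F i \<in> tate_algebra" "i < length Ys" for i
  proof -
    have "Ys ! (length Ys - Suc i) * F i \<in> tate_algebra"
      using Ys[of "length Ys - Suc i"] that unfolding tate_algebra_eq by (intro tate_radius_mult) auto
    then have "\<exists>H. H \<in> tate_algebra \<and> wp q H = Ys ! (length Ys - Suc i) * F i"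
      using wp_surj by blast
    from someI_ex[OF this] show ?thesis
      by (simp add: F_def)
  qed
  have in_T: "F i \<in> tate_algebra" if "i \<le> length Ys" for i
    using that by (induction i) (use step in \<open>auto simp: F0 tate_algebra_eq\<close>)
  have "F i \<in> tate_algebra \<and> wp q (F i) = Ys ! (length Ys - i) * F (i - 1)" if "i \<in> {1..length Ys}" for i
    using step[of "i - 1"] in_T[of "i - 1"] that by auto
  then show ?thesis
    using F0 unfolding star_solution_def by blast
qed

lemma star_solution_in_tate_radius:
  fixes Ys :: "'c fps list"
  assumes F: "star_solution q Ys F" and Ys: "\<And>j. j < length Ys \<Longrightarrow> Ys ! j \<in> tate_radius (real q)"
    and i: "i \<le> length Ys"
  shows "F i \<in> tate_radius (real q)"
  using i
proof (induction i)
  case 0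
  then show ?case
    using F by (simp add: star_solution_def)
next
  case (Suc i)
  have "F (Suc i) \<in> tate_algebra" "wp q (F (Suc i)) = Ys ! (length Ys - Suc i) * F i"
    using F Suc.prems by (auto simp: star_solution_def)
  moreover have "Ys ! (length Ys - Suc i) * F i \<in> tate_radius (real q)"
    using Suc Ys[of "length Ys - Suc i"] real_q by (intro tate_radius_mult) auto
  ultimately show ?case
    by (simp add: tate_radius_if_wp)
qed

section \<open>The discrete ring of polynomials in \<open>\<theta>\<close>\<close>

lemma ring_A_eq: "ring_A \<iota> = range (\<lambda>p. poly (map_poly emb p) \<theta>)"
  by (simp add: ring_A_def emb_def[abs_def] theta_eq)

lemma ring_A_zero: "0 \<in> ring_A \<iota>"
  unfolding ring_A_eq by (rule range_eqI[of _ _ 0]) simp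

lemma ring_A_add: "x \<in> ring_A \<iota> \<Longrightarrow> y \<in> ring_A \<iota> \<Longrightarrow> x + y \<in> ring_A \<iota>"
proof -
  have "map_poly emb (p + r) = map_poly emb p + map_poly emb r" for p r
    by (rule poly_eqI) (simp add: coeff_map_poly emb_add)
  then have "poly (map_poly emb p) \<theta> + poly (map_poly emb r) \<theta> = poly (map_poly emb (p + r)) \<theta>" for p r
    by simp
  then show "x \<in> ring_A \<iota> \<Longrightarrow> y \<in> ring_A \<iota> \<Longrightarrow> x + y \<in> ring_A \<iota>"
    unfolding ring_A_eq by auto
qed

lemma ring_A_minus: "x \<in> ring_A \<iota> \<Longrightarrow> - x \<in> ring_A \<iota>"
proof -
  have "map_poly emb (- p) = - map_poly emb p" for p
    by (rule poly_eqI) (simp add: coeff_map_poly emb_minus)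
  then have "- poly (map_poly emb p) \<theta> = poly (map_poly emb (- p)) \<theta>" for p
    by simp
  then show "x \<in> ring_A \<iota> \<Longrightarrow> - x \<in> ring_A \<iota>"
    unfolding ring_A_eq by auto
qed

text \<open>For a nonconstant polynomial the part divisible by \<open>\<theta>\<close> has absolute
  value at least \<open>q\<close> by induction, and thus dominates the constant term.\<close>

lemma ring_A_discrete:
  assumes "x \<in> ring_A \<iota>" "x \<noteq> 0"
  shows "vabs x \<ge> 1"
proof -
  have "vabs (poly (map_poly emb p) \<theta>) \<ge> 1" if "p \<noteq> 0" for p
    using that
  proof (induction p)
    case (pCons c p)
    have eq: "poly (map_poly emb (pCons c p)) \<theta> = emb c + \<theta> * poly (map_poly emb p) \<theta>"
      using pCons.hyps by (subst map_poly_pCons) auto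
    show ?case
    proof (cases "p = 0")
      case True
      then show ?thesis
        using pCons.hyps eq by (simp add: vabs_emb)
    next
      case False
      then have ge: "vabs (\<theta> * poly (map_poly emb p) \<theta>) \<ge> real q * 1"
        unfolding dist_mult_zero vabs_theta using pCons.IH by (intro mult_left_mono) auto
      have "vabs (emb c) \<le> 1"
        using vabs_emb[of c] by (cases "c = 0") auto
      then have "vabs (emb c + \<theta> * poly (map_poly emb p) \<theta>) = vabs (\<theta> * poly (map_poly emb p) \<theta>)"
        using ge real_q(4) by (intro vabs_add_eq_max) linarith
      then show ?thesis
        unfolding eq using ge real_q by linarith
    qed
  qed simp
  moreover obtain p where "x = poly (map_poly emb p) \<theta>"
    using assms(1) unfolding ring_A_eq by blast
  ultimately show ?thesis
    using assms(2) by (cases "p = 0") auto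
qed

section \<open>Coordinates of the monodromy module and of the values of solutions\<close>

context
  fixes ns :: "nat list" and zs :: "'c list" and G :: "nat \<Rightarrow> nat \<Rightarrow> 'c fps"
  assumes ns_nonempty: "ns \<noteq> []" and len_zs: "length zs = length ns - 1"
    and G: "\<And>k. k < length ns \<Longrightarrow> star_solution q (take k (Y_seq q \<theta> lam ns zs)) (G k)"
begin

definition period_power :: 'c
  where "period_power = carlitz_period q \<theta> lam ^ sum_list ns"

text \<open>The entries of the generators without their common factor \<open>\<Omega>^(-w)\<close>;
  they form a triangular matrix.\<close>

definition gen_entry :: "nat \<Rightarrow> nat \<Rightarrow> 'c fps"
  where "gen_entry k i = (if i \<le> k then G k (k - i) else 0)"

definition sol_value :: "(nat \<Rightarrow> 'c fps) \<Rightarrow> 'c vec"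
  where "sol_value F = vec (length ns) (\<lambda>i. period_power * eval_at \<theta> (F (length ns - i)))"

abbreviation Mon :: "'c vec set"
  where "Mon \<equiv> monodromy_module \<iota> lam ns G"

abbreviation Y :: "'c \<Rightarrow> 'c fps list"
  where "Y z \<equiv> Y_seq q \<theta> lam ns (zs @ [z])"

lemma len_Y: "length (Y z) = length ns"
  using len_zs ns_nonempty by (simp add: length_Y_seq)

lemma Y_in_T: "j < length ns \<Longrightarrow> Y z ! j \<in> tate_radius (real q)"
  using len_zs Y_in_tate_radius by (simp add: Y_seq_nth)

lemma Y_nth: "j < length ns - 1 \<Longrightarrow> Y z ! j = Y_seq q \<theta> lam ns zs ! j"
  using len_zs by (simp add: Y_seq_nth nth_append)

lemma gen_entry_in_T: "k < length ns \<Longrightarrow> gen_entry k i \<in> tate_radius (real q)"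
proof -
  assume k: "k < length ns"
  have len: "length (take k (Y_seq q \<theta> lam ns zs)) = k"
    using k len_zs by (simp add: length_Y_seq)
  have "take k (Y_seq q \<theta> lam ns zs) ! j \<in> tate_radius (real q)" if "j < k" for j
    using that k len_zs Y_in_tate_radius by (simp add: Y_seq_nth)
  then have "G k l \<in> tate_radius (real q)" if "l \<le> k" for l
    using star_solution_in_tate_radius[OF G[OF k]] len that by simp
  then show ?thesis
    using tate_radius_const[of "0 :: 'c" "real q"] by (simp add: gen_entry_def)
qed

lemma gen_entry_diag: "k < length ns \<Longrightarrow> gen_entry k k = 1"
  using G[of k] by (simp add: gen_entry_def star_solution_def)

text \<open>The reversals in the system and in the generator cancel: above its diagonal position
  \<open>k\<close> each generator obeys the equations of the full system, with a factor that depends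
  on \<open>i\<close> but not on \<open>k\<close>. This makes generators usable to correct
  differences of solutions.\<close>

lemma wp_gen_entry:
  assumes "k < length ns" "i < k"
  shows "wp q (gen_entry k i) = Y z ! i * gen_entry k (Suc i)"
proof -
  have "length (take k (Y_seq q \<theta> lam ns zs)) = k"
    using assms len_zs by (simp add: length_Y_seq)
  then have "wp q (G k (k - i)) = take k (Y_seq q \<theta> lam ns zs) ! (k - (k - i)) * G k (k - i - 1)"
    using G[OF assms(1)] assms(2) unfolding star_solution_def by auto
  then show ?thesis
    using assms Y_nth[of i z] by (simp add: gen_entry_def)
qed

lemma eval_inverse_Omega_mult:
  assumes "f \<in> tate_radius (real q)"
  shows "eval_at \<theta> (inverse \<Omega> ^ sum_list ns * f) = period_power * eval_at \<theta> f"
  using assms inverse_Omega_in_tate_radius real_q vabs_theta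
  by (simp add: period_power_def eval_at_mult[where \<rho> = "real q"] eval_at_power[where \<rho> = "real q"]
      tate_radius_power eval_inverse_Omega)

lemma Mon_iff:
  "v \<in> Mon \<longleftrightarrow> v \<in> carrier_vec (length ns) \<and>
    (\<exists>a. (\<forall>k<length ns. a k \<in> ring_A \<iota>) \<and>
      (\<forall>i<length ns. v $ i = (\<Sum>k<length ns. a k * (period_power * eval_at \<theta> (gen_entry k i)))))"
proof -
  define d where "d = length ns"
  define S where "S a = finsum_vec TYPE('c) d
      (\<lambda>k. a k \<cdot>\<^sub>v map_vec (eval_at \<theta>) (star_generator q \<theta> lam ns k (G k))) {..<d}" for a
  have M: "Mon = {S a | a. \<forall>k<d. a k \<in> ring_A \<iota>}"
    by (simp add: monodromy_module_def Let_def S_def d_def flip: q_eq theta_eq)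
  have S_carrier: "S a \<in> carrier_vec d" for a
    unfolding S_def by (rule finsum_vec_closed) (auto simp: star_generator_def d_def)
  have S_nth: "S a $ i = (\<Sum>k<d. a k * (period_power * eval_at \<theta> (gen_entry k i)))" if "i < d" for a i
  proof -
    have "S a $ i = (\<Sum>k<d. (a k \<cdot>\<^sub>v map_vec (eval_at \<theta>) (star_generator q \<theta> lam ns k (G k))) $ i)"
      unfolding S_def using that by (intro index_finsum_vec) (auto simp: star_generator_def d_def)
    also have "\<dots> = (\<Sum>k<d. a k * (period_power * eval_at \<theta> (gen_entry k i)))"
    proof (rule sum.cong)
      fix k assume k: "k \<in> {..<d}"
      then show "(a k \<cdot>\<^sub>v map_vec (eval_at \<theta>) (star_generator q \<theta> lam ns k (G k))) $ i =
          a k * (period_power * eval_at \<theta> (gen_entry k i))"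
        using that eval_inverse_Omega_mult[OF gen_entry_in_T, of k i]
        by (simp add: star_generator_def d_def gen_entry_def)
    qed simp
    finally show ?thesis .
  qed
  show ?thesis
  proof
    assume "v \<in> Mon"
    then show "v \<in> carrier_vec (length ns) \<and>
        (\<exists>a. (\<forall>k<length ns. a k \<in> ring_A \<iota>) \<and>
        (\<forall>i<length ns. v $ i = (\<Sum>k<length ns. a k * (period_power * eval_at \<theta> (gen_entry k i)))))"
      using M S_carrier S_nth unfolding d_def by auto
  next
    assume *: "v \<in> carrier_vec (length ns) \<and>
        (\<exists>a. (\<forall>k<length ns. a k \<in> ring_A \<iota>) \<and>
        (\<forall>i<length ns. v $ i = (\<Sum>k<length ns. a k * (period_power * eval_at \<theta> (gen_entry k i)))))"
    then obtain a where a: "\<forall>k<d. a k \<in> ring_A \<iota>"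
      "\<forall>i<d. v $ i = (\<Sum>k<d. a k * (period_power * eval_at \<theta> (gen_entry k i)))"
      unfolding d_def by blast
    then have "v = S a"
      using * S_carrier[of a] S_nth by (intro eq_vecI) (auto simp: d_def)
    then show "v \<in> Mon"
      using M a(1) by blast
  qed
qed

lemma Mon_add: "u \<in> Mon \<Longrightarrow> v \<in> Mon \<Longrightarrow> u + v \<in> Mon"
proof -
  assume "u \<in> Mon" "v \<in> Mon"
  then obtain a b where uv: "u \<in> carrier_vec (length ns)" "v \<in> carrier_vec (length ns)"
    and a: "\<forall>k<length ns. a k \<in> ring_A \<iota>"
      "\<forall>i<length ns. u $ i = (\<Sum>k<length ns. a k * (period_power * eval_at \<theta> (gen_entry k i)))"
    and b: "\<forall>k<length ns. b k \<in> ring_A \<iota>"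
      "\<forall>i<length ns. v $ i = (\<Sum>k<length ns. b k * (period_power * eval_at \<theta> (gen_entry k i)))"
    unfolding Mon_iff by blast
  have "\<forall>i<length ns. (u + v) $ i = (\<Sum>k<length ns. (a k + b k) * (period_power * eval_at \<theta> (gen_entry k i)))"
    using uv a(2) b(2) by (auto simp: sum.distrib distrib_right)
  then show "u + v \<in> Mon"
    unfolding Mon_iff using uv a(1) b(1) by (auto intro!: exI[of _ "\<lambda>k. a k + b k"] ring_A_add)
qed

lemma Mon_uminus: "u \<in> Mon \<Longrightarrow> - u \<in> Mon"
proof -
  assume "u \<in> Mon"
  then obtain a where u: "u \<in> carrier_vec (length ns)"
    and a: "\<forall>k<length ns. a k \<in> ring_A \<iota>"
      "\<forall>i<length ns. u $ i = (\<Sum>k<length ns. a k * (period_power * eval_at \<theta> (gen_entry k i)))"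
    unfolding Mon_iff by blast
  have "\<forall>i<length ns. (- u) $ i = (\<Sum>k<length ns. - a k * (period_power * eval_at \<theta> (gen_entry k i)))"
    using u a(2) by (auto simp: sum_negf)
  then show "- u \<in> Mon"
    unfolding Mon_iff using u a(1) by (auto intro!: exI[of _ "\<lambda>k. - a k"] ring_A_minus)
qed

lemma Mon_zero: "0\<^sub>v (length ns) \<in> Mon"
  unfolding Mon_iff by (auto intro!: exI[of _ "\<lambda>_. 0"] ring_A_zero)

lemma Mon_carrier: "v \<in> Mon \<Longrightarrow> v \<in> carrier_vec (length ns)"
  by (simp add: Mon_iff)

lemma residue_class_subset:
  assumes u: "u \<in> carrier_vec (length ns)" and v: "v \<in> carrier_vec (length ns)" and uv: "u - v \<in> Mon"
  shows "residue_class Mon u \<subseteq> residue_class Mon v"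
proof
  fix x assume "x \<in> residue_class Mon u"
  then obtain m where m: "x = u + m" "m \<in> Mon"
    unfolding residue_class_def by blast
  have "u + m = v + ((u - v) + m)"
    using u v Mon_carrier[OF m(2)] by (intro eq_vecI) auto
  then show "x \<in> residue_class Mon v"
    unfolding residue_class_def using m Mon_add[OF uv m(2)] by blast
qed

lemma residue_class_eq:
  assumes u: "u \<in> carrier_vec (length ns)" and v: "v \<in> carrier_vec (length ns)" and uv: "u - v \<in> Mon"
  shows "residue_class Mon u = residue_class Mon v"
proof -
  have "- (u - v) = v - u"
    using u v by (intro eq_vecI) auto
  then show ?thesis
    using residue_class_subset[OF u v uv] residue_class_subset[OF v u] Mon_uminus[OF uv] by auto
qed

text \<open>The matrix of generators is triangular with \<open>\<pi>\<^bsup>w\<^esup>\<close> on the diagonal, and \<open>A\<close> is discrete.\<close>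

lemma Mon_discrete:
  fixes m :: "'c vec"
  assumes m: "m \<in> Mon" and small: "\<And>i. i < length ns \<Longrightarrow> vabs (m $ i) < vabs period_power"
  shows "m = 0\<^sub>v (length ns)"
proof -
  obtain a where mc: "m \<in> carrier_vec (length ns)" and a: "\<forall>k<length ns. a k \<in> ring_A \<iota>"
      "\<forall>i<length ns. m $ i = (\<Sum>k<length ns. a k * (period_power * eval_at \<theta> (gen_entry k i)))"
    using m unfolding Mon_iff by blast
  have "\<forall>k<length ns. a k = 0"
  proof (rule ccontr)
    assume "\<not> ?thesis"
    then have ne: "{k. k < length ns \<and> a k \<noteq> 0} \<noteq> {}"
      by auto
    \<comment> \<open>In coordinate \<open>k\<close> the earlier generators vanish and the later
      ones have coefficient \<open>0\<close>, which leaves \<open>a k\<close> times the diagonal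
      entry.\<close>
    define k where "k = Max {k. k < length ns \<and> a k \<noteq> 0}"
    have "k \<in> {k. k < length ns \<and> a k \<noteq> 0}"
      unfolding k_def using ne by (intro Max_in) auto
    then have k: "k < length ns" "a k \<noteq> 0"
      by auto
    have above: "a j = 0" if "j < length ns" "j > k" for j
      using that Max_ge[of "{k. k < length ns \<and> a k \<noteq> 0}" j] by (fastforce simp: k_def)
    have "a j * (period_power * eval_at \<theta> (gen_entry j k)) = (if j = k then a k * period_power else 0)"
      if "j < length ns" for j
      using above[OF that] gen_entry_diag[OF k(1)] by (cases j k rule: linorder_cases) (auto simp: gen_entry_def)
    then have "(\<Sum>j<length ns. a j * (period_power * eval_at \<theta> (gen_entry j k))) =
        (\<Sum>j<length ns. if j = k then a k * period_power else 0)"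
      by (intro sum.cong) auto
    then have "m $ k = a k * period_power"
      using a(2) k by simp
    moreover have "vabs (a k) \<ge> 1"
      using a(1) k by (intro ring_A_discrete) auto
    ultimately have "vabs (m $ k) \<ge> vabs period_power"
      using mult_right_mono[of 1 "vabs (a k)" "vabs period_power"] by (simp add: dist_mult_zero)
    with small[OF k(1)] show False
      by simp
  qed
  then show ?thesis
    using a(2) mc by (intro eq_vecI) auto
qed

text \<open>The last entry \<open>P k\<close> that may be nonzero is killed by \<wp>, because the
  entry after it is \<open>0\<close>. Subtracting \<open>P k\<close> times the \<open>k\<close>-th
  generator, whose entry there is \<open>1\<close>, removes it and preserves the equations, as \<wp>
  is linear over its kernel. The induction peels off one entry at a time.\<close>

lemma kernel_combination:
  fixes P :: "nat \<Rightarrow> 'c fps"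
  assumes "k \<le> length ns" and "\<And>i. P i \<in> tate_algebra" and "\<And>i. i \<ge> k \<Longrightarrow> P i = 0"
    and "\<And>i. i < length ns \<Longrightarrow> wp q (P i) = Y z ! i * P (Suc i)"
  shows "\<exists>a. (\<forall>j. a j \<in> tate_algebra \<and> wp q (a j) = 0) \<and>
    (\<forall>i. P i = (\<Sum>j<length ns. a j * gen_entry j i))"
  using assms
proof (induction k arbitrary: P)
  case 0
  then show ?case
    using tate_radius_const[of "0 :: 'c" 1] wp_diff[of 0 0]
    by (intro exI[of _ "\<lambda>_. 0"]) (simp add: tate_algebra_eq)
next
  case (Suc k)
  have k: "k < length ns"
    using Suc.prems(1) by simp
  have wp_Pk: "wp q (P k) = 0"
    using Suc.prems(4)[OF k] Suc.prems(3)[of "Suc k"] by simp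
  define P' where "P' i = P i - P k * gen_entry k i" for i
  have gen_T: "gen_entry k i \<in> tate_algebra" for i
    unfolding tate_algebra_eq using gen_entry_in_T[OF k] real_q by (intro tate_radius_mono[of _ "real q" 1]) auto
  have zero: "P' i = 0" if "i \<ge> k" for i
    using that Suc.prems(3)[of i] gen_entry_diag[OF k]
    by (cases "i = k") (auto simp: P'_def gen_entry_def)
  have "\<exists>a. (\<forall>j. a j \<in> tate_algebra \<and> wp q (a j) = 0) \<and>
    (\<forall>i. P' i = (\<Sum>j<length ns. a j * gen_entry j i))"
  proof (rule Suc.IH)
    show "P' i \<in> tate_algebra" for i
      using Suc.prems(2) gen_T unfolding P'_def tate_algebra_eq
      by (intro tate_radius_diff tate_radius_mult) auto
    show "wp q (P' i) = Y z ! i * P' (Suc i)" if "i < length ns" for i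
    proof (cases "i < k")
      case True
      then show ?thesis
        using Suc.prems(4)[OF that] wp_gen_entry[OF k True, of z]
        by (simp add: P'_def wp_diff wp_mult_kernel[OF wp_Pk] algebra_simps)
    next
      case False
      then show ?thesis
        using zero[of i] zero[of "Suc i"] wp_diff[of 0 0] by simp
    qed
  qed (use k zero in auto)
  then obtain a where a: "\<And>j. a j \<in> tate_algebra" "\<And>j. wp q (a j) = 0"
    "\<And>i. P' i = (\<Sum>j<length ns. a j * gen_entry j i)"
    by blast
  define b where "b j = (if j = k then a j + P k else a j)" for j
  have "P i = (\<Sum>j<length ns. b j * gen_entry j i)" for i
  proof -
    have "(\<Sum>j<length ns. b j * gen_entry j i) =
        (\<Sum>j<length ns. a j * gen_entry j i + (if j = k then P k * gen_entry k i else 0))"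
      by (intro sum.cong) (auto simp: b_def distrib_right)
    also have "\<dots> = P' i + P k * gen_entry k i"
      using k by (simp add: sum.distrib a(3))
    finally show ?thesis
      by (simp add: P'_def)
  qed
  moreover have "b j \<in> tate_algebra" "wp q (b j) = 0" for j
    using a Suc.prems(2) wp_Pk tate_radius_add[of "a j" 1 "P k"]
    by (auto simp: b_def wp_add tate_algebra_eq)
  ultimately show ?case
    by blast
qed

text \<open>Both solutions start with \<open>1\<close>, so their difference satisfies the same
  linear equations with starting value \<open>0\<close> and is a combination of the generators over
  the kernel of \<wp>; evaluation sends the coefficients into the ring A.\<close>

lemma sol_value_diff_in_Mon:
  assumes F: "star_solution q (Y z) F" and F': "star_solution q (Y z) F'"
  shows "sol_value F - sol_value F' \<in> Mon"
proof -
  define d where "d = length ns"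
  define P where "P i = F (d - i) - F' (d - i)" for i
  \<comment> \<open>A solution is constrained only at indices up to \<open>d\<close>; beyond them it
    is arbitrary.\<close>
  have sol: "F 0 = 1" "F' 0 = 1" and T: "\<And>i. F i \<in> tate_algebra \<or> i > d" "\<And>i. F' i \<in> tate_algebra \<or> i > d"
    using F F' tate_radius_one[of 1] len_Y[of z]
    by (auto simp: star_solution_def d_def tate_algebra_eq not_less Suc_le_eq)
  have "P i \<in> tate_algebra" for i
    using T(1)[of "d - i"] T(2)[of "d - i"] unfolding P_def tate_algebra_eq
    by (intro tate_radius_diff) auto
  moreover have "P i = 0" if "i \<ge> d" for i
    using that sol by (simp add: P_def)
  moreover have "wp q (P i) = Y z ! i * P (Suc i)" if i: "i < d" for i
  proof -
    have "d - i \<in> {1..length (Y z)}" "length (Y z) - (d - i) = i" "d - i - 1 = d - Suc i"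
      using i len_Y[of z] by (auto simp: d_def)
    then have "wp q (F (d - i)) = Y z ! i * F (d - Suc i)" "wp q (F' (d - i)) = Y z ! i * F' (d - Suc i)"
      using F F' unfolding star_solution_def by metis+
    then show ?thesis
      by (simp add: P_def wp_diff right_diff_distrib)
  qed
  ultimately obtain a where a: "\<And>j. a j \<in> tate_algebra" "\<And>j. wp q (a j) = 0"
    "\<And>i. P i = (\<Sum>j<length ns. a j * gen_entry j i)"
    using kernel_combination[of d P z] unfolding d_def by blast
  \<comment> \<open>Since \<open>wp q (a j) = 0\<close> converges at every radius,
    \<open>a j\<close> converges at radius \<open>q\<close>.\<close>
  have aT: "a j \<in> tate_radius (real q)" for j
    by (rule tate_radius_if_wp[OF a(1)]) (use tate_radius_const[of "0 :: 'c" "real q"] in \<open>simp add: a(2)\<close>)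
  have FT: "F i \<in> tate_radius (real q)" "F' i \<in> tate_radius (real q)" if "i \<le> d" for i
    using that len_Y[of z] Y_in_T star_solution_in_tate_radius[OF F] star_solution_in_tate_radius[OF F']
    by (auto simp: d_def)
  have "(sol_value F - sol_value F') $ i =
      (\<Sum>k<length ns. eval_at \<theta> (a k) * (period_power * eval_at \<theta> (gen_entry k i)))" if i: "i < length ns" for i
  proof -
    have "(sol_value F - sol_value F') $ i = period_power * eval_at \<theta> (P i)"
      using i FT[of "d - i"] vabs_theta
      by (simp add: sol_value_def P_def d_def right_diff_distrib eval_at_diff[where \<rho> = "real q"])
    also have "eval_at \<theta> (P i) = (\<Sum>k<length ns. eval_at \<theta> (a k * gen_entry k i))"
      unfolding a(3) using aT gen_entry_in_T real_q vabs_theta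
      by (intro eval_at_sum[where \<rho> = "real q"] tate_radius_mult) auto
    also have "\<dots> = (\<Sum>k<length ns. eval_at \<theta> (a k) * eval_at \<theta> (gen_entry k i))"
      using aT gen_entry_in_T real_q vabs_theta by (intro sum.cong eval_at_mult[where \<rho> = "real q"]) auto
    finally show ?thesis
      by (simp add: sum_distrib_left mult_ac)
  qed
  moreover have "eval_at \<theta> (a k) \<in> ring_A \<iota>" for k
    using a by (intro eval_wp_kernel)
  ultimately show ?thesis
    unfolding Mon_iff
    by (intro conjI exI[of _ "\<lambda>k. eval_at \<theta> (a k)"]) (auto simp: sol_value_def)
qed

lemma vec_Li_star_eq:
  assumes F: "star_solution q (Y z) F"
  shows "vec_Li_star q \<theta> lam ns Mon (zs @ [z]) = residue_class Mon (sol_value F)"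
proof -
  have val: "map_vec (eval_at \<theta>) (vec (length ns) (\<lambda>i. inverse \<Omega> ^ sum_list ns * F' (length ns - i))) = sol_value F'"
    if "star_solution q (Y z) F'" for F'
  proof -
    have "F' i \<in> tate_radius (real q)" if "i \<le> length ns" for i
      using that len_Y[of z] Y_in_T star_solution_in_tate_radius[OF \<open>star_solution q (Y z) F'\<close>] by auto
    then show ?thesis
      by (intro eq_vecI) (simp_all add: sol_value_def eval_inverse_Omega_mult)
  qed
  have "residue_class Mon (sol_value F') = residue_class Mon (sol_value F)"
    if "star_solution q (Y z) F'" for F'
    using sol_value_diff_in_Mon[OF that F] by (intro residue_class_eq) (auto simp: sol_value_def)
  then have "residue_class Mon (map_vec (eval_at \<theta>) f) = residue_class Mon (sol_value F)"
    if "f \<in> frak_Li_star q \<theta> lam ns (zs @ [z])" for f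
    using that val unfolding frak_Li_star_def by auto
  moreover have "frak_Li_star q \<theta> lam ns (zs @ [z]) \<noteq> {}"
    using F unfolding frak_Li_star_def by blast
  ultimately show ?thesis
    unfolding vec_Li_star_def by auto
qed

lemma series_solution:
  assumes D: "\<And>i. i < length ns \<Longrightarrow> drop i (zs @ [z]) \<in> D_star q (drop i ns)"
  shows "\<exists>F. star_solution q (Y z) F \<and>
    sol_value F = vec (length ns) (\<lambda>i. carlitz_period q \<theta> lam ^ sum_list (take i ns) *
      Li_star q \<theta> (drop i ns) (drop i (zs @ [z])))"
proof -
  obtain F where F: "star_solution q (Y z) F"
    and ev: "\<And>i. i < length ns \<Longrightarrow> eval_at \<theta> (F (length ns - i)) =
      eval_at \<theta> \<Omega> ^ sum_list (drop i ns) * Li_star q \<theta> (drop i ns) (drop i (zs @ [z]))"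
    using star_series_solution[of "zs @ [z]" ns] D len_zs ns_nonempty by auto
  \<comment> \<open>Of the \<open>w\<close> factors of the period, those belonging to the tail
    cancel against the powers of \<open>\<Omega>(\<theta>)\<close>; what remains is the prefactor of
    the \<open>i\<close>-th entry.\<close>
  have "period_power * eval_at \<theta> \<Omega> ^ sum_list (drop i ns) = carlitz_period q \<theta> lam ^ sum_list (take i ns)" for i
  proof -
    have "sum_list ns = sum_list (take i ns) + sum_list (drop i ns)"
      by (simp flip: sum_list_append)
    then have "period_power * eval_at \<theta> \<Omega> ^ sum_list (drop i ns) =
        carlitz_period q \<theta> lam ^ sum_list (take i ns) *
          (eval_at \<theta> \<Omega> * carlitz_period q \<theta> lam) ^ sum_list (drop i ns)"
      by (simp add: period_power_def power_add power_mult_distrib mult_ac)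
    then show ?thesis
      by (simp add: eval_Omega_mult_period)
  qed
  then have "sol_value F = vec (length ns) (\<lambda>i. carlitz_period q \<theta> lam ^ sum_list (take i ns) *
      Li_star q \<theta> (drop i ns) (drop i (zs @ [z])))"
    by (intro eq_vecI) (simp_all add: sol_value_def ev flip: mult.assoc)
  with F show ?thesis
    by blast
qed

text \<open>Only the last entry of the system depends on the last argument, and it occurs only in
  the first equation, where it multiplies \<open>F 0 = 1\<close>; the remaining equations are linear
  with the same factors. Entry \<open>0\<close> is reset to \<open>1\<close>, since adding would
  give \<open>2\<close>.\<close>

lemma sum_solution:
  assumes F: "star_solution q (Y z) F" and E: "star_solution q (Y u) E"
  shows "star_solution q (Y (z + u)) (\<lambda>j. if j = 0 then 1 else F j + E j)"
  unfolding star_solution_def len_Y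
proof (intro conjI ballI)
  fix j assume j: "j \<in> {1..length ns}"
  have T: "F j \<in> tate_algebra" "E j \<in> tate_algebra"
    and wp: "wp q (F j) = Y z ! (length ns - j) * F (j - 1)" "wp q (E j) = Y u ! (length ns - j) * E (j - 1)"
    using F E j by (auto simp: star_solution_def len_Y)
  show "(if j = 0 then 1 else F j + E j) \<in> tate_algebra"
    using j T tate_radius_add[of "F j" 1 "E j"] by (auto simp: tate_algebra_eq)
  show "wp q (if j = 0 then 1 else F j + E j) =
      Y (z + u) ! (length ns - j) * (if j - 1 = 0 then 1 else F (j - 1) + E (j - 1))"
  proof (cases "j = 1")
    case True
    have "F 0 = 1" "E 0 = 1"
      using F E by (auto simp: star_solution_def)
    then show ?thesis
      using True wp len_zs ns_nonempty
      by (simp add: wp_add Y_seq_nth nth_append distrib_left flip: fps_const_add)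
  next
    case False
    then have "length ns - j < length ns - 1"
      using j by auto
    then show ?thesis
      using False j wp Y_nth by (simp add: wp_add distrib_left)
  qed
qed simp

text \<open>By the ultrametric inequality two points of the polydisk differ in each coordinate by at
  most its radius, which is too little for a nonzero element of the module.\<close>

lemma polydisk_injects:
  fixes c :: "'c vec" and R :: "real vec"
  assumes c: "dim_vec c = length ns" and R: "\<And>i. i < length ns \<Longrightarrow> R $ i < vabs (period_power)"
  shows "inj_on (residue_class Mon) (polydisk c R)"
proof (rule inj_onI)
    fix u v assume u: "u \<in> polydisk c R" and v: "v \<in> polydisk c R"
    and eq: "residue_class Mon u = residue_class Mon v"
  have uc: "u \<in> carrier_vec (length ns)" and vc: "v \<in> carrier_vec (length ns)"
    using u v c by (auto simp: polydisk_def)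
  have "u \<in> residue_class Mon u"
    unfolding residue_class_def using Mon_zero uc
    by (auto intro!: exI[of _ "0\<^sub>v (length ns)"])
  then obtain m where m: "u = v + m" "m \<in> Mon"
    unfolding eq unfolding residue_class_def by blast
  have mc: "m \<in> carrier_vec (length ns)"
    using Mon_carrier[OF m(2)] .
  have "vabs (m $ i) < vabs (period_power)" if i: "i < length ns" for i
  proof -
    have "u $ i = v $ i + m $ i"
      using i mc vc by (simp add: m(1))
    then have "vabs (m $ i) = dist (u $ i) (v $ i)"
      using dist_eq_dist_diff[of "u $ i" "v $ i"] by simp
    also have "\<dots> \<le> max (dist (u $ i) (c $ i)) (dist (c $ i) (v $ i))"
      by (rule dist_ultrametric)
    also have "\<dots> \<le> R $ i"
      using u v c i by (auto simp: polydisk_def dist_commute)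
    finally show ?thesis
      using R[OF i] by simp
  qed
  then have "m = 0\<^sub>v (length ns)"
    using Mon_discrete[OF m(2)] by blast
  then show "u = v"
    using m(1) vc by simp
qed

section \<open>Congruence with the star polylogarithms and local analyticity\<close>

lemma vec_Li_star_congruent:
  assumes D: "\<And>i. i < length ns \<Longrightarrow> drop i (zs @ [z]) \<in> D_star q (drop i ns)"
  shows "vec_Li_star q \<theta> lam ns Mon (zs @ [z]) =
    residue_class Mon
      (vec (length ns) (\<lambda>i. carlitz_period q \<theta> lam ^ sum_list (take i ns) *
        Li_star q \<theta> (drop i ns) (drop i (zs @ [z]))))"
  using series_solution[OF D] vec_Li_star_eq by metis

lemma vec_Li_star_locally_analytic:
  "\<exists>a r c R \<phi>.
    r \<in> value_group TYPE('c) \<and> z \<in> cball a r \<and>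
    dim_vec c = length ns \<and> dim_vec R = length ns \<and> (\<forall>i<length ns. R $ i \<in> value_group TYPE('c)) \<and>
    inj_on (residue_class Mon) (polydisk c R) \<and>
    (\<forall>x\<in>cball a r. \<phi> x \<in> polydisk c R \<and> residue_class Mon (\<phi> x) =
      vec_Li_star q \<theta> lam ns Mon (zs @ [x])) \<and>
    (\<forall>i<length ns. rigid_analytic_on_cball a r (\<lambda>x. \<phi> x $ i))"
proof -
  define d where "d = length ns"
  define \<pi> where "\<pi> = carlitz_period q \<theta> lam"
  have d: "d > 0" "length zs = d - 1"
    using ns_nonempty len_zs by (auto simp: d_def)
  define Ki where "Ki i = (\<Prod>j<d - 1 - i. max 1 (D_bound (drop i ns) (drop i zs) j))" for i
  \<comment> \<open>Each coordinate involves a different tail; since all \<open>Ki i\<close> are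
    positive, their sum is one bound serving all of them.\<close>
  define K where "K = (\<Sum>i<d. Ki i)"
  define C where "C = real q powr (- (real q * real (ns ! (d - 1)) / (real q - 1)))"
  have Ki: "1 \<le> Ki i" for i
    unfolding Ki_def by (intro prod_ge_1) auto
  have Ki_le: "Ki i \<le> K" if "i < d" for i
    unfolding K_def using that Ki by (intro member_le_sum) (auto intro: order.trans[of 0 1])
  have "K > 0" "C > 0"
    using Ki[of 0] Ki_le[OF d(1)] real_q by (auto simp: C_def)
  then obtain l where l: "(1 / real q) ^ l < 1 / (real q * C * K)"
    using real_arch_pow_inv[of "1 / (real q * C * K)" "1 / real q"] real_q by auto
  \<comment> \<open>A power of \<open>1/\<theta>\<close> makes the radius arbitrarily small and
    keeps it in the value group.\<close>
  define r where "r = vabs (inverse \<theta> ^ l)"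
  have r: "r \<in> value_group TYPE('c)"
    using theta_nonzero by (auto simp: r_def value_group_def)
  have r_eq: "r = (1 / real q) ^ l"
    by (simp only: r_def vabs_power vabs_inverse vabs_theta inverse_eq_divide[where 'a = real])
  have small: "vabs u * C * K \<le> 1 / real q" if "vabs u \<le> r" for u
  proof -
    have "vabs u \<le> 1 / (real q * C * K)"
      using that l unfolding r_eq by linarith
    then show ?thesis
      using \<open>K > 0\<close> \<open>C > 0\<close> real_q by (simp add: field_simps)
  qed
  have len_drop: "length (drop i zs) = d - 1 - i" "length (drop i ns) = Suc (d - 1 - i)"
    "drop i (zs @ [u]) = drop i zs @ [u]" "drop i ns ! (d - 1 - i) = ns ! (d - 1)" if "i < d" for i u
    using that d by (auto simp: d_def)
  have D: "drop i (zs @ [u]) \<in> D_star q (drop i ns)"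
    and Li_le: "vabs (Li_star q \<theta> (drop i ns) (drop i (zs @ [u]))) \<le> vabs \<pi> ^ sum_list (drop i ns) / real q"
    if "i < d" "vabs u \<le> r" for i u
    using in_D_star_if_small[of "drop i zs" "d - 1 - i" "drop i ns" K u]
      vabs_Li_star_le[of "drop i zs" "d - 1 - i" "drop i ns" K u]
      len_drop[OF that(1)] Ki_le[OF that(1)] small[OF that(2)] by (auto simp: Ki_def C_def \<pi>_def)
  obtain F where F: "star_solution q (Y_seq q \<theta> lam ns (zs @ [z])) F"
    using star_solution_exists[of "Y_seq q \<theta> lam ns (zs @ [z])"] Y_in_T
      len_Y real_q
    by (metis tate_algebra_eq tate_radius_mono zero_le_one)
  define v where "v = sol_value F"
  define \<psi> where "\<psi> u i = \<pi> ^ sum_list (take i ns) * Li_star q \<theta> (drop i ns) (drop i (zs @ [u]))" for u i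
  \<comment> \<open>The centre of the polydisk is the value \<open>v\<close> of any solution at
    \<open>z\<close>; the variation with \<open>x\<close> is carried by the convergent series at
    \<open>x - z\<close>.\<close>
  define \<phi> where "\<phi> x = vec d (\<lambda>i. v $ i + \<psi> (x - z) i)" for x
  define R where "R = vec d (\<lambda>_. vabs (\<pi> ^ sum_list ns / \<theta>))"
  have dim_v: "dim_vec v = d"
    by (simp add: v_def sol_value_def d_def)
  have psi_le: "vabs (\<psi> u i) \<le> vabs (\<pi> ^ sum_list ns / \<theta>)" if "i < d" "vabs u \<le> r" for u i
  proof -
    have "vabs (\<psi> u i) \<le> vabs \<pi> ^ sum_list (take i ns) * (vabs \<pi> ^ sum_list (drop i ns) / real q)"
      unfolding \<psi>_def dist_mult_zero vabs_power using Li_le[OF that] by (rule mult_left_mono) simp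
    also have "\<dots> = vabs \<pi> ^ (sum_list (take i ns) + sum_list (drop i ns)) / real q"
      by (simp add: power_add)
    also have "sum_list (take i ns) + sum_list (drop i ns) = sum_list ns"
      by (simp flip: sum_list_append)
    finally show ?thesis
      by (simp add: vabs_divide vabs_power vabs_theta)
  qed
  have \<pi>: "\<pi> \<noteq> 0"
    unfolding \<pi>_def by (rule period_nonzero)
  have R_less: "R $ i < vabs (period_power)" if "i < d" for i
  proof -
    have "R $ i = vabs \<pi> ^ sum_list ns / real q"
      using that by (simp add: R_def vabs_divide vabs_power vabs_theta)
    also have "\<dots> < vabs \<pi> ^ sum_list ns"
      using \<pi> real_q by (simp add: field_simps)
    finally show ?thesis
      by (simp add: period_power_def vabs_power flip: \<pi>_def)
  qed
  have in_ball: "vabs (x - z) \<le> r" if "x \<in> cball z r" for x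
    using that by (simp add: mem_cball_vabs_iff del: mem_cball)
  have "\<phi> x \<in> polydisk v R" if "x \<in> cball z r" for x
  proof -
    have "dist (v $ i) (v $ i + \<psi> (x - z) i) \<le> R $ i" if i: "i < d" for i
      using psi_le[OF i in_ball[OF \<open>x \<in> cball z r\<close>]] i
      by (simp add: R_def dist_eq_dist_diff[of "v $ i"])
    then show ?thesis
      by (simp add: polydisk_def \<phi>_def dim_v)
  qed
  moreover have "residue_class Mon (\<phi> x) =
      vec_Li_star q \<theta> lam ns Mon (zs @ [x])" if x: "x \<in> cball z r" for x
  proof -
    obtain E where E: "star_solution q (Y_seq q \<theta> lam ns (zs @ [x - z])) E"
      "sol_value E = vec d (\<psi> (x - z))"
      using series_solution[of "x - z", OF D[OF _ in_ball[OF x]]]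
      unfolding d_def \<psi>_def \<pi>_def by auto
    let ?H = "\<lambda>j. if j = 0 then 1 else F j + E j"
    have sum: "star_solution q (Y_seq q \<theta> lam ns (zs @ [x])) ?H"
      using sum_solution[OF F E(1)] by simp
    have F_in: "F j \<in> tate_radius (real q)" and E_in: "E j \<in> tate_radius (real q)" if "j \<le> d" for j
      using star_solution_in_tate_radius[OF F] star_solution_in_tate_radius[OF E(1)] that
        Y_in_T len_Y by (auto simp: d_def)
    have "sol_value ?H $ i = \<phi> x $ i" if i: "i < d" for i
    proof -
      have "sol_value ?H $ i = v $ i + sol_value E $ i"
        using i F_in[of "d - i"] E_in[of "d - i"] vabs_theta
        by (simp add: v_def sol_value_def d_def distrib_left eval_at_add[where \<rho> = "real q"])
      then show ?thesis
        using i by (simp add: E(2) \<phi>_def)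
    qed
    then have "sol_value ?H = \<phi> x"
      by (intro eq_vecI) (auto simp: \<phi>_def sol_value_def d_def)
    then show ?thesis
      using vec_Li_star_eq[OF sum] by simp
  qed
  moreover have "rigid_analytic_on_cball z r (\<lambda>x. \<phi> x $ i)" if i: "i < d" for i
  proof -
    obtain c where c: "c 0 = 0" "\<And>u. drop i zs @ [u] \<in> D_star q (drop i ns) \<Longrightarrow>
        (\<lambda>k. c k * u ^ k) sums Li_star q \<theta> (drop i ns) (drop i zs @ [u])"
      using Li_star_power_series[OF len_drop(1,2)[OF i]] by blast
    \<comment> \<open>Coefficient \<open>0\<close> absorbs the coordinate of the centre, so the
      expansion is one around \<open>z\<close>.\<close>
    define c' where "c' k = (if k = 0 then v $ i else 0) + \<pi> ^ sum_list (take i ns) * c k" for k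
    show ?thesis
    proof (rule rigid_analytic_on_cballI[OF r])
      fix u :: 'c assume u: "vabs u \<le> r"
      have "(\<lambda>k. c k * u ^ k) sums Li_star q \<theta> (drop i ns) (drop i (zs @ [u]))"
        using c(2)[of u] D[OF i u] len_drop(3)[OF i, of u] by simp
      then have "(\<lambda>k. \<pi> ^ sum_list (take i ns) * (c k * u ^ k)) sums \<psi> u i"
        unfolding \<psi>_def by (rule nonarch_sums_mult)
      moreover have "(\<lambda>k. if k = 0 then v $ i else 0) sums (v $ i)"
        using sums_single[of 0 "\<lambda>_. v $ i"] by simp
      ultimately have "(\<lambda>k. (if k = 0 then v $ i else 0) + \<pi> ^ sum_list (take i ns) * (c k * u ^ k))
          sums (v $ i + \<psi> u i)"
        by (intro sums_add)
      also have "(\<lambda>k. (if k = 0 then v $ i else 0) + \<pi> ^ sum_list (take i ns) * (c k * u ^ k)) =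
          (\<lambda>k. c' k * u ^ k)"
        by (auto simp: c'_def fun_eq_iff algebra_simps)
      finally show "(\<lambda>k. c' k * u ^ k) sums (\<phi> (z + u) $ i)"
        using i by (simp add: \<phi>_def)
    qed
  qed
  moreover have "inj_on (residue_class Mon) (polydisk v R)"
    using dim_v R_less by (intro polydisk_injects) (simp_all add: d_def)
  moreover have "z \<in> cball z r"
    by (simp add: r_def)
  moreover have "\<forall>i<d. R $ i \<in> value_group TYPE('c)"
    using \<pi> theta_nonzero by (auto simp: R_def value_group_def)
  moreover have "dim_vec R = d"
    by (simp add: R_def)
  ultimately show ?thesis
    using r dim_v unfolding d_def
    by (intro exI[of _ z] exI[of _ r] exI[of _ v] exI[of _ R] exI[of _ \<phi>]) blast
qed

end

end

theorem theorem1p15: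
  fixes \<iota> :: "'k::{field,finite} fls alg_closure \<Rightarrow> 'c::{nonarch_field,complete_space}"
    and q d :: nat and \<theta> lam :: 'c
    and ns :: "nat list" and zs :: "'c list"
    and G :: "nat \<Rightarrow> nat \<Rightarrow> 'c fps" and M :: "'c vec set"
  assumes "C_infinity \<iota>"
    and "q = CARD('k)"
    and "\<theta> = \<iota> (to_ac fls_X_inv)"
    and "lam ^ (q - 1) = - \<theta>"
    and "d \<ge> 1" and "length ns = d" and "length zs = d - 1"
    and "\<And>k. k < d \<Longrightarrow> star_solution q (take k (Y_seq q \<theta> lam ns zs)) (G k)"
    and "M = monodromy_module \<iota> lam ns G"
  shows
    "(\<forall>z. zs @ [z] \<in> D_star q ns \<and>
          (\<forall>i\<in>{1..<d}. drop i (zs @ [z]) \<in> D_star q (drop i ns)) \<longrightarrow>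
        vec_Li_star q \<theta> lam ns M (zs @ [z]) =
        residue_class M (vec d (\<lambda>i. carlitz_period q \<theta> lam ^ sum_list (take i ns) *
                                     Li_star q \<theta> (drop i ns) (drop i (zs @ [z]))))) \<and>
     (\<forall>z. \<exists>a r c R \<phi>.
        r \<in> value_group TYPE('c) \<and> z \<in> cball a r \<and>
        dim_vec c = d \<and> dim_vec R = d \<and> (\<forall>i<d. R $ i \<in> value_group TYPE('c)) \<and>
        inj_on (residue_class M) (polydisk c R) \<and>
        (\<forall>x\<in>cball a r. \<phi> x \<in> polydisk c R \<and>
           residue_class M (\<phi> x) = vec_Li_star q \<theta> lam ns M (zs @ [x])) \<and>
        (\<forall>i<d. rigid_analytic_on_cball a r (\<lambda>x. \<phi> x $ i)))"
proof -
  interpret C_infinity \<iota>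
    by fact
  interpret carlitz_setup \<iota> q \<theta> lam
    by standard fact+
  have ns: "ns \<noteq> []" and len: "length zs = length ns - 1"
    and G: "\<And>k. k < length ns \<Longrightarrow> star_solution q (take k (Y_seq q \<theta> lam ns zs)) (G k)"
    using assms by auto
  show ?thesis
  proof (intro conjI allI impI)
    fix z
    assume D: "zs @ [z] \<in> D_star q ns \<and> (\<forall>i\<in>{1..<d}. drop i (zs @ [z]) \<in> D_star q (drop i ns))"
    have "drop i (zs @ [z]) \<in> D_star q (drop i ns)" if "i < length ns" for i
      using D that assms(6) by (cases "i = 0") auto
    from vec_Li_star_congruent[OF ns len G this]
    show "vec_Li_star q \<theta> lam ns M (zs @ [z]) =
        residue_class M (vec d (\<lambda>i. carlitz_period q \<theta> lam ^ sum_list (take i ns) *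
                                     Li_star q \<theta> (drop i ns) (drop i (zs @ [z]))))"
      by (simp add: assms(6,9))
  next
    fix z
    show "\<exists>a r c R \<phi>.
        r \<in> value_group TYPE('c) \<and> z \<in> cball a r \<and>
        dim_vec c = d \<and> dim_vec R = d \<and> (\<forall>i<d. R $ i \<in> value_group TYPE('c)) \<and>
        inj_on (residue_class M) (polydisk c R) \<and>
        (\<forall>x\<in>cball a r. \<phi> x \<in> polydisk c R \<and>
           residue_class M (\<phi> x) = vec_Li_star q \<theta> lam ns M (zs @ [x])) \<and>
        (\<forall>i<d. rigid_analytic_on_cball a r (\<lambda>x. \<phi> x $ i))"
      using vec_Li_star_locally_analytic[OF ns len G, of z] unfolding assms(6,9) .
  qed
qed

end
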